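(* Let $0<\gamma\leq 1$, $1<q\leq\alpha<p\leq\infty$ and $w\in\mathcal A_{q}$. Then the operator $S_{\gamma}$ is bounded in $(L^{q}_{w},L^{p})^{\alpha}(\mathbb R^{n})$; that is, there exists a constant $C>0$ such that $\left\|S_{\gamma}(f)\right\|_{q_{w},p,\alpha}\leq C\left\|f\right\|_{q_{w},p,\alpha}$ for all $f\in (L^{q}_{w},L^{p})^{\alpha}(\mathbb R^{n})$.
   Context: A weight $w$ on $\mathbb R^n$ is a positive locally integrable function on $\mathbb R^{n}$, and $w(E)=\int_{E}w(x)\,dx$. $B(y,r)$ is the open ball of $\mathbb R^n$ centered at $y$ with radius $r$, and $|E|$ is the Lebesgue measure of $E$. For $1<q<\infty$, $w\in\mathcal A_{q}$ means that there is a constant $C>0$ such that for all balls $B\subset\mathbb R^{n}$, $$\left(\frac{1}{|B|}\int_{B}w(x)\,dx\right)\left(\frac{1}{|B|}\int_{B}w(x)^{\frac{-1}{q-1}}\,dx\right)^{q-1}\leq C.$$ Put $\|f\|_{q_{w}}=\left(\int_{\mathbb R^{n}}|f(x)|^{q}w(x)\,dx\right)^{1/q}$. For $1\leq q\leq\alpha\leq p\leq\infty$, with the convention $\frac1\infty=0$, the space $(L^{q}_{w},L^{p})^{\alpha}(\mathbb R^{n})$ consists of the measurable functions $f$ on $\mathbb R^n$ such that $\|f\|_{q_{w},p,\alpha}<\infty$, where $$\|f\|_{q_{w},p,\alpha}:=\sup_{r>0}\left[\int_{\mathbb R^{n}}\left(w(B(y,r))^{\frac{1}{\alpha}-\frac{1}{q}-\frac{1}{p}}\left\|f\chi_{B(y,r)}\right\|_{q_{w}}\right)^{p}dy\right]^{\frac{1}{p}},$$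 with the usual modification (essential supremum over $y\in\mathbb R^n$) when $p=\infty$; $\chi_E$ is the characteristic function of $E$. For $0<\gamma\leq 1$, $\mathcal C_{\gamma}$ is the family of functions $\varphi$ defined on $\mathbb R^{n}$ with support in the closed unit ball $\{x\in\mathbb R^n:|x|\leq 1\}$, with $\int_{\mathbb R^{n}}\varphi(x)\,dx=0$, and such that $|\varphi(x)-\varphi(x')|\leq|x-x'|^{\gamma}$ for all $x,x'\in\mathbb R^{n}$. Put $\varphi_{t}(x)=t^{-n}\varphi(t^{-1}x)$ for $t>0$. The intrinsic square function of $f$ of order $\gamma$ is $$S_{\gamma}(f)(x)=\left[\int_{\Gamma(x)}\left(\sup_{\varphi\in\mathcal C_{\gamma}}|f\ast\varphi_{t}(y)|\right)^{2}\frac{dy\,dt}{t^{n+1}}\right]^{\frac{1}{2}},\qquad \Gamma(x)=\{(y,t)\in\mathbb R^{n}\times(0,\infty):|x-y|<t\}.$$ *)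

theory Defs
  imports "HOL-Probability.Essential_Supremum"
begin

text \<open>
  $\mathbb R^n$ is an arbitrary Euclidean space, with \<open>n = DIM('a)\<close>. Measurability and integrals refer to
  Lebesgue (not Borel) measure. Functions $f$ and $\varphi$ are complex-valued.
  Quantities that may be infinite are of type \<^typ>\<open>ennreal\<close>, since the Bochner integral of a
  non-integrable function is \<open>0\<close>.
\<close>

text \<open>Only meant for exponents \<open>a > 0\<close>.\<close>
definition ennpow :: "ennreal \<Rightarrow> real \<Rightarrow> ennreal" where
  "ennpow x a = (if x = \<infinity> then \<infinity> else ennreal (enn2real x powr a))"

definition is_weight :: "('a::euclidean_space \<Rightarrow> real) \<Rightarrow> bool" where
  "is_weight w \<longleftrightarrow> (\<forall>x. 0 < w x) \<and> (\<forall>K. compact K \<longrightarrow> set_integrable lebesgue K w)"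

text \<open>Only used for balls \<open>E\<close>, on which a weight is integrable.\<close>
definition weight_of :: "('a::euclidean_space \<Rightarrow> real) \<Rightarrow> 'a set \<Rightarrow> real" where
  "weight_of w E = (LINT x:E|lebesgue. w x)"

definition Muckenhoupt :: "real \<Rightarrow> ('a::euclidean_space \<Rightarrow> real) set" where
  "Muckenhoupt q = {w. is_weight w \<and>
     (\<exists>C::real. C > 0 \<and> (\<forall>z. \<forall>r>0.
        ((\<integral>\<^sup>+x\<in>ball z r. ennreal (w x) \<partial>lebesgue) / emeasure lebesgue (ball z r)) *
        ennpow ((\<integral>\<^sup>+x\<in>ball z r. ennreal (w x powr (- 1 / (q - 1))) \<partial>lebesgue)
                  / emeasure lebesgue (ball z r)) (q - 1)
        \<le> ennreal C))}"

text \<open>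
  The norms below take the modulus of a function as argument, so that they apply both to
  \<open>\<lambda>x. ennreal (norm (f x))\<close> for a complex function \<open>f\<close> and to the \<open>[0,\<infinity>]\<close>-valued square function.
\<close>
definition weighted_norm :: "('a::euclidean_space \<Rightarrow> real) \<Rightarrow> real \<Rightarrow> ('a \<Rightarrow> ennreal) \<Rightarrow> ennreal" where
  "weighted_norm w q g = ennpow (\<integral>\<^sup>+x. ennpow (g x) q * ennreal (w x) \<partial>lebesgue) (1 / q)"

text \<open>The exponent \<open>1 / p\<close>, with the convention \<open>1 / \<infinity> = 0\<close>.\<close>
definition recip :: "ereal \<Rightarrow> real" where
  "recip p = real_of_ereal (1 / p)"

definition Lebesgue_norm :: "ereal \<Rightarrow> ('a::euclidean_space \<Rightarrow> ennreal) \<Rightarrow> ennreal" where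
  "Lebesgue_norm p h =
     (if p = \<infinity> then esssup lebesgue h
      else ennpow (\<integral>\<^sup>+y. ennpow (h y) (real_of_ereal p) \<partial>lebesgue) (recip p))"

definition amalgam_norm ::
    "('a::euclidean_space \<Rightarrow> real) \<Rightarrow> real \<Rightarrow> ereal \<Rightarrow> real \<Rightarrow> ('a \<Rightarrow> ennreal) \<Rightarrow> ennreal" where
  "amalgam_norm w q p \<alpha> g =
     (SUP r\<in>{0<..}. Lebesgue_norm p (\<lambda>y.
        ennreal (weight_of w (ball y r) powr (1 / \<alpha> - 1 / q - recip p)) *
        weighted_norm w q (\<lambda>x. g x * indicator (ball y r) x)))"

definition amalgam_space ::
    "('a::euclidean_space \<Rightarrow> real) \<Rightarrow> real \<Rightarrow> ereal \<Rightarrow> real \<Rightarrow> ('a \<Rightarrow> complex) set" where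
  "amalgam_space w q p \<alpha> =
     {f \<in> borel_measurable lebesgue. amalgam_norm w q p \<alpha> (\<lambda>x. ennreal (norm (f x))) < \<infinity>}"

definition test_class :: "real \<Rightarrow> ('a::euclidean_space \<Rightarrow> complex) set" where
  "test_class \<gamma> = {\<phi>. closure {x. \<phi> x \<noteq> 0} \<subseteq> cball 0 1 \<and>
     (LINT x|lebesgue. \<phi> x) = 0 \<and>
     (\<forall>x x'. norm (\<phi> x - \<phi> x') \<le> norm (x - x') powr \<gamma>)}"

definition dilate :: "real \<Rightarrow> ('a::euclidean_space \<Rightarrow> complex) \<Rightarrow> 'a \<Rightarrow> complex" where
  "dilate t \<phi> x = complex_of_real (1 / t ^ DIM('a)) * \<phi> ((1 / t) *\<^sub>R x)"

definition convol :: "('a::euclidean_space \<Rightarrow> complex) \<Rightarrow> ('a \<Rightarrow> complex) \<Rightarrow> 'a \<Rightarrow> complex" where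
  "convol f g y = (LINT z|lebesgue. f z * g (y - z))"

definition cone :: "'a::euclidean_space \<Rightarrow> ('a \<times> real) set" where
  "cone x = {(y, t). 0 < t \<and> norm (x - y) < t}"

definition intrinsic_square :: "real \<Rightarrow> ('a::euclidean_space \<Rightarrow> complex) \<Rightarrow> 'a \<Rightarrow> ennreal" where
  "intrinsic_square \<gamma> f x =
     ennpow (\<integral>\<^sup>+yt\<in>cone x.
        (SUP \<phi>\<in>test_class \<gamma>. ennreal (norm (convol f (dilate (snd yt) \<phi>) (fst yt))))\<^sup>2 *
        ennreal (1 / snd yt ^ (DIM('a) + 1)) \<partial>lebesgue) (1 / 2)"

end

theory Submission
  imports Defs
begin

text \<open>
  The square function is compared with square sums over dyadic grids. For these a weighted bound follows from a
  good-lambda inequality, and reverse doubling of the weight handles the interaction of distant scales.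

  If \<open>(z, t)\<close> lies in the cone over \<open>x\<close>, then the kernels that are paired with \<open>f\<close> in
  \<open>f * \<phi>\<^sub>t(z)\<close> are supported in the ball of radius \<open>2 * t\<close> about \<open>x\<close>. By the one-third trick
  (\<open>ball_subset_grid_cube\<close>), one of finitely many shifted dyadic grids has a cube \<open>Q\<close> around \<open>x\<close>, of side comparable to
  \<open>t\<close>, that contains this ball. Hence \<open>|f * \<phi>\<^sub>t(z)|\<close> is bounded by the oscillation of \<open>f\<close> on \<open>Q\<close>, the supremum of
  the pairings of \<open>f\<close> with Hoelder bumps of mean zero that live on \<open>Q\<close>, divided by the volume of \<open>Q\<close>. For \<open>x\<close> in a ball
  \<open>B(y,r)\<close>, the heights below a multiple of \<open>r\<close> involve only \<open>f\<close> on \<open>B(y,2r)\<close>, and the larger heights are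
  bounded by averages of \<open>|f|\<close> over the balls \<open>B(y,2\<^sup>ir)\<close> (\<open>area_integral_le\<close>).

  Bumps that vanish outside their cube confine the weighted estimate of the square sums to nested cubes.
  Almost orthogonality of bumps at different scales gives an \<open>L\<^sup>2\<close> bound (\<open>osc_square_integral\<close>). With a
  Calderon--Zygmund decomposition it shows that, inside a cube, the square sum over smaller cubes exceeds \<open>\<mu>\<^sup>2\<close>
  while the dyadic maximal function stays below \<open>h\<close> only on a small portion of the cube if \<open>h / \<mu>\<close> is small
  (\<open>local_good_set\<close>). By the \<open>A\<^sub>q\<close> condition, a subset of at most half the measure of a cube carries at most a
  fraction \<open>\<theta> < 1\<close> of its weight (\<open>half_cube_weight\<close>). The resulting good-lambda inequality compares the levels \<open>a * t\<close> and
  \<open>t\<close> with \<open>a\<close> so close to \<open>1\<close> that \<open>\<theta> * a powr q < 1\<close>, and it integrates to a bound of the square sum by the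
  dyadic maximal function in weighted \<open>L\<^sup>q\<close> (\<open>square_sum_bounded\<close>). The maximal function is bounded there because it is
  dominated pointwise by a composition of the maximal functions of \<open>w\<close> and of its dual weight (\<open>maxf_pointwise\<close>).

  It remains to sum the contributions of the averages. The average of \<open>|f|\<close> over \<open>B(y,2\<^sup>ir)\<close> is controlled
  by the weighted norm of \<open>f\<close> on this ball and a power of its weight, and \<open>w(B(y,r))\<close> is at most a geometrically decreasing multiple of \<open>w(B(y,2\<^sup>ir))\<close>. Since
  \<open>1 / \<alpha> - 1 / p\<close> is positive, the function of \<open>y\<close> whose norm defines the amalgam norm of the square function at radius \<open>r\<close>
  is therefore dominated by a geometric series of the corresponding functions for \<open>f\<close> at the radii \<open>2\<^sup>ir\<close>
  (\<open>amalgam_local_bound\<close>), and such a series is summed in \<open>L\<^sup>p\<close> (\<open>Lebesgue_norm_geometric_sum\<close>).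
\<close>

section \<open>Powers of extended nonnegative numbers\<close>

lemma ennpow_ennreal: "0 \<le> x \<Longrightarrow> ennpow (ennreal x) a = ennreal (x powr a)"
  by (simp add: ennpow_def)

lemma ennpow_top [simp]: "ennpow top a = top"
  by (simp add: ennpow_def)

lemma ennpow_zero [simp]: "ennpow 0 a = 0"
  by (simp add: ennpow_def)

lemma ennpow_one [simp]: "ennpow x 1 = x"
  by (cases x) (auto simp: ennpow_ennreal)

lemma ennpow_eq_0_iff [simp]: "ennpow x a = 0 \<longleftrightarrow> x = 0"
  by (cases x) (auto simp: ennpow_ennreal)

lemma ennpow_eq_top_iff [simp]: "ennpow x a = top \<longleftrightarrow> x = top"
  by (cases x) (auto simp: ennpow_ennreal)

lemma ennpow_less_top_iff [simp]: "ennpow x a < top \<longleftrightarrow> x < top"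
  by (cases x) (auto simp: ennpow_ennreal)

lemma ennpow_ennpow: "ennpow (ennpow x a) b = ennpow x (a * b)"
  by (cases x) (auto simp: ennpow_ennreal powr_powr)

lemma ennpow_mono: "0 \<le> a \<Longrightarrow> x \<le> y \<Longrightarrow> ennpow x a \<le> ennpow y a"
  by (cases x; cases y) (auto simp: ennpow_ennreal powr_mono2 top_unique intro!: ennreal_leI)

lemma ennpow_mult: "0 < a \<Longrightarrow> ennpow (x * y) a = ennpow x a * ennpow y a"
  by (cases x; cases y)
    (auto simp: ennpow_ennreal powr_mult ennreal_mult_top ennreal_top_mult simp flip: ennreal_mult)

lemma ennpow_add: "x \<noteq> 0 \<Longrightarrow> ennpow x a * ennpow x b = ennpow x (a + b)"
  by (cases x) (auto simp: ennpow_ennreal powr_add simp flip: ennreal_mult)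

lemma ennpow_two: "ennpow x 2 = x\<^sup>2"
  by (cases x) (auto simp: ennpow_ennreal ennreal_power)

text \<open>
  Raising to a positive power is an order isomorphism, which is why suprema commute with it.
\<close>

lemma ennpow_le_iff: "0 < a \<Longrightarrow> ennpow x a \<le> y \<longleftrightarrow> x \<le> ennpow y (1 / a)"
  using ennpow_mono[of "1 / a" "ennpow x a" y] ennpow_mono[of a x "ennpow y (1 / a)"]
  by (auto simp: ennpow_ennpow)

lemma ennpow_SUP: "0 < a \<Longrightarrow> ennpow (SUP i\<in>I. f i) a = (SUP i\<in>I. ennpow (f i) a)"
proof (intro antisym)
  assume a: "0 < a"
  show "ennpow (SUP i\<in>I. f i) a \<le> (SUP i\<in>I. ennpow (f i) a)"
    unfolding ennpow_le_iff[OF a] 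
  proof (intro SUP_least)
    fix i assume "i \<in> I"
    then show "f i \<le> ennpow (SUP i\<in>I. ennpow (f i) a) (1 / a)"
      unfolding ennpow_le_iff[OF a, symmetric] by (rule SUP_upper)
  qed
qed (auto intro!: SUP_least ennpow_mono SUP_upper)

lemma borel_measurable_ennpow [measurable]: "(\<lambda>x. ennpow x a) \<in> borel_measurable borel"
  unfolding ennpow_def by measurable

text \<open>
  A sum of \<open>N\<close> terms is at most \<open>N\<close> times the largest one.
\<close>

lemma ennpow_sum_le:
  assumes "finite I" "0 < a"
  shows "ennpow (\<Sum>i\<in>I. f i) a \<le> ennreal (real (card I) powr a) * (\<Sum>i\<in>I. ennpow (f i) a)"
proof (cases "I = {}")
  case False
  define m where "m = Max (f ` I)"
  have m: "m \<in> f ` I" "\<And>i. i \<in> I \<Longrightarrow> f i \<le> m"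
    using assms False by (auto simp: m_def)
  then obtain j where j: "j \<in> I" "m = f j" by auto
  have "(\<Sum>i\<in>I. f i) \<le> of_nat (card I) * m"
    using m by (intro sum_bounded_above) auto
  then have "ennpow (\<Sum>i\<in>I. f i) a \<le> ennpow (of_nat (card I) * m) a"
    using assms by (intro ennpow_mono) auto
  also have "\<dots> = ennreal (real (card I) powr a) * ennpow (f j) a"
    using assms by (simp add: ennpow_mult j ennreal_of_nat_eq_real_of_nat ennpow_ennreal)
  also have "\<dots> \<le> ennreal (real (card I) powr a) * (\<Sum>i\<in>I. ennpow (f i) a)"
    using assms j by (intro mult_left_mono member_le_sum) auto
  finally show ?thesis .
qed simp

lemma ennpow_add_le:
  assumes "0 < a"
  shows "ennpow (x + y) a \<le> ennreal (2 powr a) * (ennpow x a + ennpow y a)"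
  using ennpow_sum_le[of "{True, False}" a "\<lambda>b. if b then x else y"] assms by simp

section \<open>Hoelder inequality and layer-cake formula\<close>

text \<open>
  Young's inequality, with the factors normalized by \<open>X\<close> and \<open>Y\<close>. When
  these are the integrals of the two powers, the right-hand side integrates to \<open>X powr (1 / q)
  * Y powr (1 - 1 / q)\<close>, and this is the inequality of Hoelder.
\<close>

lemma Young_ennreal:
  fixes f g :: ennreal
  assumes q: "1 < q" and X: "0 < X" "0 < Y"
  shows "f * g \<le> ennreal (X powr (1 / q) * Y powr (1 - 1 / q)) *
    (ennpow f q * ennreal (1 / (q * X)) + ennpow g (q / (q - 1)) * ennreal ((1 - 1 / q) / Y))"
proof (cases "f = top \<or> g = top")
  case True
  then show ?thesis using q X by (auto simp: ennreal_top_mult ennreal_mult_top)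
next
  case False
  then obtain a b where ab: "f = ennreal a" "g = ennreal b" "0 \<le> a" "0 \<le> b"
    by (metis ennreal_cases)
  let ?x = "X powr (1 / q)" and ?y = "Y powr (1 - 1 / q)"
  have "(a / ?x) * (b / ?y) \<le> (a / ?x) powr q / q + (b / ?y) powr (q / (q - 1)) / (q / (q - 1))"
    using q X ab by (intro Youngs_inequality) (auto simp: field_simps)
  also have "(a / ?x) powr q = a powr q / X"
    using q X ab by (simp add: powr_divide powr_powr)
  also have "(b / ?y) powr (q / (q - 1)) = b powr (q / (q - 1)) / Y"
  proof -
    have "(1 - 1 / q) * (q / (q - 1)) = 1" using q by (simp add: field_simps)
    then have "?y powr (q / (q - 1)) = Y" using X by (simp only: powr_powr) simp
    then show ?thesis using X ab by (simp only: powr_divide)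
  qed
  finally have le: "?x * ?y * ((a / ?x) * (b / ?y)) \<le>
      ?x * ?y * (a powr q / X / q + b powr (q / (q - 1)) / Y / (q / (q - 1)))"
    using X by (intro mult_left_mono) auto
  have 1: "?x * ?y * ((a / ?x) * (b / ?y)) = a * b"
    using X by simp
  have 2: "a powr q / X / q = a powr q * (1 / (q * X))"
    by simp
  have 3: "b powr (q / (q - 1)) / Y / (q / (q - 1)) = b powr (q / (q - 1)) * ((1 - 1 / q) / Y)"
    using q X by (simp add: field_simps)
  have *: "a * b \<le> ?x * ?y * (a powr q * (1 / (q * X)) + b powr (q / (q - 1)) * ((1 - 1 / q) / Y))"
    using le unfolding 1 2 3 .
  show ?thesis
    using * q X ab
    by (simp add: ennpow_ennreal flip: ennreal_mult ennreal_plus)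
qed

lemma Hoelder_nn_integral:
  fixes f g :: "'a \<Rightarrow> ennreal"
  assumes q: "1 < q" and [measurable]: "f \<in> borel_measurable M" "g \<in> borel_measurable M"
  shows "ennpow (\<integral>\<^sup>+x. f x * g x \<partial>M) q
    \<le> (\<integral>\<^sup>+x. ennpow (f x) q \<partial>M) * ennpow (\<integral>\<^sup>+x. ennpow (g x) (q / (q - 1)) \<partial>M) (q - 1)"
    (is "_ \<le> ?X * ennpow ?Y _")
proof (cases "?X = 0 \<or> ?Y = 0")
  case True
  then have "AE x in M. f x * g x = 0"
    by (auto simp: nn_integral_0_iff_AE)
  then have "(\<integral>\<^sup>+x. f x * g x \<partial>M) = 0"
    by (subst nn_integral_0_iff_AE) auto
  then show ?thesis by simp
next
  case False
  show ?thesis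
  proof (cases "?X = top \<or> ?Y = top")
    case True
    then show ?thesis using False by (auto simp: ennreal_top_mult ennreal_mult_top)
  next
    case fin: False
    obtain X where X: "?X = ennreal X" "0 < X"
      using False fin by (cases ?X) (auto simp: less_le)
    obtain Y where Y: "?Y = ennreal Y" "0 < Y"
      using False fin by (cases ?Y) (auto simp: less_le)
    let ?c = "X powr (1 / q) * Y powr (1 - 1 / q)"
    have "(\<integral>\<^sup>+x. f x * g x \<partial>M) \<le> (\<integral>\<^sup>+x. ennreal ?c *
      (ennpow (f x) q * ennreal (1 / (q * X)) + ennpow (g x) (q / (q - 1)) * ennreal ((1 - 1 / q) / Y)) \<partial>M)"
      using q X Y by (intro nn_integral_mono Young_ennreal) auto
    also have "\<dots> = ennreal ?c * (?X * ennreal (1 / (q * X)) + ?Y * ennreal ((1 - 1 / q) / Y))"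
      by (simp add: nn_integral_cmult nn_integral_multc nn_integral_add)
    also have "\<dots> = ennreal ?c * ennreal (X * (1 / (q * X)) + Y * ((1 - 1 / q) / Y))"
      unfolding X(1) Y(1) using q X Y by (simp del: times_divide_eq_right flip: ennreal_mult ennreal_plus)
    also have "X * (1 / (q * X)) + Y * ((1 - 1 / q) / Y) = 1"
      using q X Y by (simp add: field_simps)
    finally have "ennpow (\<integral>\<^sup>+x. f x * g x \<partial>M) q \<le> ennpow (ennreal ?c) q"
      using q by (intro ennpow_mono) auto
    also have "\<dots> = ennreal (X * Y powr (q - 1))"
      using q X Y by (simp add: ennpow_ennreal powr_mult powr_powr left_diff_distrib)
    also have "\<dots> = ?X * ennpow ?Y (q - 1)"
      unfolding X(1) Y(1) using X(2) Y(2) by (simp add: ennpow_ennreal ennreal_mult)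
    finally show ?thesis .
  qed
qed

text \<open>
  The power is the integral of its derivative over the levels below its value.
\<close>

lemma ennpow_layers:
  assumes p: "0 < p"
  shows "ennpow G p = (\<integral>\<^sup>+t. ennreal (p * t powr (p - 1)) * indicator {0<..} t *
    indicator {t. ennreal t < G} t \<partial>lborel)"
proof -
  have real: "(\<integral>\<^sup>+t. ennreal (p * t powr (p - 1)) * indicator {0<..<g} t \<partial>lborel) = ennreal (g powr p)"
    if g: "0 \<le> g" for g :: real
  proof -
    have "((\<lambda>x. p * x powr (p - 1)) has_integral (p * (g powr (p - 1 + 1) / (p - 1 + 1)))) {0..g}"
      using p g by (intro has_integral_mult_right has_integral_powr_from_0) auto
    then have "((\<lambda>x. p * x powr (p - 1)) has_integral (g powr p)) {0..g}"
      using p by simp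
    then have "((\<lambda>x. if x \<in> {0..g} then p * x powr (p - 1) else 0) has_integral (g powr p)) UNIV"
      by (simp only: has_integral_restrict_UNIV)
    then have "(\<integral>\<^sup>+t. ennreal (if t \<in> {0..g} then p * t powr (p - 1) else 0) \<partial>lborel) = ennreal (g powr p)"
      using p by (intro nn_integral_has_integral_lborel) auto
    also have "(\<integral>\<^sup>+t. ennreal (if t \<in> {0..g} then p * t powr (p - 1) else 0) \<partial>lborel) =
       (\<integral>\<^sup>+t. ennreal (p * t powr (p - 1)) * indicator {0<..<g} t \<partial>lborel)"
    proof (intro nn_integral_cong_AE)
      have "AE t in lborel. t \<noteq> 0 \<and> t \<noteq> g"
        using AE_lborel_singleton[of 0] AE_lborel_singleton[of g] by auto
      then show "AE t in lborel. ennreal (if t \<in> {0..g} then p * t powr (p - 1) else 0) =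
        ennreal (p * t powr (p - 1)) * indicator {0<..<g} t"
        by (auto split: split_indicator)
    qed
    finally show ?thesis .
  qed
  show ?thesis
  proof (cases G)
    case (real g)
    have "(\<integral>\<^sup>+t. ennreal (p * t powr (p - 1)) * indicator {0<..} t * indicator {t. ennreal t < G} t \<partial>lborel)
      = (\<integral>\<^sup>+t. ennreal (p * t powr (p - 1)) * indicator {0<..<g} t \<partial>lborel)"
      using real by (intro nn_integral_cong) (auto simp: ennreal_less_iff split: split_indicator)
    then show ?thesis using \<open>\<And>g. 0 \<le> g \<Longrightarrow> _\<close>[of g] real by (simp add: ennpow_ennreal)
  next
    case top
    have "top \<le> (\<integral>\<^sup>+t. ennreal (p * t powr (p - 1)) * indicator {0<..} t \<partial>lborel)"
    proof (rule ccontr)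
      assume "\<not> ?thesis"
      then obtain c where c: "(\<integral>\<^sup>+t. ennreal (p * t powr (p - 1)) * indicator {0<..} t \<partial>lborel) = ennreal c" "0 \<le> c"
        by (metis ennreal_cases order_refl)
      define g where "g = (c + 1) powr (1 / p)"
      have "ennreal (g powr p) \<le> ennreal c"
        unfolding c(1)[symmetric] real[of g, unfolded g_def, simplified, folded g_def, symmetric]
        by (auto intro!: nn_integral_mono split: split_indicator)
      moreover have "g powr p = c + 1" using p c by (simp add: g_def powr_powr)
      ultimately show False using c by simp
    qed
    then show ?thesis using top by (simp add: top_unique)
  qed
qed

text \<open>
  Tonelli's theorem for the layers of \<open>g\<close>, after replacing the functions by Borel
  functions that agree with them almost everywhere.
\<close>

lemma layer_cake_aux:
  fixes u g :: "'a::euclidean_space \<Rightarrow> ennreal"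
  assumes p: "0 < p" and m: "u \<in> borel_measurable lebesgue" "g \<in> borel_measurable lebesgue"
  shows "(\<integral>\<^sup>+x. ennpow (g x) p * u x \<partial>lebesgue) =
    (\<integral>\<^sup>+t. ennreal (p * t powr (p - 1)) * indicator {0<..} t *
      (\<integral>\<^sup>+x. u x * indicator {x. ennreal t < g x} x \<partial>lebesgue) \<partial>lborel)" (is ?A)
    and "(\<lambda>t. \<integral>\<^sup>+x. u x * indicator {x. ennreal t < g x} x \<partial>lebesgue) \<in> borel_measurable lborel" (is ?B)
proof -
  obtain u' where u': "u' \<in> borel_measurable lborel" "AE x in lborel. u x = u' x"
    using completion_ex_borel_measurable[OF m(1)] by auto
  obtain g' where g': "g' \<in> borel_measurable lborel" "AE x in lborel. g x = g' x"
    using completion_ex_borel_measurable[OF m(2)] by auto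
  have [measurable]: "u' \<in> borel_measurable borel" "g' \<in> borel_measurable borel"
    using u' g' by auto
  have eq: "(\<integral>\<^sup>+x. u x * indicator {x. ennreal t < g x} x \<partial>lebesgue) =
    (\<integral>\<^sup>+x. u' x * indicator {x. ennreal t < g' x} x \<partial>lborel)" for t
    unfolding nn_integral_completion
    by (rule nn_integral_cong_AE, use u'(2) g'(2) in eventually_elim) (auto split: split_indicator)
  show ?B unfolding eq by measurable
  have "(\<integral>\<^sup>+x. ennpow (g x) p * u x \<partial>lebesgue) = (\<integral>\<^sup>+x. ennpow (g' x) p * u' x \<partial>lborel)"
    unfolding nn_integral_completion
    by (rule nn_integral_cong_AE, use u'(2) g'(2) in eventually_elim) auto
  also have "\<dots> = (\<integral>\<^sup>+x. (\<integral>\<^sup>+t. ennreal (p * t powr (p - 1)) * indicator {0<..} t *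
    indicator {t. ennreal t < g' x} t * u' x \<partial>lborel) \<partial>lborel)"
    by (simp add: ennpow_layers[OF p] nn_integral_multc)
  also have "\<dots> = (\<integral>\<^sup>+t. (\<integral>\<^sup>+x. ennreal (p * t powr (p - 1)) * indicator {0<..} t *
    indicator {t. ennreal t < g' x} t * u' x \<partial>lborel) \<partial>lborel)"
    by (intro lborel_pair.Fubini') measurable
  also have "\<dots> = (\<integral>\<^sup>+t. ennreal (p * t powr (p - 1)) * indicator {0<..} t *
      (\<integral>\<^sup>+x. u' x * indicator {x. ennreal t < g' x} x \<partial>lborel) \<partial>lborel)"
    by (intro nn_integral_cong, subst nn_integral_cmult[symmetric], measurable)
       (auto intro!: nn_integral_cong split: split_indicator)
  finally show ?A unfolding eq .
qed

lemmas layer_cake = layer_cake_aux(1)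
lemmas borel_measurable_distribution = layer_cake_aux(2)

text \<open>
  The form in which a good-lambda inequality is integrated: \<open>h\<close> is the function to be
  absorbed, with a constant \<open>c\<close> that will be small compared to the dilation between
  \<open>g\<close> and \<open>h\<close>.
\<close>

lemma nn_integral_ennpow_mono_distribution:
  fixes u g h k :: "'a::euclidean_space \<Rightarrow> ennreal"
  assumes p: "0 < p" and m: "u \<in> borel_measurable lebesgue" "g \<in> borel_measurable lebesgue"
      "h \<in> borel_measurable lebesgue" "k \<in> borel_measurable lebesgue"
    and le: "\<And>t. 0 < t \<Longrightarrow> (\<integral>\<^sup>+x. u x * indicator {x. ennreal t < g x} x \<partial>lebesgue) \<le>
      c * (\<integral>\<^sup>+x. u x * indicator {x. ennreal t < h x} x \<partial>lebesgue) +
      (\<integral>\<^sup>+x. u x * indicator {x. ennreal t < k x} x \<partial>lebesgue)"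
  shows "(\<integral>\<^sup>+x. ennpow (g x) p * u x \<partial>lebesgue) \<le>
    c * (\<integral>\<^sup>+x. ennpow (h x) p * u x \<partial>lebesgue) + (\<integral>\<^sup>+x. ennpow (k x) p * u x \<partial>lebesgue)"
proof -
  note [measurable] = borel_measurable_distribution[OF p m(1,3)] borel_measurable_distribution[OF p m(1,4)]
  have "(\<integral>\<^sup>+x. ennpow (g x) p * u x \<partial>lebesgue) \<le>
    (\<integral>\<^sup>+t. c * (ennreal (p * t powr (p - 1)) * indicator {0<..} t *
      (\<integral>\<^sup>+x. u x * indicator {x. ennreal t < h x} x \<partial>lebesgue)) +
      ennreal (p * t powr (p - 1)) * indicator {0<..} t *
      (\<integral>\<^sup>+x. u x * indicator {x. ennreal t < k x} x \<partial>lebesgue) \<partial>lborel)"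
    unfolding layer_cake[OF p m(1,2)]
  proof (intro nn_integral_mono)
    fix t :: real
    show "ennreal (p * t powr (p - 1)) * indicator {0<..} t *
      (\<integral>\<^sup>+x. u x * indicator {x. ennreal t < g x} x \<partial>lebesgue) \<le>
      c * (ennreal (p * t powr (p - 1)) * indicator {0<..} t *
      (\<integral>\<^sup>+x. u x * indicator {x. ennreal t < h x} x \<partial>lebesgue)) +
      ennreal (p * t powr (p - 1)) * indicator {0<..} t *
      (\<integral>\<^sup>+x. u x * indicator {x. ennreal t < k x} x \<partial>lebesgue)"
    proof (cases "0 < t")
      case True
      then show ?thesis
        using mult_left_mono[OF le[OF True], of "ennreal (p * t powr (p - 1))"]
        by (simp add: distrib_left mult.left_commute)
    qed simp
  qed
  also have "\<dots> = c * (\<integral>\<^sup>+x. ennpow (h x) p * u x \<partial>lebesgue) + (\<integral>\<^sup>+x. ennpow (k x) p * u x \<partial>lebesgue)"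
    unfolding layer_cake[OF p m(1,3)] layer_cake[OF p m(1,4)]
    by (subst nn_integral_add, measurable, subst nn_integral_cmult, measurable)
  finally show ?thesis .
qed

section \<open>Dyadic grids and stopping cubes\<close>

lemma ennreal_divide_mult_cancel: "0 < b \<Longrightarrow> b < top \<Longrightarrow> a / b * b = (a::ennreal)"
  by (simp add: ennreal_divide_times)

text \<open>
  \<open>D k x\<close> is the cube of level \<open>k\<close> that contains \<open>x\<close>; level
  \<open>0\<close> has the largest cubes, of side \<open>L\<close>. Indexing cubes by their points
  turns sums over cubes into integrals of functions that are constant on cubes, and since scales are
  bounded from above, a first (maximal) cube with a given property exists around each point where
  any has it.
\<close>

locale dyadic_grid =
  fixes D :: "nat \<Rightarrow> 'a::euclidean_space \<Rightarrow> 'a set" and L :: real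
  assumes L_pos: "0 < L"
    and mem_cube [simp]: "x \<in> D k x"
    and cube_eq: "y \<in> D k x \<Longrightarrow> D k y = D k x"
    and cube_Suc_subset: "D (Suc k) x \<subseteq> D k x"
    and borel_cube: "D k x \<in> sets borel"
    and emeasure_lborel_cube: "emeasure lborel (D k x) = ennreal ((L / 2 ^ k) ^ DIM('a))"
    and cube_diam: "y \<in> D k x \<Longrightarrow> norm (y - x) \<le> DIM('a) * (L / 2 ^ k)"
    and countable_cubes: "countable (range (D k))"
begin

definition side :: "nat \<Rightarrow> real" where
  "side k = L / 2 ^ k"

lemma side_pos: "0 < side k"
  using L_pos by (simp add: side_def)

lemma side_add: "side (k + j) = side k / 2 ^ j"
  by (simp add: side_def power_add)

lemma cube_mono: "j \<le> k \<Longrightarrow> D k x \<subseteq> D j x"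
  by (induction rule: dec_induct) (use cube_Suc_subset in blast)+

lemma cube_eq_coarser: "j \<le> k \<Longrightarrow> y \<in> D k x \<Longrightarrow> D j y = D j x"
  using cube_mono cube_eq by blast

lemma sets_cube [measurable, simp]: "D k x \<in> sets lebesgue"
  using borel_cube by auto

lemma emeasure_cube: "emeasure lebesgue (D k x) = ennreal (side k ^ DIM('a))"
  using borel_cube emeasure_lborel_cube by (simp add: side_def emeasure_lborel_cube)

lemma nn_integral_cube_const:
  "(\<integral>\<^sup>+y. c * indicator (D k x) y \<partial>lebesgue) = c * ennreal (side k ^ DIM('a))"
  by (simp add: nn_integral_cmult_indicator emeasure_cube)

lemma disjoint_cubes_exhaust:
  assumes E: "\<And>x. x \<in> E \<Longrightarrow> D k x \<subseteq> E"
  obtains A :: "nat \<Rightarrow> 'a set" where "disjoint_family A" "E = (\<Union>i. A i)"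
    "\<And>i. A i = {} \<or> (\<exists>x\<in>E. A i = D k x)"
proof -
  define \<A> where "\<A> = D k ` E"
  have c: "countable \<A>"
    unfolding \<A>_def using countable_cubes[of k] by (rule countable_subset[rotated]) auto
  define A where "A i = \<Union>{P \<in> \<A>. to_nat_on \<A> P = i}" for i
  have one: "{P \<in> \<A>. to_nat_on \<A> P = i} = {} \<or> (\<exists>P\<in>\<A>. {P \<in> \<A>. to_nat_on \<A> P = i} = {P})" for i
    using inj_on_to_nat_on[OF c] by (fastforce simp: inj_on_def)
  have ex: "A i = {} \<or> (\<exists>x\<in>E. A i = D k x)" for i
    using one[of i] by (auto simp: A_def \<A>_def)
  have "disjoint_family A"
  proof (unfold disjoint_family_on_def, safe)
    fix i j x assume ij: "i \<noteq> j" and x: "x \<in> A i" "x \<in> A j"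
    then obtain P Q where "P \<in> \<A>" "to_nat_on \<A> P = i" "x \<in> P" "Q \<in> \<A>" "to_nat_on \<A> Q = j" "x \<in> Q"
      by (auto simp: A_def)
    moreover from this have "P = Q"
      unfolding \<A>_def using cube_eq by blast
    ultimately show "x \<in> {}" using ij by simp
  qed
  moreover have "E = (\<Union>i. A i)"
  proof (intro set_eqI iffI)
    fix x assume x: "x \<in> E"
    then have "x \<in> A (to_nat_on \<A> (D k x))"
      by (auto simp: A_def \<A>_def intro!: bexI[of _ x])
    then show "x \<in> (\<Union>i. A i)" by blast
  next
    fix x assume "x \<in> (\<Union>i. A i)"
    then show "x \<in> E" using E by (auto simp: A_def \<A>_def)
  qed
  ultimately show ?thesis using ex that by blast
qed

lemma sets_saturated:
  assumes "\<And>x. x \<in> E \<Longrightarrow> D k x \<subseteq> E"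
  shows "E \<in> sets lebesgue"
proof -
  obtain A :: "nat \<Rightarrow> 'a set" where "E = (\<Union>i. A i)" "\<And>i. A i = {} \<or> (\<exists>x\<in>E. A i = D k x)"
    using disjoint_cubes_exhaust[of E k] assms by metis
  moreover have "A i \<in> sets lebesgue" for i
    using calculation(2)[of i] sets_cube by (metis sets.empty_sets)
  ultimately show ?thesis by auto
qed

lemma measurable_piecewise_cubes:
  assumes "\<And>x. \<exists>g\<in>borel_measurable lebesgue. \<forall>y\<in>D k x. h y = g y"
  shows "h \<in> borel_measurable lebesgue"
proof (rule measurable_piecewise_restrict[where C = "range (D k)"])
  show "countable (range (D k))" by (rule countable_cubes)
  show "space lebesgue \<subseteq> \<Union> (range (D k))" using mem_cube by blast
  fix \<Omega> assume "\<Omega> \<in> range (D k)"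
  then obtain x where x: "\<Omega> = D k x" by auto
  show "\<Omega> \<inter> space lebesgue \<in> sets lebesgue" by (simp add: x)
  obtain g where "g \<in> borel_measurable lebesgue" "\<forall>y\<in>D k x. h y = g y"
    using assms by blast
  then show "h \<in> borel_measurable (restrict_space lebesgue \<Omega>)"
    unfolding x by (subst measurable_cong[where g = g])
      (auto simp: space_restrict_space intro: measurable_restrict_space1)
qed

lemma measurable_cubewise_constant:
  assumes "\<And>x y. y \<in> D k x \<Longrightarrow> h y = h x"
  shows "h \<in> borel_measurable lebesgue"
proof (rule measurable_piecewise_cubes)
  show "\<exists>g\<in>borel_measurable lebesgue. \<forall>y\<in>D k x. h y = g y" for x
    by (rule bexI[of _ "\<lambda>_. h x"]) (auto simp: assms)
qed

lemma nn_integral_saturated_mono: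
  assumes E: "\<And>x. x \<in> E \<Longrightarrow> D k x \<subseteq> E"
    and m: "u \<in> borel_measurable lebesgue" "v \<in> borel_measurable lebesgue"
    and le: "\<And>x. x \<in> E \<Longrightarrow> (\<integral>\<^sup>+y. u y * indicator (D k x) y \<partial>lebesgue)
      \<le> (\<integral>\<^sup>+y. v y * indicator (D k x) y \<partial>lebesgue)"
  shows "(\<integral>\<^sup>+y. u y * indicator E y \<partial>lebesgue) \<le> (\<integral>\<^sup>+y. v y * indicator E y \<partial>lebesgue)"
proof -
  obtain A :: "nat \<Rightarrow> 'a set" where A: "disjoint_family A" "E = (\<Union>i. A i)"
    "\<And>i. A i = {} \<or> (\<exists>x\<in>E. A i = D k x)"
    using disjoint_cubes_exhaust[of E k] E by metis
  have s: "A i \<in> sets lebesgue" for i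
    using A(3)[of i] sets_cube by (metis sets.empty_sets)
  have sum: "(\<integral>\<^sup>+y. f y * indicator E y \<partial>lebesgue) = (\<Sum>i. \<integral>\<^sup>+y. f y * indicator (A i) y \<partial>lebesgue)"
    if f: "f \<in> borel_measurable lebesgue" for f :: "'a \<Rightarrow> ennreal"
    using suminf_emeasure[of A "density lebesgue f"] s A(1,2) f
    by (simp add: emeasure_density image_subset_iff sets.countable_UN)
  show ?thesis
    unfolding sum[OF m(1)] sum[OF m(2)]
  proof (intro suminf_le summableI)
    show "(\<integral>\<^sup>+y. u y * indicator (A i) y \<partial>lebesgue) \<le> (\<integral>\<^sup>+y. v y * indicator (A i) y \<partial>lebesgue)" for i
      using A(3)[of i] le by auto
  qed
qed

text \<open>
  Selection of maximal cubes. The property \<open>P k\<close> refers to the cube of level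
  \<open>k\<close>, and the cubes at which it holds for the first time are disjoint and cover all
  points where it ever holds, so that an inequality on each of them sums up to one on their union.
\<close>

lemma stopping_cubes:
  assumes P: "\<And>k x y. y \<in> D k x \<Longrightarrow> P k y = P k x"
    and m: "u \<in> borel_measurable lebesgue" "v \<in> borel_measurable lebesgue"
    and le: "\<And>k x. P k x \<Longrightarrow> (\<And>j. j < k \<Longrightarrow> \<not> P j x) \<Longrightarrow>
      (\<integral>\<^sup>+y. u y * indicator (D k x) y \<partial>lebesgue) \<le> (\<integral>\<^sup>+y. v y * indicator (D k x) y \<partial>lebesgue)"
  shows "(\<integral>\<^sup>+y. u y * indicator {x. \<exists>k. P k x} y \<partial>lebesgue)
    \<le> (\<integral>\<^sup>+y. v y * indicator {x. \<exists>k. P k x} y \<partial>lebesgue)"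
proof -
  define E where "E k = {x. P k x \<and> (\<forall>j<k. \<not> P j x)}" for k
  have sat: "D k x \<subseteq> E k" if "x \<in> E k" for k x
  proof
    fix y assume y: "y \<in> D k x"
    have "P j y = P j x" if "j \<le> k" for j
      using P cube_mono[OF that] y by blast
    then show "y \<in> E k" using \<open>x \<in> E k\<close> by (auto simp: E_def)
  qed
  have s: "E k \<in> sets lebesgue" for k
    by (rule sets_saturated[OF sat])
  have dis: "disjoint_family E"
    by (auto simp: disjoint_family_on_def E_def) (metis linorder_less_linear)
  have un: "{x. \<exists>k. P k x} = (\<Union>k. E k)"
  proof (intro set_eqI iffI)
    fix x assume "x \<in> {x. \<exists>k. P k x}"
    then have "\<exists>k. P k x" by simp
    then obtain k where "P k x" "\<forall>j<k. \<not> P j x"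
      using exists_least_iff[of "\<lambda>k. P k x"] by blast
    then have "x \<in> E k" by (simp add: E_def)
    then show "x \<in> (\<Union>k. E k)" by blast
  qed (auto simp: E_def)
  have sum: "(\<integral>\<^sup>+y. f y * indicator {x. \<exists>k. P k x} y \<partial>lebesgue) = (\<Sum>i. \<integral>\<^sup>+y. f y * indicator (E i) y \<partial>lebesgue)"
    if f: "f \<in> borel_measurable lebesgue" for f :: "'a \<Rightarrow> ennreal"
    unfolding un using suminf_emeasure[of E "density lebesgue f"] s dis f
    by (simp add: emeasure_density image_subset_iff sets.countable_UN)
  show ?thesis
    unfolding sum[OF m(1)] sum[OF m(2)]
    by (intro suminf_le summableI nn_integral_saturated_mono[OF sat] m le) (auto simp: E_def)
qed

section \<open>The dyadic maximal function\<close>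

definition wavg :: "('a \<Rightarrow> ennreal) \<Rightarrow> nat \<Rightarrow> ('a \<Rightarrow> ennreal) \<Rightarrow> 'a \<Rightarrow> ennreal" where
  "wavg v k f x = (\<integral>\<^sup>+y. f y * v y * indicator (D k x) y \<partial>lebesgue)
    / (\<integral>\<^sup>+y. v y * indicator (D k x) y \<partial>lebesgue)"

definition wmax :: "('a \<Rightarrow> ennreal) \<Rightarrow> ('a \<Rightarrow> ennreal) \<Rightarrow> 'a \<Rightarrow> ennreal" where
  "wmax v f x = (SUP k. wavg v k f x)"

abbreviation "avg \<equiv> wavg (\<lambda>_. 1)"
abbreviation "maxf \<equiv> wmax (\<lambda>_. 1)"

lemma avg_eq: "avg k f x = (\<integral>\<^sup>+y. f y * indicator (D k x) y \<partial>lebesgue) / ennreal (side k ^ DIM('a))"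
  using nn_integral_cube_const[of 1 k x] by (simp add: wavg_def)

lemma wavg_cube: "y \<in> D k x \<Longrightarrow> wavg v k f y = wavg v k f x"
  by (simp add: wavg_def cube_eq)

lemma measurable_wavg [measurable]: "wavg v k f \<in> borel_measurable lebesgue"
  by (rule measurable_cubewise_constant) (rule wavg_cube)

lemma measurable_wmax [measurable]: "wmax v f \<in> borel_measurable lebesgue"
  unfolding wmax_def by measurable

lemma wavg_le_wmax: "wavg v k f x \<le> wmax v f x"
  unfolding wmax_def by (rule SUP_upper) simp

text \<open>
  Only the part of \<open>f\<close> above \<open>t / 2\<close> can push an average above
  \<open>t\<close>. Keeping only that part on the right makes the estimate integrable against powers
  of \<open>t\<close> without knowing beforehand that the maximal function is in
  \<open>L\<^sup>p\<close>.
\<close>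

lemma wmax_weak_type:
  assumes m [measurable]: "v \<in> borel_measurable lebesgue" "f \<in> borel_measurable lebesgue"
    and v: "\<And>k x. 0 < (\<integral>\<^sup>+y. v y * indicator (D k x) y \<partial>lebesgue)"
      "\<And>k x. (\<integral>\<^sup>+y. v y * indicator (D k x) y \<partial>lebesgue) < top"
    and t: "0 < t"
  shows "(\<integral>\<^sup>+x. v x * indicator {x. ennreal t < wmax v f x} x \<partial>lebesgue) \<le>
    ennreal (2 / t) * (\<integral>\<^sup>+x. f x * v x * indicator {x. ennreal t < 2 * f x} x \<partial>lebesgue)"
proof -
  define f1 where "f1 x = f x * indicator {x. ennreal t < 2 * f x} x" for x
  have [measurable]: "f1 \<in> borel_measurable lebesgue"
    unfolding f1_def by measurable
  have split: "f x \<le> f1 x + ennreal (t / 2)" for x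
  proof (cases "ennreal t < 2 * f x")
    case False
    then have "f x \<le> ennreal (t / 2)"
      using t by (cases "f x") (auto simp: not_less ennreal_mult_top numeral_mult_ennreal top_unique)
    then show ?thesis by (simp add: f1_def False)
  qed (simp add: f1_def)
  have "(\<integral>\<^sup>+x. v x * indicator {x. \<exists>k. ennreal t < wavg v k f x} x \<partial>lebesgue) \<le>
    (\<integral>\<^sup>+x. (ennreal (2 / t) * (f1 x * v x)) * indicator {x. \<exists>k. ennreal t < wavg v k f x} x \<partial>lebesgue)"
  proof (rule stopping_cubes)
    fix k x assume less: "ennreal t < wavg v k f x"
    define V where "V = (\<integral>\<^sup>+y. v y * indicator (D k x) y \<partial>lebesgue)"
    obtain c where c: "V = ennreal c" "0 < c"
      using v[of k x] unfolding V_def[symmetric] by (cases V) auto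
    define I where "I = (\<integral>\<^sup>+y. f1 y * v y * indicator (D k x) y \<partial>lebesgue)"
    have "(\<integral>\<^sup>+y. f y * v y * indicator (D k x) y \<partial>lebesgue) \<le>
      (\<integral>\<^sup>+y. f1 y * v y * indicator (D k x) y + ennreal (t / 2) * (v y * indicator (D k x) y) \<partial>lebesgue)"
      using split by (intro nn_integral_mono)
        (auto split: split_indicator simp: mult.assoc[symmetric] distrib_right[symmetric] intro: mult_right_mono)
    also have "\<dots> = I + ennreal (t / 2) * V"
      unfolding I_def V_def by (subst nn_integral_add, measurable, subst nn_integral_cmult, measurable)
    finally have "wavg v k f x \<le> (I + ennreal (t / 2) * V) / V"
      unfolding wavg_def V_def[symmetric] by (rule divide_right_mono_ennreal)
    with less have *: "ennreal t < (I + ennreal (t / 2) * V) / V" by (rule less_le_trans)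
    have "V \<le> ennreal (2 / t) * I"
    proof (cases I)
      case (real i)
      have "t < (i + t / 2 * c) / c"
        using * t c real by (simp add: divide_ennreal ennreal_less_iff flip: ennreal_mult ennreal_plus)
      then have "c \<le> 2 / t * i" using c t by (simp add: field_simps)
      then show ?thesis using c t real by (simp flip: ennreal_mult)
    qed (use t in \<open>auto simp: ennreal_mult_top\<close>)
    then show "(\<integral>\<^sup>+y. v y * indicator (D k x) y \<partial>lebesgue) \<le>
      (\<integral>\<^sup>+y. (ennreal (2 / t) * (f1 y * v y)) * indicator (D k x) y \<partial>lebesgue)"
      unfolding V_def I_def by (subst (asm) nn_integral_cmult[symmetric]) (auto simp: mult.assoc)
  qed (auto simp: wavg_cube)
  also have "\<dots> \<le> (\<integral>\<^sup>+x. ennreal (2 / t) * (f x * v x * indicator {x. ennreal t < 2 * f x} x) \<partial>lebesgue)"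
    by (intro nn_integral_mono) (auto simp: f1_def split: split_indicator)
  also have "\<dots> = ennreal (2 / t) * (\<integral>\<^sup>+x. f x * v x * indicator {x. ennreal t < 2 * f x} x \<partial>lebesgue)"
    by (rule nn_integral_cmult) measurable
  finally show ?thesis unfolding wmax_def by (simp add: less_SUP_iff)
qed

text \<open>
  The constant depends on the exponent only, so that the bound applies to a weight and to its dual
  alike.
\<close>

lemma wmax_strong_type:
  assumes m [measurable]: "v \<in> borel_measurable lebesgue" "f \<in> borel_measurable lebesgue"
    and v: "\<And>k x. 0 < (\<integral>\<^sup>+y. v y * indicator (D k x) y \<partial>lebesgue)"
      "\<And>k x. (\<integral>\<^sup>+y. v y * indicator (D k x) y \<partial>lebesgue) < top"
    and p: "1 < p"
  shows "(\<integral>\<^sup>+x. ennpow (wmax v f x) p * v x \<partial>lebesgue) \<le>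
    ennreal (p * 2 powr p / (p - 1)) * (\<integral>\<^sup>+x. ennpow (f x) p * v x \<partial>lebesgue)"
proof -
  define J where "J t = (\<integral>\<^sup>+x. f x * v x * indicator {x. ennreal t < 2 * f x} x \<partial>lebesgue)" for t
  have [measurable]: "J \<in> borel_measurable lborel"
    unfolding J_def using borel_measurable_distribution[of "p - 1" "\<lambda>x. f x * v x" "\<lambda>x. 2 * f x"] p by simp
  have "(\<integral>\<^sup>+x. ennpow (wmax v f x) p * v x \<partial>lebesgue) =
    (\<integral>\<^sup>+t. ennreal (p * t powr (p - 1)) * indicator {0<..} t *
      (\<integral>\<^sup>+x. v x * indicator {x. ennreal t < wmax v f x} x \<partial>lebesgue) \<partial>lborel)"
    using p by (intro layer_cake) auto
  also have "\<dots> \<le> (\<integral>\<^sup>+t. ennreal (2 * p / (p - 1)) * (ennreal ((p - 1) * t powr (p - 1 - 1)) * indicator {0<..} t * J t) \<partial>lborel)"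
  proof (intro nn_integral_mono)
    fix t :: real
    show "ennreal (p * t powr (p - 1)) * indicator {0<..} t *
      (\<integral>\<^sup>+x. v x * indicator {x. ennreal t < wmax v f x} x \<partial>lebesgue)
      \<le> ennreal (2 * p / (p - 1)) * (ennreal ((p - 1) * t powr (p - 1 - 1)) * indicator {0<..} t * J t)"
    proof (cases "0 < t")
      case True
      have "p * t powr (p - 1) * (2 / t) = 2 * p / (p - 1) * ((p - 1) * t powr (p - 1 - 1))"
      proof -
        have "t powr (p - 1 - 1) = t powr (p - 1) / t"
          using powr_diff[of t "p - 1" 1] True by simp
        then show ?thesis using True p by simp
      qed
      then have e: "ennreal (p * t powr (p - 1)) * ennreal (2 / t) =
        ennreal (2 * p / (p - 1)) * ennreal ((p - 1) * t powr (p - 1 - 1))"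
        using True p by (subst (1 2) ennreal_mult[symmetric]) auto
      show ?thesis
        using mult_left_mono[OF wmax_weak_type[OF m v True], of "ennreal (p * t powr (p - 1))"] True
        by (simp add: J_def mult.assoc[symmetric] e)
    qed simp
  qed
  also have "\<dots> = ennreal (2 * p / (p - 1)) * (\<integral>\<^sup>+x. ennpow (2 * f x) (p - 1) * (f x * v x) \<partial>lebesgue)"
    using p by (subst nn_integral_cmult, measurable, subst layer_cake) (auto simp: J_def)
  also have "(\<integral>\<^sup>+x. ennpow (2 * f x) (p - 1) * (f x * v x) \<partial>lebesgue) =
    (\<integral>\<^sup>+x. ennreal (2 powr (p - 1)) * (ennpow (f x) p * v x) \<partial>lebesgue)"
  proof (intro nn_integral_cong)
    fix x
    have "ennpow (f x) (p - 1) * f x = ennpow (f x) p"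
      using ennpow_add[of "f x" "p - 1" 1] by (cases "f x = 0") auto
    moreover have "ennpow 2 (p - 1) = ennreal (2 powr (p - 1))"
      using ennpow_ennreal[of 2 "p - 1"] by simp
    ultimately show "ennpow (2 * f x) (p - 1) * (f x * v x) = ennreal (2 powr (p - 1)) * (ennpow (f x) p * v x)"
      using p by (simp add: ennpow_mult mult.assoc[symmetric]) (simp add: mult.assoc)
  qed
  also have "ennreal (2 * p / (p - 1)) * \<dots> = ennreal (p * 2 powr p / (p - 1)) * (\<integral>\<^sup>+x. ennpow (f x) p * v x \<partial>lebesgue)"
  proof -
    have "2 * p / (p - 1) * 2 powr (p - 1) = p * 2 powr p / (p - 1)"
      using p powr_diff[of 2 p 1] by simp
    then have "ennreal (2 * p / (p - 1)) * ennreal (2 powr (p - 1)) = ennreal (p * 2 powr p / (p - 1))"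
      using p by (simp flip: ennreal_mult)
    then show ?thesis
      by (subst nn_integral_cmult, measurable) (simp add: mult.assoc[symmetric])
  qed
  finally show ?thesis .
qed

end

text \<open>
  The weight \<open>w\<close> satisfies the \<open>A\<^sub>q\<close> condition on the cubes of the
  grid. The function \<open>w powr (- 1 / (q - 1))\<close> is the dual weight.
\<close>

locale muckenhoupt_grid = dyadic_grid D L
  for D :: "nat \<Rightarrow> 'a::euclidean_space \<Rightarrow> 'a set" and L +
  fixes w :: "'a \<Rightarrow> real" and q A :: real
  assumes q: "1 < q" and A_pos: "0 < A"
    and w_pos: "0 < w x"
    and w_measurable [measurable]: "w \<in> borel_measurable lebesgue"
    and w_cube: "(\<integral>\<^sup>+y. ennreal (w y) * indicator (D k x) y \<partial>lebesgue) < top"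
    and dual_cube: "(\<integral>\<^sup>+y. ennreal (w y powr (- 1 / (q - 1))) * indicator (D k x) y \<partial>lebesgue) < top"
    and Aq: "(\<integral>\<^sup>+y. ennreal (w y) * indicator (D k x) y \<partial>lebesgue) *
      ennpow (\<integral>\<^sup>+y. ennreal (w y powr (- 1 / (q - 1))) * indicator (D k x) y \<partial>lebesgue) (q - 1)
      \<le> ennreal A * ennpow (ennreal (side k ^ DIM('a))) q"
begin

abbreviation W :: "'a \<Rightarrow> ennreal" where "W x \<equiv> ennreal (w x)"
abbreviation V :: "'a \<Rightarrow> ennreal" where "V x \<equiv> ennreal (w x powr (- 1 / (q - 1)))"

lemma nn_integral_cube_pos:
  assumes "u \<in> borel_measurable lebesgue" "\<And>x. 0 < u x"
  shows "0 < (\<integral>\<^sup>+y. u y * indicator (D k x) y \<partial>lebesgue)"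
proof (rule ccontr)
  assume "\<not> ?thesis"
  then have "(\<integral>\<^sup>+y. u y * indicator (D k x) y \<partial>lebesgue) = 0" by simp
  then have "AE y in lebesgue. u y * indicator (D k x) y = 0"
    using assms by (subst (asm) nn_integral_0_iff_AE) auto
  then have "AE y in lebesgue. y \<notin> D k x"
    by eventually_elim (use assms(2) in \<open>auto simp: indicator_def less_le split: if_splits\<close>)
  then have "emeasure lebesgue (D k x) = 0"
    by (subst (asm) AE_iff_measurable[OF sets_cube]) auto
  then show False unfolding emeasure_cube using side_pos[of k] by simp
qed

text \<open>
  On a cube \<open>Q\<close>, the \<open>A\<^sub>q\<close> condition bounds the power \<open>q -
  1\<close> of the average of \<open>f\<close> by \<open>A * |Q| / w(Q)\<close> times the same power
  of the average of \<open>f / V\<close> with respect to the dual weight \<open>V\<close>. The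
  latter is at most the dual maximal function at every point of \<open>Q\<close>, hence at most its
  average over \<open>Q\<close>; the factor \<open>|Q| / w(Q)\<close> turns this into an average
  with respect to \<open>w\<close>. Muckenhoupt's theorem therefore reduces to the maximal
  inequality for the two weighted maximal functions.
\<close>

lemma maxf_pointwise:
  assumes [measurable]: "f \<in> borel_measurable lebesgue"
  shows "ennpow (maxf f x) (q - 1) \<le> ennreal A *
    wmax W (\<lambda>x. ennpow (wmax V (\<lambda>x. f x / V x) x) (q - 1) / W x) x"
proof -
  define h where "h x = f x / V x" for x
  define G where "G x = ennpow (wmax V h x) (q - 1) / W x" for x
  have [measurable]: "h \<in> borel_measurable lebesgue" unfolding h_def by measurable
  have "ennpow (avg k f x) (q - 1) \<le> ennreal A * wavg W k G x" for k
  proof -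
    obtain c where c: "(\<integral>\<^sup>+y. W y * indicator (D k x) y \<partial>lebesgue) = ennreal c" "0 < c"
      using nn_integral_cube_pos[of W k x] w_cube[of k x] w_pos
      by (cases "(\<integral>\<^sup>+y. W y * indicator (D k x) y \<partial>lebesgue)") auto
    obtain s where s: "(\<integral>\<^sup>+y. V y * indicator (D k x) y \<partial>lebesgue) = ennreal s" "0 < s"
      using nn_integral_cube_pos[of V k x] dual_cube[of k x] w_pos
      by (cases "(\<integral>\<^sup>+y. V y * indicator (D k x) y \<partial>lebesgue)") (auto simp: less_le)
    define d where "d = side k ^ DIM('a)"
    have d: "0 < d" using side_pos by (simp add: d_def)
    define a where "a = wavg V k h x"
    have hV: "h y * V y = f y" for y
      using w_pos[of y] unfolding h_def by (intro ennreal_divide_mult_cancel) auto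
    have "(\<integral>\<^sup>+y. f y * indicator (D k x) y \<partial>lebesgue) = a * ennreal s"
    proof -
      have "a = (\<integral>\<^sup>+y. f y * indicator (D k x) y \<partial>lebesgue) / ennreal s"
        unfolding a_def wavg_def hV s(1) ..
      then show ?thesis using s(2) by (simp add: ennreal_divide_mult_cancel)
    qed
    then have "avg k f x = a * ennreal (s / d)"
      unfolding avg_eq using d s by (simp add: d_def divide_ennreal flip: ennreal_times_divide)
    then have "ennpow (avg k f x) (q - 1) = ennpow a (q - 1) * ennreal ((s / d) powr (q - 1))"
      using q d s by (simp add: ennpow_mult ennpow_ennreal)
    also have "\<dots> \<le> ennpow a (q - 1) * ennreal (A * d / c)"
    proof (intro mult_left_mono ennreal_leI)
      have "c * s powr (q - 1) \<le> A * d powr q"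
        using Aq[of k x] c(2) s(2) d A_pos unfolding c(1) s(1) d_def[symmetric]
        by (simp add: ennpow_ennreal flip: ennreal_mult)
      then have "c * (s powr (q - 1) / d powr (q - 1)) \<le> A * (d powr q / d powr (q - 1))"
        using d by (simp add: divide_right_mono)
      also have "d powr q / d powr (q - 1) = d"
        using d by (simp flip: powr_diff)
      finally show "(s / d) powr (q - 1) \<le> A * d / c"
        using c s d by (simp add: powr_divide pos_le_divide_eq mult.commute)
    qed simp
    also have "\<dots> = ennreal A * ((ennpow a (q - 1) * ennreal d) / ennreal c)"
      proof -
      have "A * d / c = A * (d * inverse c)" by (simp add: field_simps)
      then show ?thesis
        using A_pos c d by (simp add: divide_ennreal_def inverse_ennreal ennreal_mult mult.left_commute mult.assoc)
    qed
    also have "ennpow a (q - 1) * ennreal d = (\<integral>\<^sup>+y. ennpow a (q - 1) * indicator (D k x) y \<partial>lebesgue)"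
      by (simp add: nn_integral_cube_const d_def)
    also have "\<dots> \<le> (\<integral>\<^sup>+y. G y * W y * indicator (D k x) y \<partial>lebesgue)"
    proof (intro nn_integral_mono)
      fix y
      have "G y * W y = ennpow (wmax V h y) (q - 1)"
        using w_pos[of y] unfolding G_def by (intro ennreal_divide_mult_cancel) auto
      moreover have "a \<le> wmax V h y" if "y \<in> D k x"
        using wavg_le_wmax[of V k h y] wavg_cube[OF that] by (simp add: a_def)
      ultimately show "ennpow a (q - 1) * indicator (D k x) y \<le> G y * W y * indicator (D k x) y"
        using q by (auto split: split_indicator intro!: ennpow_mono)
    qed
    finally show ?thesis
      unfolding wavg_def[of W k G x] c(1) by (simp add: divide_right_mono_ennreal mult_left_mono)
  qed
  then have "ennpow (avg k f x) (q - 1) \<le> ennreal A * wmax W G x" for k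
    using wavg_le_wmax[of W k G x] by (meson mult_left_mono order_trans zero_le)
  then show ?thesis
    unfolding wmax_def[of "\<lambda>_. 1"] G_def[abs_def] h_def[abs_def] using q
    by (subst ennpow_SUP) (auto intro!: SUP_least)
qed

definition "max_const = A powr (q / (q - 1)) * (q / (q - 1) * 2 powr (q / (q - 1)) / (q / (q - 1) - 1)) *
  (q * 2 powr q / (q - 1))"

lemma maxf_bounded:
  assumes [measurable]: "f \<in> borel_measurable lebesgue"
  shows "(\<integral>\<^sup>+x. ennpow (maxf f x) q * W x \<partial>lebesgue) \<le>
    ennreal max_const * (\<integral>\<^sup>+x. ennpow (f x) q * W x \<partial>lebesgue)"
proof -
  let ?q = "q / (q - 1)"
  have q': "1 < ?q" using q by (simp add: field_simps)
  define h where "h x = f x / V x" for x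
  define G where "G x = ennpow (wmax V h x) (q - 1) / W x" for x
  have [measurable]: "h \<in> borel_measurable lebesgue" unfolding h_def by measurable
  have [measurable]: "G \<in> borel_measurable lebesgue" unfolding G_def by measurable
  have "(\<integral>\<^sup>+x. ennpow (maxf f x) q * W x \<partial>lebesgue) \<le>
    (\<integral>\<^sup>+x. ennreal (A powr ?q) * (ennpow (wmax W G x) ?q * W x) \<partial>lebesgue)"
  proof (intro nn_integral_mono)
    fix x
    have "ennpow (maxf f x) q = ennpow (ennpow (maxf f x) (q - 1)) ?q"
      using q by (simp add: ennpow_ennpow)
    also have "\<dots> \<le> ennpow (ennreal A * wmax W G x) ?q"
      using q maxf_pointwise[of f x, folded h_def[abs_def], folded G_def[abs_def]]
      by (intro ennpow_mono) auto
    also have "\<dots> = ennreal (A powr ?q) * ennpow (wmax W G x) ?q"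
      using q A_pos by (simp add: ennpow_mult ennpow_ennreal)
    finally show "ennpow (maxf f x) q * W x \<le> ennreal (A powr ?q) * (ennpow (wmax W G x) ?q * W x)"
      by (simp add: mult_right_mono mult.assoc[symmetric])
  qed
  also have "\<dots> = ennreal (A powr ?q) * (\<integral>\<^sup>+x. ennpow (wmax W G x) ?q * W x \<partial>lebesgue)"
    by (rule nn_integral_cmult) measurable
  also have "(\<integral>\<^sup>+x. ennpow (wmax W G x) ?q * W x \<partial>lebesgue) \<le>
      ennreal (?q * 2 powr ?q / (?q - 1)) * (\<integral>\<^sup>+x. ennpow (G x) ?q * W x \<partial>lebesgue)"
    using w_pos w_cube by (intro wmax_strong_type q' nn_integral_cube_pos) auto
  also have "(\<integral>\<^sup>+x. ennpow (G x) ?q * W x \<partial>lebesgue) = (\<integral>\<^sup>+x. ennpow (wmax V h x) q * V x \<partial>lebesgue)"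
  proof (intro nn_integral_cong)
    fix x
    have "ennpow (G x) ?q = ennpow (wmax V h x) q * ennreal (inverse (w x) powr ?q)"
      using q w_pos[of x]
      by (simp add: G_def divide_ennreal_def ennpow_mult ennpow_ennpow inverse_ennreal ennpow_ennreal)
    moreover have "inverse (w x) powr ?q * w x = w x powr (- 1 / (q - 1))"
    proof -
      have "inverse (w x) powr ?q * w x = w x powr (- ?q) * w x powr 1"
        using w_pos[of x] by (simp add: powr_minus inverse_powr)
      also have "\<dots> = w x powr (- ?q + 1)" by (rule powr_add[symmetric])
      also have "- ?q + 1 = - 1 / (q - 1)" using q by (simp add: field_simps)
      finally show ?thesis .
    qed
    ultimately show "ennpow (G x) ?q * W x = ennpow (wmax V h x) q * V x"
      using w_pos[of x] by (simp add: mult.assoc flip: ennreal_mult)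
  qed
  also have "\<dots> \<le> ennreal (q * 2 powr q / (q - 1)) * (\<integral>\<^sup>+x. ennpow (h x) q * V x \<partial>lebesgue)"
  proof (intro wmax_strong_type q nn_integral_cube_pos)
    show "0 < V x" for x using w_pos[of x] by simp
  qed (use dual_cube in auto)
  also have "(\<integral>\<^sup>+x. ennpow (h x) q * V x \<partial>lebesgue) = (\<integral>\<^sup>+x. ennpow (f x) q * W x \<partial>lebesgue)"
  proof (intro nn_integral_cong)
    fix x
    let ?v = "w x powr (- 1 / (q - 1))"
    have v: "0 < ?v" using w_pos[of x] by simp
    have "ennpow (h x) q = ennpow (f x) q * ennreal (inverse ?v powr q)"
      using q v by (simp add: h_def divide_ennreal_def ennpow_mult inverse_ennreal ennpow_ennreal del: ennreal_less_zero_iff)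
    moreover have "inverse ?v powr q * ?v = w x"
    proof -
      have "inverse ?v powr q * ?v = ?v powr (- q) * ?v powr 1"
        using v by (simp add: powr_minus inverse_powr)
      also have "\<dots> = ?v powr (- q + 1)" by (rule powr_add[symmetric])
      also have "\<dots> = w x powr (- 1 / (q - 1) * (- q + 1))" by (rule powr_powr)
      also have "- 1 / (q - 1) * (- q + 1) = 1" using q by (simp add: field_simps)
      finally show ?thesis using w_pos[of x] by simp
    qed
    ultimately show "ennpow (h x) q * V x = ennpow (f x) q * W x"
      by (simp add: mult.assoc flip: ennreal_mult)
  qed
  finally have "(\<integral>\<^sup>+x. ennpow (maxf f x) q * W x \<partial>lebesgue) \<le> ennreal (A powr ?q) *
    (ennreal (?q * 2 powr ?q / (?q - 1)) * (ennreal (q * 2 powr q / (q - 1)) *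
      (\<integral>\<^sup>+x. ennpow (f x) q * W x \<partial>lebesgue)))"
    by (simp add: mult_left_mono)
  also have "\<dots> = ennreal max_const * (\<integral>\<^sup>+x. ennpow (f x) q * W x \<partial>lebesgue)"
  proof -
    have "0 \<le> A powr ?q" "0 \<le> ?q * 2 powr ?q / (?q - 1)" "0 \<le> q * 2 powr q / (q - 1)"
      using q q' by auto
    then show ?thesis
      unfolding max_const_def by (simp only: ennreal_mult mult_nonneg_nonneg mult.assoc)
  qed
  finally show ?thesis .
qed

end

section \<open>Oscillations against bumps\<close>

lemma set_integrable_finite_sum:
  fixes h :: "'i \<Rightarrow> 'a \<Rightarrow> 'b::{banach, second_countable_topology}"
  assumes "\<And>i. i \<in> I \<Longrightarrow> set_integrable M E (h i)"
  shows "set_integrable M E (\<lambda>x. \<Sum>i\<in>I. h i x)"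
  using assms unfolding set_integrable_def scaleR_sum_right by (intro Bochner_Integration.integrable_sum)

lemma set_integral_finite_sum:
  fixes h :: "'i \<Rightarrow> 'a \<Rightarrow> 'b::{banach, second_countable_topology}"
  assumes "\<And>i. i \<in> I \<Longrightarrow> set_integrable M E (h i)"
  shows "(LINT x:E|M. (\<Sum>i\<in>I. h i x)) = (\<Sum>i\<in>I. LINT x:E|M. h i x)"
  using assms unfolding set_integrable_def set_lebesgue_integral_def scaleR_sum_right
  by (intro Bochner_Integration.integral_sum)

lemma nn_set_integral_eq:
  assumes "set_integrable M E h" "\<And>x. 0 \<le> h x"
  shows "(\<integral>\<^sup>+x. ennreal (h x) * indicator E x \<partial>M) = ennreal (LINT x:E|M. h x)"
proof -
  have "(\<integral>\<^sup>+x. ennreal (h x) * indicator E x \<partial>M) = (\<integral>\<^sup>+x. ennreal (indicat_real E x *\<^sub>R h x) \<partial>M)"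
    by (intro nn_integral_cong) (auto split: split_indicator)
  also have "\<dots> = ennreal (LINT x:E|M. h x)"
    unfolding set_lebesgue_integral_def
    using assms by (intro nn_integral_eq_integral) (auto simp: set_integrable_def)
  finally show ?thesis .
qed

lemma Hoelder_continuous:
  fixes \<psi> :: "'a::real_normed_vector \<Rightarrow> 'b::real_normed_vector"
  assumes \<gamma>: "0 < \<gamma>" and l: "0 < l"
    and \<psi>: "\<And>x y. norm (\<psi> x - \<psi> y) \<le> (norm (x - y) / l) powr \<gamma>"
  shows "continuous_on UNIV \<psi>"
proof (unfold continuous_on_iff, intro ballI allI impI)
  fix x and e :: real assume e: "0 < e"
  show "\<exists>d>0. \<forall>x'\<in>UNIV. dist x' x < d \<longrightarrow> dist (\<psi> x') (\<psi> x) < e"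
  proof (intro exI[of _ "l * e powr (1 / \<gamma>)"] conjI ballI impI)
    show "0 < l * e powr (1 / \<gamma>)" using e l by simp
    fix y assume "dist y x < l * e powr (1 / \<gamma>)"
    then have "norm (y - x) / l < e powr (1 / \<gamma>)"
      using l by (simp add: dist_norm field_simps)
    then have "(norm (y - x) / l) powr \<gamma> < (e powr (1 / \<gamma>)) powr \<gamma>"
      using \<gamma> l by (intro powr_less_mono2) auto
    also have "\<dots> = e" using \<gamma> e by (simp add: powr_powr)
    finally show "dist (\<psi> y) (\<psi> x) < e"
      using \<psi>[of y x] by (simp add: dist_norm)
  qed
qed

locale oscillation_grid = dyadic_grid D L
  for D :: "nat \<Rightarrow> 'a::euclidean_space \<Rightarrow> 'a set" and L +
  fixes \<gamma> :: real
  assumes \<gamma>: "0 < \<gamma>" "\<gamma> \<le> 1"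
begin

text \<open>
  Bumps are normalized by their size, which is of order \<open>1\<close>; the volume of the cube
  appears as a divisor in the oscillation. Since bumps vanish outside \<open>Q\<close>, the
  oscillation on \<open>Q\<close> depends only on the values of \<open>f\<close> in
  \<open>Q\<close>, and no neighbouring cubes interact.
\<close>

definition bumps :: "nat \<Rightarrow> 'a set \<Rightarrow> ('a \<Rightarrow> complex) set" where
  "bumps k Q = {\<psi>. (\<forall>x. x \<notin> Q \<longrightarrow> \<psi> x = 0) \<and> (LINT x|lebesgue. \<psi> x) = 0 \<and>
     (\<forall>x y. norm (\<psi> x - \<psi> y) \<le> (norm (x - y) / side k) powr \<gamma>)}"

definition osc_on :: "nat \<Rightarrow> 'a set \<Rightarrow> ('a \<Rightarrow> complex) \<Rightarrow> ennreal" where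
  "osc_on k Q f = (SUP \<psi>\<in>bumps k Q. ennreal (norm (LINT y|lebesgue. f y * \<psi> y))) / ennreal (side k ^ DIM('a))"

definition osc :: "nat \<Rightarrow> ('a \<Rightarrow> complex) \<Rightarrow> 'a \<Rightarrow> ennreal" where
  "osc k f x = osc_on k (D k x) f"

text \<open>
  All cubes of one level have the same volume; the one at the origin represents them.
\<close>

definition vol :: "nat \<Rightarrow> real" where "vol k = measure lebesgue (D k 0)"

lemma vol_eq: "vol k = side k ^ DIM('a)"
  using side_pos[of k] by (simp only: vol_def measure_def emeasure_cube) simp

lemma vol_pos: "0 < vol k"
  using side_pos by (simp add: vol_eq)

lemma emeasure_cube_vol: "emeasure lebesgue (D k x) = ennreal (vol k)"
  by (simp add: vol_eq emeasure_cube)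

lemma measure_cube: "measure lebesgue (D k x) = vol k"
  using emeasure_cube_vol vol_pos[of k] by (simp add: measure_def)

lemma osc_cube: "y \<in> D k x \<Longrightarrow> osc k f y = osc k f x"
  by (simp add: osc_def cube_eq)

lemma measurable_osc [measurable]: "osc k f \<in> borel_measurable lebesgue"
  by (rule measurable_cubewise_constant) (rule osc_cube)

lemma bump_outside: "\<psi> \<in> bumps k Q \<Longrightarrow> x \<notin> Q \<Longrightarrow> \<psi> x = 0"
  by (simp add: bumps_def)

lemma bump_Hoelder: "\<psi> \<in> bumps k Q \<Longrightarrow> norm (\<psi> x - \<psi> y) \<le> (norm (x - y) / side k) powr \<gamma>"
  by (simp add: bumps_def)

text \<open>
  A bump vanishes at points at distance \<open>(DIM('a) + 1) * side k\<close>, beyond the diameter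
  of its cube.
\<close>

lemma bump_bound:
  assumes \<psi>: "\<psi> \<in> bumps k (D k z)"
  shows "norm (\<psi> x) \<le> (real DIM('a) + 1)"
proof (cases "x \<in> D k z")
  case False
  then show ?thesis using bump_outside[OF \<psi>] by simp
next
  case True
  obtain b :: 'a where b: "b \<in> Basis" using nonempty_Basis by blast
  define y where "y = x + ((real DIM('a) + 1) * side k) *\<^sub>R b"
  have "norm (y - x) = (real DIM('a) + 1) * side k"
    using b side_pos[of k] by (simp add: y_def)
  moreover have "D k z = D k x" using cube_eq[OF True] by simp
  ultimately have "y \<notin> D k z"
    using cube_diam[of y k x] side_pos[of k] by (auto simp: side_def[symmetric] field_simps)
  then have "norm (\<psi> x) \<le> (norm (x - y) / side k) powr \<gamma>"
    using bump_Hoelder[OF \<psi>, of x y] bump_outside[OF \<psi>, of y] by simp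
  also have "norm (x - y) / side k = (real DIM('a) + 1)"
    using \<open>norm (y - x) = _\<close> side_pos[of k] by (simp add: norm_minus_commute)
  also have "(real DIM('a) + 1) powr \<gamma> \<le> (real DIM('a) + 1) powr 1"
    using \<gamma> by (intro powr_mono) auto
  finally show ?thesis by simp
qed

lemma bump_measurable:
  assumes \<psi>: "\<psi> \<in> bumps k Q"
  shows "\<psi> \<in> borel_measurable lebesgue"
proof -
  have "continuous_on UNIV \<psi>"
    by (rule Hoelder_continuous[OF \<gamma>(1) side_pos[of k]]) (rule bump_Hoelder[OF \<psi>])
  then show ?thesis
    by (intro measurable_completion) (simp add: borel_measurable_continuous_onI)
qed

text \<open>
  Across a cube that is \<open>j\<close> levels finer, a bump varies only by a multiple of the power
  \<open>j\<close> of \<open>2 powr (- \<gamma>)\<close>. This decay is the source of all convergent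
  sums below.
\<close>

lemma bump_osc_le:
  assumes \<psi>: "\<psi> \<in> bumps k Q" and u: "u \<in> D (k + j) x"
  shows "norm (\<psi> u - \<psi> x) \<le> DIM('a) * (2 powr (- \<gamma>)) ^ j"
proof -
  have "norm (u - x) \<le> DIM('a) * side (k + j)"
    using cube_diam[OF u] by (simp add: side_def)
  then have "norm (u - x) / side k \<le> DIM('a) * (1 / 2 ^ j)"
    using side_pos[of k] by (simp only: side_add divide_le_eq) simp
  then have "(norm (u - x) / side k) powr \<gamma> \<le> (DIM('a) * (1 / 2 ^ j)) powr \<gamma>"
    using \<gamma> side_pos[of k] by (intro powr_mono2) auto
  also have "\<dots> = DIM('a) powr \<gamma> * (1 / 2 ^ j) powr \<gamma>"
    by (rule powr_mult)
  also have "(1 / 2 ^ j) powr \<gamma> = (2 powr (- \<gamma>)) ^ j"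
  proof -
    have "(1 / 2 ^ j :: real) = 2 powr (- real j)" by (simp add: powr_minus powr_realpow divide_simps)
    then show ?thesis by (simp add: powr_powr mult.commute flip: powr_realpow)
  qed
  also have "DIM('a) powr \<gamma> * (2 powr (- \<gamma>)) ^ j \<le> DIM('a) powr 1 * (2 powr (- \<gamma>)) ^ j"
    using \<gamma> by (intro mult_right_mono powr_mono) (auto simp: Suc_leI)
  finally show ?thesis
    using bump_Hoelder[OF \<psi>, of u x] by simp
qed

lemma set_integrable_bounded_cube:
  fixes h :: "'a \<Rightarrow> 'b::{banach, second_countable_topology}"
  assumes "h \<in> borel_measurable lebesgue" "\<And>x. norm (h x) \<le> B" "E \<in> sets lebesgue" "E \<subseteq> D k x"
  shows "set_integrable lebesgue E h"
proof (rule set_integrable_bound)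
  have "emeasure lebesgue E \<le> emeasure lebesgue (D k x)"
    using assms by (intro emeasure_mono) auto
  also have "\<dots> < \<infinity>" by (simp add: emeasure_cube)
  finally show "set_integrable lebesgue E (\<lambda>_. B)"
    using assms by (simp add: set_integrable_def)
  show "set_borel_measurable lebesgue E h"
    using assms by (simp add: set_borel_measurable_def)
  show "AE x in lebesgue. x \<in> E \<longrightarrow> norm (h x) \<le> norm B"
    using assms(2) by (auto intro!: AE_I2 order_trans[OF _ abs_ge_self])
qed

text \<open>
  Cancellation of \<open>X\<close> inside the individual cubes survives summation over the cubes.
\<close>

lemma norm_set_integral_le_cubes:
  fixes X :: "'a \<Rightarrow> 'b::{banach, second_countable_topology}"
  assumes E: "\<And>x. x \<in> E \<Longrightarrow> D k x \<subseteq> E"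
    and X: "set_integrable lebesgue E X"
    and Y: "Y \<in> borel_measurable lebesgue"
    and le: "\<And>x. x \<in> E \<Longrightarrow> ennreal (norm (LINT y:D k x|lebesgue. X y))
      \<le> (\<integral>\<^sup>+y. Y y * indicator (D k x) y \<partial>lebesgue)"
  shows "ennreal (norm (LINT y:E|lebesgue. X y)) \<le> (\<integral>\<^sup>+y. Y y * indicator E y \<partial>lebesgue)"
proof -
  obtain A :: "nat \<Rightarrow> 'a set" where A: "disjoint_family A" "E = (\<Union>i. A i)"
    "\<And>i. A i = {} \<or> (\<exists>x\<in>E. A i = D k x)"
    using disjoint_cubes_exhaust[of E k] E by metis
  have s: "A i \<in> sets lebesgue" for i
    using A(3)[of i] sets_cube by (metis sets.empty_sets)
  have int: "set_integrable lebesgue (A i) X" for i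
    using X s A(2) by (intro set_integrable_subset[OF X]) auto
  have lim: "(\<lambda>n. LINT y:(\<Union>i<n. A i)|lebesgue. X y) \<longlonglongrightarrow> (LINT y:E|lebesgue. X y)"
    unfolding set_lebesgue_integral_def
  proof (rule integral_dominated_convergence[where w = "\<lambda>y. norm (indicat_real E y *\<^sub>R X y)"])
    show "integrable lebesgue (\<lambda>y. norm (indicat_real E y *\<^sub>R X y))"
      using X by (intro integrable_norm) (simp add: set_integrable_def)
    show "AE x in lebesgue. (\<lambda>n. indicat_real (\<Union>i<n. A i) x *\<^sub>R X x) \<longlonglongrightarrow> indicat_real E x *\<^sub>R X x"
    proof (intro AE_I2 tendsto_eventually)
      fix x
      show "\<forall>\<^sub>F n in sequentially. indicat_real (\<Union>i<n. A i) x *\<^sub>R X x = indicat_real E x *\<^sub>R X x"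
      proof (cases "x \<in> E")
        case True
        then obtain i where "x \<in> A i" using A(2) by auto
        then show ?thesis
          using True by (intro eventually_sequentiallyI[of "Suc i"]) (auto simp: indicator_def)
      qed (use A(2) in \<open>auto simp: indicator_def\<close>)
    qed
    show "(\<lambda>y. indicat_real E y *\<^sub>R X y) \<in> borel_measurable lebesgue"
      using X by (auto simp: set_integrable_def)
    show "(\<lambda>y. indicat_real (\<Union>i<n. A i) y *\<^sub>R X y) \<in> borel_measurable lebesgue" for n
    proof -
      have "set_integrable lebesgue (\<Union>i<n. A i) X"
        using s A(2) by (intro set_integrable_subset[OF X]) auto
      then show ?thesis by (auto simp: set_integrable_def)
    qed
    show "AE x in lebesgue. norm (indicat_real (\<Union>i<n. A i) x *\<^sub>R X x) \<le> norm (indicat_real E x *\<^sub>R X x)" for n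
      using A(2) by (intro AE_I2) (auto simp: indicator_def)
  qed
  have fin: "ennreal (norm (LINT y:(\<Union>i<n. A i)|lebesgue. X y)) \<le> (\<integral>\<^sup>+y. Y y * indicator E y \<partial>lebesgue)" for n
  proof -
    have "(LINT y:(\<Union>i<n. A i)|lebesgue. X y) = (\<Sum>i<n. LINT y:A i|lebesgue. X y)"
      using A(1) int s by (intro set_integral_finite_Union) (auto simp: disjoint_family_on_def)
    then have "ennreal (norm (LINT y:(\<Union>i<n. A i)|lebesgue. X y)) \<le> ennreal (\<Sum>i<n. norm (LINT y:A i|lebesgue. X y))"
      by (simp add: norm_sum ennreal_leI)
    also have "\<dots> = (\<Sum>i<n. ennreal (norm (LINT y:A i|lebesgue. X y)))"
      by simp
    also have "\<dots> \<le> (\<Sum>i<n. \<integral>\<^sup>+y. Y y * indicator (A i) y \<partial>lebesgue)"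
    proof (intro sum_mono)
      fix i
      show "ennreal (norm (LINT y:A i|lebesgue. X y)) \<le> (\<integral>\<^sup>+y. Y y * indicator (A i) y \<partial>lebesgue)"
        using A(3)[of i] le by (auto simp: set_lebesgue_integral_def)
    qed
    also have "\<dots> = (\<integral>\<^sup>+y. (\<Sum>i<n. Y y * indicator (A i) y) \<partial>lebesgue)"
      using s Y by (intro nn_integral_sum[symmetric]) auto
    also have "\<dots> \<le> (\<integral>\<^sup>+y. Y y * indicator E y \<partial>lebesgue)"
    proof (intro nn_integral_mono)
      fix y
      have "(\<Sum>i<n. Y y * indicator (A i) y) = Y y * indicator (\<Union>i<n. A i) y"
        using A(1) by (subst indicator_UN_disjoint) (auto simp: sum_distrib_left disjoint_family_on_def)
      also have "\<dots> \<le> Y y * indicator E y"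
        using A(2) by (auto split: split_indicator)
      finally show "(\<Sum>i<n. Y y * indicator (A i) y) \<le> Y y * indicator E y" .
    qed
    finally show ?thesis .
  qed
  show ?thesis
    by (rule LIMSEQ_le_const2[OF tendsto_ennrealI[OF tendsto_norm[OF lim]]]) (use fin in auto)
qed

lemma bump_integral_cube:
  assumes \<psi>: "\<psi> \<in> bumps k (D k x)" 
  shows "(LINT y:D k x|lebesgue. g y * \<psi> y) = (LINT y|lebesgue. g y * \<psi> y)"
  unfolding set_lebesgue_integral_def
  by (intro Bochner_Integration.integral_cong) (auto simp: indicator_def bump_outside[OF \<psi>])

lemma osc_le_avg:
  assumes f: "integrable lebesgue f"
  shows "osc k f x \<le> ennreal (real DIM('a) + 1) * avg k (\<lambda>y. ennreal (norm (f y))) x"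
proof -
  have "ennreal (norm (LINT y|lebesgue. f y * \<psi> y)) \<le> ennreal (real DIM('a) + 1) * (\<integral>\<^sup>+y. ennreal (norm (f y)) * indicator (D k x) y \<partial>lebesgue)"
    if \<psi>: "\<psi> \<in> bumps k (D k x)" for \<psi>
  proof -
    note [measurable] = bump_measurable[OF \<psi>] borel_measurable_integrable[OF f]
    have le: "norm (f y * \<psi> y) \<le> (real DIM('a) + 1) * norm (f y)" for y
      using mult_left_mono[OF bump_bound[OF \<psi>, of y], of "norm (f y)"] by (simp add: norm_mult mult.commute)
    have "ennreal (norm (LINT y|lebesgue. f y * \<psi> y)) \<le> (\<integral>\<^sup>+y. ennreal (norm (f y * \<psi> y)) \<partial>lebesgue)"
      by (rule integral_norm_bound_ennreal,
          rule Bochner_Integration.integrable_bound[of _ "\<lambda>y. (real DIM('a) + 1) * norm (f y)"])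
        (use f le in \<open>auto intro!: AE_I2 order_trans[OF le]\<close>)
    also have "\<dots> \<le> (\<integral>\<^sup>+y. ennreal (real DIM('a) + 1) * (ennreal (norm (f y)) * indicator (D k x) y) \<partial>lebesgue)"
    proof (intro nn_integral_mono)
      fix y
      show "ennreal (norm (f y * \<psi> y)) \<le> ennreal (real DIM('a) + 1) * (ennreal (norm (f y)) * indicator (D k x) y)"
      proof (cases "y \<in> D k x")
        case True
        have "ennreal (norm (f y * \<psi> y)) \<le> ennreal ((real DIM('a) + 1) * norm (f y))"
          by (rule ennreal_leI) (rule le)
        also have "\<dots> = ennreal (real DIM('a) + 1) * ennreal (norm (f y))"
          by (rule ennreal_mult) auto
        finally show ?thesis using True by simp
      qed (simp add: bump_outside[OF \<psi>])
    qed
    also have "\<dots> = ennreal (real DIM('a) + 1) * (\<integral>\<^sup>+y. ennreal (norm (f y)) * indicator (D k x) y \<partial>lebesgue)"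
      by (intro nn_integral_cmult) measurable
    finally show ?thesis .
  qed
  then have "(SUP \<psi>\<in>bumps k (D k x). ennreal (norm (LINT y|lebesgue. f y * \<psi> y)))
    \<le> ennreal (real DIM('a) + 1) * (\<integral>\<^sup>+y. ennreal (norm (f y)) * indicator (D k x) y \<partial>lebesgue)"
    by (rule SUP_least)
  then show ?thesis
    unfolding osc_def osc_on_def avg_eq ennreal_times_divide by (rule divide_right_mono_ennreal)
qed

text \<open>
  Multiplication by a unimodular constant preserves bumps, so that the pairing can be taken real and
  nonnegative.
\<close>

lemma near_optimal_bump:
  assumes fin: "osc_on k Q g < top"
  shows "\<exists>\<psi>\<in>bumps k Q. osc_on k Q g \<le> 2 * (ennreal (norm (LINT y|lebesgue. g y * \<psi> y)) / ennreal (vol k)) \<and>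
    Re (LINT y|lebesgue. g y * \<psi> y) = norm (LINT y|lebesgue. g y * \<psi> y)"
proof (cases "osc_on k Q g = 0")
  case True
  have "(\<lambda>_. 0) \<in> bumps k Q" by (simp add: bumps_def)
  then show ?thesis using True by (intro bexI[of _ "\<lambda>_. 0"]) auto
next
  case False
  then have "osc_on k Q g / 2 < osc_on k Q g"
    using fin by (cases "osc_on k Q g") (auto simp: ennreal_divide_numeral ennreal_less_iff)
  also have "\<dots> = (SUP \<psi>\<in>bumps k Q. ennreal (norm (LINT y|lebesgue. g y * \<psi> y)) / ennreal (vol k))"
    by (simp add: osc_on_def vol_eq SUP_divide_ennreal)
  finally obtain \<psi> where \<psi>: "\<psi> \<in> bumps k Q"
    "osc_on k Q g / 2 < ennreal (norm (LINT y|lebesgue. g y * \<psi> y)) / ennreal (vol k)"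
    by (auto simp: less_SUP_iff)
  define I where "I = (LINT y|lebesgue. g y * \<psi> y)"
  define c where "c = (if I = 0 then 1 else cnj I / of_real (norm I))"
  have c: "norm c = 1" "c * I = of_real (norm I)"
    using complex_norm_square[of I]
    by (auto simp: c_def norm_divide mult.commute power2_eq_square field_simps)
  have "(\<lambda>y. c * \<psi> y) \<in> bumps k Q"
    using \<psi>(1) c(1) by (auto simp: bumps_def norm_mult simp flip: right_diff_distrib)
  moreover have I': "(LINT y|lebesgue. g y * (c * \<psi> y)) = of_real (norm I)"
  proof -
    have "(LINT y|lebesgue. g y * (c * \<psi> y)) = (LINT y|lebesgue. c * (g y * \<psi> y))"
      by (simp add: mult.left_commute)
    also have "\<dots> = c * I" unfolding I_def by simp
    finally show ?thesis using c(2) by simp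
  qed
  moreover have "osc_on k Q g \<le> 2 * (ennreal (norm I) / ennreal (vol k))"
  proof -
    have "osc_on k Q g = 2 * (osc_on k Q g / 2)"
      using ennreal_divide_mult_cancel[of 2 "osc_on k Q g"] by (simp add: mult.commute)
    also have "\<dots> \<le> 2 * (ennreal (norm I) / ennreal (vol k))"
      using \<psi>(2) by (intro mult_left_mono) (auto simp: I_def)
    finally show ?thesis .
  qed
  ultimately show ?thesis by (intro bexI[of _ "\<lambda>y. c * \<psi> y"]) auto
qed


section \<open>Almost orthogonality\<close>

definition "decay = 2 powr (- \<gamma>)"

lemma decay: "0 < decay" "decay < 1"
  using \<gamma> by (auto simp: decay_def powr_less_one)

definition "schur_const = DIM('a) * (real DIM('a) + 1) * (2 / (1 - decay))"

lemma schur_const_pos: "0 < schur_const"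
  using decay by (simp add: schur_const_def)

text \<open>
  The bound is uniform in \<open>i\<close>, as required for the Schur test.
\<close>

lemma sum_decay_le: "(\<Sum>j = m..K. decay ^ ((max i j) - (min i j))) \<le> 2 / (1 - decay)"
proof -
  have geo: "(\<Sum>l<n. decay ^ l) \<le> 1 / (1 - decay)" for n
  proof -
    have "(\<Sum>l<n. decay ^ l) \<le> (\<Sum>l. decay ^ l)"
      using decay by (intro sum_le_suminf summable_geometric) auto
    then show ?thesis using decay by (simp add: suminf_geometric)
  qed
  have "(\<Sum>j = m..K. decay ^ ((max i j) - (min i j))) \<le>
      (\<Sum>j\<in>{..<i} \<union> {i..max i K}. decay ^ ((max i j) - (min i j)))"
    using decay by (intro sum_mono2) auto
  also have "\<dots> = (\<Sum>j<i. decay ^ (i - j)) + (\<Sum>j = i..max i K. decay ^ (j - i))"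
    by (subst sum.union_disjoint) (auto simp: max_def min_def intro!: arg_cong2[where f = "(+)"] sum.cong)
  also have "(\<Sum>j<i. decay ^ (i - j)) = (\<Sum>l<i. decay ^ Suc l)"
    by (rule sum.reindex_bij_witness[of _ "\<lambda>l. i - Suc l" "\<lambda>j. i - Suc j"]) (auto simp: Suc_diff_Suc simp del: power_Suc)
  also have "\<dots> \<le> (\<Sum>l<i. decay ^ l)"
    using decay by (intro sum_mono power_decreasing) auto
  also have "(\<Sum>j = i..max i K. decay ^ (j - i)) = (\<Sum>l<Suc (max i K - i). decay ^ l)"
    by (rule sum.reindex_bij_witness[of _ "\<lambda>l. l + i" "\<lambda>j. j - i"]) auto
  finally show ?thesis using geo[of i] geo[of "Suc (max i K - i)"] by simp
qed

text \<open>
  For each cube take a nearly optimal bump, and let \<open>H i\<close> be the sum over the cubes of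
  level \<open>i\<close> of these bumps, each multiplied by its coefficient \<open>c i\<close>, so
  that the integral of \<open>g * H i\<close> is that of \<open>(c i)\<^sup>2\<close>. For \<open>i
  \<le> j\<close>, the function \<open>H j\<close> has mean zero on the cubes of level
  \<open>j\<close>, on which \<open>H i\<close> varies little; hence \<open>H i\<close> and \<open>H
  j\<close> are almost orthogonal, with a geometric gain in \<open>j - i\<close>. The Schur test
  bounds the norm of the sum of all \<open>H i\<close> by the sum \<open>S\<close> of the integrals
  of \<open>(c i)\<^sup>2\<close>, and pairing with \<open>g\<close> gives a bound for
  \<open>S\<close> itself.
\<close>

lemma osc_square_integral:
  assumes [measurable]: "g \<in> borel_measurable lebesgue"
    and bound: "\<And>x. norm (g x) \<le> B" and supp: "\<And>x. x \<notin> D m z \<Longrightarrow> g x = 0"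
  shows "(\<integral>\<^sup>+x. (\<Sum>i = m..K. (osc i g x)\<^sup>2) * indicator (D m z) x \<partial>lebesgue)
    \<le> ennreal (4 * schur_const * (LINT x:D m z|lebesgue. (norm (g x))\<^sup>2))"
proof -
  let ?Q = "D m z"
  let ?n = "real DIM('a)"
  have B0: "0 \<le> B" using bound[of 0] norm_ge_zero order_trans by blast
  have g_int: "integrable lebesgue g"
  proof -
    have "set_integrable lebesgue ?Q g"
      by (rule set_integrable_bounded_cube[of _ B]) (use bound in auto)
    then show ?thesis
      unfolding set_integrable_def
      by (rule Bochner_Integration.integrable_cong[THEN iffD1, rotated -1]) (auto simp: indicator_def supp)
  qed
  have "osc_on i (D i x) g < top" for i x
  proof -
    have "osc i g x \<le> ennreal (?n + 1) * avg i (\<lambda>y. ennreal (norm (g y))) x"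
      by (rule osc_le_avg[OF g_int])
    also have "\<dots> < top"
    proof -
      have "(\<integral>\<^sup>+y. ennreal (norm (g y)) * indicator (D i x) y \<partial>lebesgue) \<le> (\<integral>\<^sup>+y. ennreal (norm (g y)) \<partial>lebesgue)"
        by (intro nn_integral_mono) (auto split: split_indicator)
      also have "\<dots> < top"
        using g_int by (auto simp: integrable_iff_bounded)
      finally show ?thesis
        using side_pos[of i]
        by (cases "\<integral>\<^sup>+y. ennreal (norm (g y)) * indicator (D i x) y \<partial>lebesgue")
          (auto simp: avg_eq divide_ennreal simp flip: ennreal_mult simp del: ennreal_plus)
    qed
    finally show ?thesis by (simp add: osc_def)
  qed
  then have "\<forall>i Q. \<exists>\<psi>. Q \<in> range (D i) \<longrightarrow> \<psi> \<in> bumps i Q \<and>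
    osc_on i Q g \<le> 2 * (ennreal (norm (LINT y|lebesgue. g y * \<psi> y)) / ennreal (vol i)) \<and>
    Re (LINT y|lebesgue. g y * \<psi> y) = norm (LINT y|lebesgue. g y * \<psi> y)"
    using near_optimal_bump by blast
  from this[unfolded choice_iff] obtain \<Psi> where \<Psi>0: "\<And>i Q. Q \<in> range (D i) \<Longrightarrow> \<Psi> i Q \<in> bumps i Q \<and>
    osc_on i Q g \<le> 2 * (ennreal (norm (LINT y|lebesgue. g y * \<Psi> i Q y)) / ennreal (vol i)) \<and>
    Re (LINT y|lebesgue. g y * \<Psi> i Q y) = norm (LINT y|lebesgue. g y * \<Psi> i Q y)"
    by blast
  have \<Psi>: "\<And>i x. \<Psi> i (D i x) \<in> bumps i (D i x)"
    "\<And>i x. osc i g x \<le> 2 * (ennreal (norm (LINT y|lebesgue. g y * \<Psi> i (D i x) y)) / ennreal (vol i))"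
    "\<And>i x. Re (LINT y|lebesgue. g y * \<Psi> i (D i x) y) = norm (LINT y|lebesgue. g y * \<Psi> i (D i x) y)"
    using \<Psi>0[OF rangeI] unfolding osc_def by auto
  define c where "c i x = norm (LINT y|lebesgue. g y * \<Psi> i (D i x) y) / vol i" for i x
  define H where "H i u = c i u *\<^sub>R \<Psi> i (D i u) u" for i u
  have c_nonneg: "0 \<le> c i x" for i x using vol_pos[of i] by (simp add: c_def)
  have c_cube: "c i y = c i x" if "y \<in> D i x" for i x y
    by (simp add: c_def cube_eq[OF that])
  have c_cube': "c i y = c i x" if "y \<in> D j x" "i \<le> j" for i j x y
    using c_cube cube_mono[OF that(2)] that(1) by blast
  have osc_c: "osc i g x \<le> ennreal (2 * c i x)" for i x
    using \<Psi>(2)[of i x] vol_pos[of i] by (simp add: c_def divide_ennreal numeral_mult_ennreal)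
  have [measurable]: "c i \<in> borel_measurable lebesgue" for i
    by (rule measurable_cubewise_constant) (rule c_cube)
  have [measurable]: "H i \<in> borel_measurable lebesgue" for i
  proof (rule measurable_piecewise_cubes)
    fix x
    note [measurable] = bump_measurable[OF \<Psi>(1)[of i x]]
    show "\<exists>g\<in>borel_measurable lebesgue. \<forall>y\<in>D i x. H i y = g y"
      by (rule bexI[of _ "\<lambda>y. c i x *\<^sub>R \<Psi> i (D i x) y"]) (auto simp: H_def c_cube cube_eq)
  qed
  have H_bound: "norm (H i u) \<le> c i u * (?n + 1)" for i u
    using bump_bound[OF \<Psi>(1)[of i u], of u] c_nonneg[of i u] by (simp add: H_def mult_left_mono)
  have c_bound: "c i x \<le> (?n + 1) * B" for i x
  proof -
    have "ennreal (norm (LINT y|lebesgue. g y * \<Psi> i (D i x) y)) = ennreal (norm (LINT y:D i x|lebesgue. g y * \<Psi> i (D i x) y))"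
      by (simp add: bump_integral_cube[OF \<Psi>(1)])
    also have "\<dots> \<le> ennreal ((?n + 1) * B * vol i)"
    proof (rule ennreal_leI)
      note [measurable] = bump_measurable[OF \<Psi>(1)[of i x]]
      have le: "norm (g y * \<Psi> i (D i x) y) \<le> (?n + 1) * B" for y
        using mult_mono[OF bound[of y] bump_bound[OF \<Psi>(1)[of i x], of y]] B0
        by (simp add: norm_mult mult.commute)
      have "norm (LINT y:D i x|lebesgue. g y * \<Psi> i (D i x) y) \<le> (LINT y:D i x|lebesgue. norm (g y * \<Psi> i (D i x) y))"
        by (rule set_integral_norm_bound) (rule set_integrable_bounded_cube[OF _ le], auto)
      also have "\<dots> \<le> (LINT y:D i x|lebesgue. (?n + 1) * B)"
        by (intro set_integral_mono set_integrable_bounded_cube[of _ "(?n + 1) * B"]) (use le B0 in auto)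
      also have "\<dots> = (?n + 1) * B * vol i"
        by (simp add: set_integral_const measure_cube emeasure_cube mult.commute)
      finally show "norm (LINT y:D i x|lebesgue. g y * \<Psi> i (D i x) y) \<le> (?n + 1) * B * vol i" .
    qed
    finally show ?thesis
      using vol_pos[of i] B0 by (simp add: c_def pos_divide_le_eq)
  qed
  define M where "M = (?n + 1) * B * (?n + 1)"
  have M: "c i x \<le> M" "norm (H i x) \<le> M" "0 \<le> M" for i x
  proof -
    show M0: "0 \<le> M" using B0 by (simp add: M_def)
    have "c i x * (?n + 1) \<le> M" unfolding M_def using c_bound[of i x] by (intro mult_right_mono) auto
    then show "norm (H i x) \<le> M" using H_bound[of i x] by simp
    have "(?n + 1) * B * 1 \<le> M" unfolding M_def using B0 by (intro mult_left_mono) auto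
    then show "c i x \<le> M" using c_bound[of i x] by simp
  qed
  have int_bounded: "set_integrable lebesgue (D j x) h"
    if "h \<in> borel_measurable lebesgue" "\<And>x. norm (h x) \<le> b" for h :: "'a \<Rightarrow> 'c::{banach,second_countable_topology}" and b j x
    by (rule set_integrable_bounded_cube[OF that]) auto
  define A where "A i = (LINT u:?Q|lebesgue. (c i u)\<^sup>2)" for i
  have int_cc: "set_integrable lebesgue (D k x) (\<lambda>u. c i u * c j u)" for i j k x
    by (rule int_bounded[of _ "M * M"]) (use M c_nonneg in \<open>auto simp: abs_mult intro!: mult_mono\<close>)
  have int_c2: "set_integrable lebesgue (D k x) (\<lambda>u. (c i u)\<^sup>2)" for i k x
    using int_cc[of k x i i] by (simp add: power2_eq_square)
  have int_gH: "set_integrable lebesgue (D k x) (\<lambda>u. Re (g u * H i u))" for i k x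
  proof (rule int_bounded)
    fix u
    have "norm (Re (g u * H i u)) \<le> norm (g u) * norm (H i u)"
      unfolding real_norm_def by (metis abs_Re_le_cmod norm_mult)
    also have "\<dots> \<le> B * M" using bound M B0 by (intro mult_mono) auto
    finally show "norm (Re (g u * H i u)) \<le> B * M" .
  qed measurable
  have int_HH: "set_integrable lebesgue (D k x) (\<lambda>u. H i u \<bullet> H j u)" for i j k x
    by (rule int_bounded[of _ "M * M"])
       (use M in \<open>auto intro!: order_trans[OF Cauchy_Schwarz_ineq2] mult_mono\<close>)
  have A_nonneg: "0 \<le> A i" for i
    unfolding A_def set_lebesgue_integral_def by (intro integral_nonneg_AE AE_I2) auto
  have cover: "D i x \<subseteq> ?Q" if "x \<in> ?Q" "m \<le> i" for i x
    using cube_mono[OF that(2), of x] cube_eq[OF that(1)] by simp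
  have diag: "(LINT u:?Q|lebesgue. Re (g u * H i u)) = A i" if i: "m \<le> i" for i
  proof -
    have "ennreal (norm (LINT u:?Q|lebesgue. Re (g u * H i u) - (c i u)\<^sup>2)) \<le>
      (\<integral>\<^sup>+u. 0 * indicator ?Q u \<partial>lebesgue)"
    proof (rule norm_set_integral_le_cubes[where k = i])
      show "D i x \<subseteq> ?Q" if "x \<in> ?Q" for x by (rule cover[OF that i])
      show "set_integrable lebesgue ?Q (\<lambda>u. Re (g u * H i u) - (c i u)\<^sup>2)"
        by (intro set_integral_diff int_gH int_c2)
      fix x
      note [measurable] = bump_measurable[OF \<Psi>(1)[of i x]]
      have gP: "set_integrable lebesgue (D i x) (\<lambda>u. g u * \<Psi> i (D i x) u)"
        by (rule int_bounded[of _ "B * (?n + 1)"])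
          (use bump_bound[OF \<Psi>(1)[of i x]] bound B0 in \<open>auto simp: norm_mult intro!: mult_mono\<close>)
      have "(LINT u:D i x|lebesgue. Re (g u * H i u)) = (LINT u:D i x|lebesgue. c i x * Re (g u * \<Psi> i (D i x) u))"
        by (intro set_lebesgue_integral_cong) (auto simp: H_def c_cube cube_eq algebra_simps)
      also have "\<dots> = c i x * Re (LINT u:D i x|lebesgue. g u * \<Psi> i (D i x) u)"
        using gP by (simp add: set_lebesgue_integral_def set_integrable_def integral_Re[symmetric] mult.left_commute)
      also have "\<dots> = (c i x)\<^sup>2 * vol i"
        using vol_pos[of i] by (simp add: bump_integral_cube[OF \<Psi>(1)] \<Psi>(3) c_def power2_eq_square)
      also have "\<dots> = (LINT u:D i x|lebesgue. (c i x)\<^sup>2)"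
        by (simp add: set_integral_const measure_cube emeasure_cube mult.commute)
      also have "\<dots> = (LINT u:D i x|lebesgue. (c i u)\<^sup>2)"
        by (intro set_lebesgue_integral_cong) (auto simp: c_cube)
      finally have "(LINT u:D i x|lebesgue. Re (g u * H i u) - (c i u)\<^sup>2) = 0"
        by (subst set_integral_diff(2)[OF int_gH int_c2]) simp
      then show "ennreal (norm (LINT u:D i x|lebesgue. Re (g u * H i u) - (c i u)\<^sup>2)) \<le>
        (\<integral>\<^sup>+u. 0 * indicator (D i x) u \<partial>lebesgue)" by simp
    qed simp
    then have "(LINT u:?Q|lebesgue. Re (g u * H i u) - (c i u)\<^sup>2) = 0" by simp
    then show ?thesis
      by (subst (asm) set_integral_diff(2)[OF int_gH int_c2]) (simp add: A_def)
  qed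
  have off: "\<bar>LINT u:?Q|lebesgue. H i u \<bullet> H j u\<bar> \<le> ?n * (?n + 1) * decay ^ (j - i) * ((A i + A j) / 2)"
    if ij: "m \<le> i" "i \<le> j" for i j
  proof -
    let ?\<kappa> = "?n * (?n + 1) * decay ^ (j - i)"
    have \<kappa>: "0 \<le> ?\<kappa>" using decay by simp
    have "ennreal (norm (LINT u:?Q|lebesgue. H i u \<bullet> H j u)) \<le>
      (\<integral>\<^sup>+u. ennreal (?\<kappa> * (c i u * c j u)) * indicator ?Q u \<partial>lebesgue)"
    proof (rule norm_set_integral_le_cubes[where k = j])
      show "D j x \<subseteq> ?Q" if "x \<in> ?Q" for x by (rule cover[OF that]) (use ij in simp)
      show "set_integrable lebesgue ?Q (\<lambda>u. H i u \<bullet> H j u)" by (rule int_HH)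
      fix x
      note [measurable] = bump_measurable[OF \<Psi>(1)[of i x]] bump_measurable[OF \<Psi>(1)[of j x]]
      have intH: "set_integrable lebesgue (D j x) (H j)"
        by (rule int_bounded[of _ M]) (use M in auto)
      have "(LINT u:D j x|lebesgue. H j u) = (LINT u:D j x|lebesgue. c j x *\<^sub>R \<Psi> j (D j x) u)"
        by (intro set_lebesgue_integral_cong) (auto simp: H_def c_cube cube_eq)
      also have "\<dots> = c j x *\<^sub>R (LINT u:D j x|lebesgue. 1 * \<Psi> j (D j x) u)"
        by simp
      also have "\<dots> = 0"
        unfolding bump_integral_cube[OF \<Psi>(1)] using \<Psi>(1)[of j x] by (simp add: bumps_def)
      finally have zero: "(LINT u:D j x|lebesgue. H i x \<bullet> H j u) = 0"
        using intH by (simp add: set_lebesgue_integral_def set_integrable_def inner_scaleR_right[symmetric] del: inner_scaleR_right)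
      have pt: "\<bar>(H i u - H i x) \<bullet> H j u\<bar> \<le> ?\<kappa> * (c i x * c j x)" if u: "u \<in> D j x" for u
      proof -
        have ui: "u \<in> D i x" using cube_mono[OF ij(2), of x] u by blast
        have "H i u - H i x = c i x *\<^sub>R (\<Psi> i (D i x) u - \<Psi> i (D i x) x)"
          by (simp add: H_def c_cube[OF ui] cube_eq[OF ui] scaleR_diff_right)
        then have "norm (H i u - H i x) \<le> c i x * (?n * decay ^ (j - i))"
          using bump_osc_le[OF \<Psi>(1)[of i x], of u "j - i" x] u ij c_nonneg[of i x]
          by (simp add: decay_def mult_left_mono)
        moreover have "norm (H j u) \<le> c j x * (?n + 1)"
          using H_bound[of j u] c_cube[OF u] by simp
        ultimately have "norm (H i u - H i x) * norm (H j u) \<le> (c i x * (?n * decay ^ (j - i))) * (c j x * (?n + 1))"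
          using c_nonneg decay by (intro mult_mono) auto
        then show ?thesis
          using Cauchy_Schwarz_ineq2[of "H i u - H i x" "H j u"] by (simp add: ac_simps)
      qed
      have int1: "set_integrable lebesgue (D j x) (\<lambda>u. (H i u - H i x) \<bullet> H j u)"
      proof (rule int_bounded[of _ "(M + M) * M"])
        show "norm ((H i u - H i x) \<bullet> H j u) \<le> (M + M) * M" for u
          unfolding real_norm_def using M
          by (intro order_trans[OF Cauchy_Schwarz_ineq2] mult_mono order_trans[OF norm_triangle_ineq4] add_mono) auto
      qed measurable
      have int2: "set_integrable lebesgue (D j x) (\<lambda>u. H i x \<bullet> H j u)"
        by (rule int_bounded[of _ "M * M"])
          (use M in \<open>auto intro!: order_trans[OF Cauchy_Schwarz_ineq2] mult_mono\<close>)
      have "(LINT u:D j x|lebesgue. H i u \<bullet> H j u) = (LINT u:D j x|lebesgue. (H i u - H i x) \<bullet> H j u + H i x \<bullet> H j u)"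
        by (simp add: inner_diff_left)
      also have "\<dots> = (LINT u:D j x|lebesgue. (H i u - H i x) \<bullet> H j u)"
        by (subst set_integral_add(2)[OF int1 int2]) (simp add: zero)
      finally have "norm (LINT u:D j x|lebesgue. H i u \<bullet> H j u) \<le> (LINT u:D j x|lebesgue. norm ((H i u - H i x) \<bullet> H j u))"
        using set_integral_norm_bound[OF int1] by simp
      also have "\<dots> \<le> (LINT u:D j x|lebesgue. ?\<kappa> * (c i x * c j x))"
      proof (rule set_integral_mono)
        show "set_integrable lebesgue (D j x) (\<lambda>u. norm ((H i u - H i x) \<bullet> H j u))"
          using int1 by (rule set_integrable_norm)
        show "set_integrable lebesgue (D j x) (\<lambda>u. ?\<kappa> * (c i x * c j x))"
          by (rule int_bounded[of _ "\<bar>?\<kappa> * (c i x * c j x)\<bar>"]) auto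
      qed (use pt in auto)
      also have "\<dots> = ?\<kappa> * (c i x * c j x) * vol j"
        by (simp add: set_integral_const measure_cube emeasure_cube mult.commute)
      finally have "ennreal (norm (LINT u:D j x|lebesgue. H i u \<bullet> H j u)) \<le> ennreal (?\<kappa> * (c i x * c j x) * vol j)"
        by (rule ennreal_leI)
      also have "\<dots> = (\<integral>\<^sup>+u. ennreal (?\<kappa> * (c i x * c j x)) * indicator (D j x) u \<partial>lebesgue)"
        using vol_pos[of j] \<kappa> c_nonneg by (subst ennreal_mult) (auto simp: nn_integral_cmult_indicator emeasure_cube_vol)
      also have "\<dots> = (\<integral>\<^sup>+u. ennreal (?\<kappa> * (c i u * c j u)) * indicator (D j x) u \<partial>lebesgue)"
        using c_cube' ij(2) by (intro nn_integral_cong) (auto split: split_indicator)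
      finally show "ennreal (norm (LINT u:D j x|lebesgue. H i u \<bullet> H j u)) \<le> \<dots>" .
    qed measurable
    also have "\<dots> = ennreal (LINT u:?Q|lebesgue. ?\<kappa> * (c i u * c j u))"
      using \<kappa> c_nonneg by (intro nn_set_integral_eq set_integrable_mult_right int_cc) auto
    finally have "norm (LINT u:?Q|lebesgue. H i u \<bullet> H j u) \<le> (LINT u:?Q|lebesgue. ?\<kappa> * (c i u * c j u))"
      using \<kappa> c_nonneg by (subst (asm) ennreal_le_iff) (auto simp: set_lebesgue_integral_def intro!: integral_nonneg_AE AE_I2)
    also have "\<dots> = ?\<kappa> * (LINT u:?Q|lebesgue. c i u * c j u)" by simp
    also have "(LINT u:?Q|lebesgue. c i u * c j u) \<le> (LINT u:?Q|lebesgue. ((c i u)\<^sup>2 + (c j u)\<^sup>2) / 2)"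
    proof (rule set_integral_mono)
      show "set_integrable lebesgue ?Q (\<lambda>u. ((c i u)\<^sup>2 + (c j u)\<^sup>2) / 2)"
        using int_c2 by (intro set_integrable_divide set_integral_add) auto
      fix u
      show "c i u * c j u \<le> ((c i u)\<^sup>2 + (c j u)\<^sup>2) / 2"
        using sum_squares_bound[of "c i u" "c j u"] by simp
    qed (rule int_cc)
    also have "\<dots> = (A i + A j) / 2"
      by (simp add: A_def set_integral_add(2)[OF int_c2 int_c2])
    finally show ?thesis using \<kappa> by (simp add: mult_left_mono)
  qed
  have off': "\<bar>LINT u:?Q|lebesgue. H i u \<bullet> H j u\<bar> \<le> ?n * (?n + 1) * decay ^ (max i j - min i j) * ((A i + A j) / 2)"
    if "m \<le> i" "m \<le> j" for i j
    using off[of i j] off[of j i] that by (cases "i \<le> j") (auto simp: inner_commute add.commute max_def min_def)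
  \<comment> \<open>The Schur test: expand the square and use the decay of the off-diagonal terms.\<close>
  define F where "F u = (\<Sum>i = m..K. H i u)" for u
  have F_int: "set_integrable lebesgue ?Q (\<lambda>u. (norm (F u))\<^sup>2)"
    unfolding F_def power2_norm_eq_inner inner_sum_left inner_sum_right
    by (intro set_integrable_finite_sum int_HH)
  define S where "S = (\<Sum>i = m..K. A i)"
  have F_norm: "(LINT u:?Q|lebesgue. (norm (F u))\<^sup>2) \<le> schur_const * S"
  proof -
    have "(LINT u:?Q|lebesgue. (norm (F u))\<^sup>2) = (\<Sum>i = m..K. \<Sum>j = m..K. LINT u:?Q|lebesgue. H i u \<bullet> H j u)"
      unfolding F_def power2_norm_eq_inner inner_sum_left inner_sum_right
      by (simp only: set_integral_finite_sum set_integrable_finite_sum int_HH)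
        (subst sum.swap, simp add: inner_commute)
    also have "\<dots> \<le> (\<Sum>i = m..K. \<Sum>j = m..K. ?n * (?n + 1) * decay ^ (max i j - min i j) * ((A i + A j) / 2))"
      by (intro sum_mono order_trans[OF abs_ge_self off']) auto
    also have "\<dots> = (\<Sum>i = m..K. \<Sum>j = m..K. ?n * (?n + 1) / 2 *
        (decay ^ (max i j - min i j) * A i + decay ^ (max i j - min i j) * A j))"
      by (intro sum.cong) (auto simp: field_simps)
    also have "\<dots> = ?n * (?n + 1) / 2 * ((\<Sum>i = m..K. \<Sum>j = m..K. decay ^ (max i j - min i j) * A i) +
        (\<Sum>i = m..K. \<Sum>j = m..K. decay ^ (max i j - min i j) * A j))"
      by (simp only: sum_distrib_left[symmetric] sum.distrib)
    also have "(\<Sum>i = m..K. \<Sum>j = m..K. decay ^ (max i j - min i j) * A j) =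
        (\<Sum>i = m..K. \<Sum>j = m..K. decay ^ (max i j - min i j) * A i)"
      by (subst sum.swap) (simp add: max.commute min.commute)
    finally have 1: "(LINT u:?Q|lebesgue. (norm (F u))\<^sup>2) \<le>
      ?n * (?n + 1) * (\<Sum>i = m..K. \<Sum>j = m..K. decay ^ (max i j - min i j) * A i)" by simp
    have "(\<Sum>i = m..K. \<Sum>j = m..K. decay ^ (max i j - min i j) * A i) \<le> (\<Sum>i = m..K. 2 / (1 - decay) * A i)"
      unfolding sum_distrib_right[symmetric] using A_nonneg sum_decay_le
      by (intro sum_mono mult_right_mono) auto
    also have "\<dots> = 2 / (1 - decay) * S" by (simp add: S_def sum_distrib_left)
    finally have "?n * (?n + 1) * (\<Sum>i = m..K. \<Sum>j = m..K. decay ^ (max i j - min i j) * A i)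
      \<le> ?n * (?n + 1) * (2 / (1 - decay) * S)"
      by (intro mult_left_mono) auto
    with 1 show ?thesis unfolding schur_const_def by (simp only: mult.assoc)
  qed
  have gF: "S = (LINT u:?Q|lebesgue. Re (g u * F u))"
  proof -
    have "S = (\<Sum>i = m..K. LINT u:?Q|lebesgue. Re (g u * H i u))"
      unfolding S_def by (intro sum.cong diag[symmetric]) auto
    also have "\<dots> = (LINT u:?Q|lebesgue. (\<Sum>i = m..K. Re (g u * H i u)))"
      by (rule set_integral_finite_sum[symmetric]) (rule int_gH)
    finally show ?thesis by (simp only: F_def sum_distrib_left Re_sum)
  qed
  have g2: "set_integrable lebesgue ?Q (\<lambda>u. (norm (g u))\<^sup>2)"
    by (rule int_bounded[of _ "B\<^sup>2"]) (use bound in \<open>auto intro!: power_mono\<close>)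
  have pos: "0 < schur_const" by (rule schur_const_pos)
  \<comment> \<open>The inequality of Cauchy and Schwarz, in additive form with a parameter that allows absorbing \<open>S\<close>.\<close>
  have "S \<le> (LINT u:?Q|lebesgue. schur_const / 2 * (norm (g u))\<^sup>2 + 1 / (2 * schur_const) * (norm (F u))\<^sup>2)"
    unfolding gF
  proof (rule set_integral_mono)
    show "set_integrable lebesgue ?Q (\<lambda>u. Re (g u * F u))"
      unfolding F_def sum_distrib_left Re_sum by (intro set_integrable_finite_sum int_gH)
    show "set_integrable lebesgue ?Q (\<lambda>u. schur_const / 2 * (norm (g u))\<^sup>2 + 1 / (2 * schur_const) * (norm (F u))\<^sup>2)"
      using g2 F_int by (intro set_integral_add set_integrable_mult_right) auto
    fix u
    have "Re (g u * F u) \<le> norm (g u) * norm (F u)"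
      by (metis complex_Re_le_cmod norm_mult)
    also have "\<dots> \<le> schur_const / 2 * (norm (g u))\<^sup>2 + 1 / (2 * schur_const) * (norm (F u))\<^sup>2"
    proof -
      have "2 * (schur_const * norm (g u)) * norm (F u) \<le> (schur_const * norm (g u))\<^sup>2 + (norm (F u))\<^sup>2"
        using sum_squares_bound[of "schur_const * norm (g u)" "norm (F u)"] by simp
      then show ?thesis using pos by (simp add: field_simps power2_eq_square)
    qed
    finally show "Re (g u * F u) \<le> schur_const / 2 * (norm (g u))\<^sup>2 + 1 / (2 * schur_const) * (norm (F u))\<^sup>2" .
  qed
  also have "\<dots> = schur_const / 2 * (LINT u:?Q|lebesgue. (norm (g u))\<^sup>2) + 1 / (2 * schur_const) * (LINT u:?Q|lebesgue. (norm (F u))\<^sup>2)"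
    using g2 F_int by (subst set_integral_add(2)) (auto intro!: set_integrable_mult_right)
  also have "\<dots> \<le> schur_const / 2 * (LINT u:?Q|lebesgue. (norm (g u))\<^sup>2) + 1 / (2 * schur_const) * (schur_const * S)"
    using F_norm pos by (intro add_left_mono mult_left_mono) auto
  finally have S_le: "S \<le> schur_const * (LINT u:?Q|lebesgue. (norm (g u))\<^sup>2)"
    using pos by (simp add: field_simps)
  have "(\<integral>\<^sup>+x. (\<Sum>i = m..K. (osc i g x)\<^sup>2) * indicator ?Q x \<partial>lebesgue) \<le>
    (\<integral>\<^sup>+x. (\<Sum>i = m..K. ennreal (4 * (c i x)\<^sup>2) * indicator ?Q x) \<partial>lebesgue)"
  proof (intro nn_integral_mono)
    fix x
    have "(osc i g x)\<^sup>2 \<le> ennreal (4 * (c i x)\<^sup>2)" for i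
    proof -
      have "(osc i g x)\<^sup>2 \<le> (ennreal (2 * c i x))\<^sup>2" by (rule power_mono_ennreal) (rule osc_c)
      also have "\<dots> = ennreal (4 * (c i x)\<^sup>2)" using c_nonneg[of i x] by (simp add: ennreal_power power_mult_distrib)
      finally show ?thesis .
    qed
    then show "(\<Sum>i = m..K. (osc i g x)\<^sup>2) * indicator ?Q x \<le> (\<Sum>i = m..K. ennreal (4 * (c i x)\<^sup>2) * indicator ?Q x)"
      unfolding sum_distrib_right by (intro sum_mono mult_right_mono) auto
  qed
  also have "\<dots> = (\<Sum>i = m..K. \<integral>\<^sup>+x. ennreal (4 * (c i x)\<^sup>2) * indicator ?Q x \<partial>lebesgue)"
    by (rule nn_integral_sum) measurable
  also have "\<dots> = (\<Sum>i = m..K. ennreal (4 * A i))"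
  proof (intro sum.cong refl)
    fix i
    have "4 * A i = (LINT u:?Q|lebesgue. 4 * (c i u)\<^sup>2)" by (simp add: A_def)
    moreover have "ennreal \<dots> = (\<integral>\<^sup>+x. ennreal (4 * (c i x)\<^sup>2) * indicator ?Q x \<partial>lebesgue)"
      by (intro nn_set_integral_eq[symmetric] set_integrable_mult_right int_c2) auto
    ultimately show "(\<integral>\<^sup>+x. ennreal (4 * (c i x)\<^sup>2) * indicator ?Q x \<partial>lebesgue) = ennreal (4 * A i)" by simp
  qed
  also have "\<dots> = ennreal (4 * S)"
    using A_nonneg by (simp add: S_def sum_distrib_left)
  also have "\<dots> \<le> ennreal (4 * schur_const * (LINT x:?Q|lebesgue. (norm (g x))\<^sup>2))"
    using S_le by (intro ennreal_leI) simp
  finally show ?thesis .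
qed

end

section \<open>Local distribution estimate\<close>

lemma ennpow_1 [simp]: "ennpow 1 a = 1"
  using ennpow_ennreal[of 1 a] by simp

lemma ennreal_sum_squares_le: "finite I \<Longrightarrow> (\<Sum>i\<in>I. (f i)\<^sup>2) \<le> (\<Sum>i\<in>I. f i :: ennreal)\<^sup>2"
proof (induction rule: finite_induct)
  case (insert i I)
  have "(f i)\<^sup>2 + (\<Sum>i\<in>I. (f i)\<^sup>2) \<le> (f i)\<^sup>2 + (\<Sum>i\<in>I. f i)\<^sup>2"
    using insert by (intro add_left_mono)
  also have "\<dots> \<le> (f i + (\<Sum>i\<in>I. f i))\<^sup>2"
    by (simp add: power2_eq_square distrib_left distrib_right add.assoc add_mono add_increasing)
  finally show ?case using insert by simp
qed simp

lemma ennreal_power2_add_le: "(a + b)\<^sup>2 \<le> 2 * a\<^sup>2 + 2 * (b::ennreal)\<^sup>2"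
proof (cases a; cases b)
  fix x y assume xy: "0 \<le> x" "a = ennreal x" "0 \<le> y" "b = ennreal y"
  have "(x + y)\<^sup>2 \<le> 2 * x\<^sup>2 + 2 * y\<^sup>2"
    using sum_squares_bound[of x y] by (simp add: power2_sum)
  then have "ennreal ((x + y)\<^sup>2) \<le> ennreal (2 * x\<^sup>2 + 2 * y\<^sup>2)"
    by (rule ennreal_leI)
  moreover have "(a + b)\<^sup>2 = ennreal ((x + y)\<^sup>2)"
    using xy by (simp add: ennreal_power[symmetric] ennreal_plus)
  ultimately show ?thesis using xy by (simp add: numeral_mult_ennreal ennreal_power)
qed (auto simp: ennreal_mult_top)

text \<open>
  The weight and its dual are the two factors into which \<open>1\<close> is split.
\<close>

lemma weighted_Hoelder:
  fixes w :: "'a::euclidean_space \<Rightarrow> real"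
  assumes q: "1 < q" and w: "\<And>x. 0 < w x"
    and m: "w \<in> borel_measurable lebesgue" "u \<in> borel_measurable lebesgue" "E \<in> sets lebesgue"
  shows "ennpow (\<integral>\<^sup>+x. u x * indicator E x \<partial>lebesgue) q \<le>
    (\<integral>\<^sup>+x. ennpow (u x) q * ennreal (w x) * indicator E x \<partial>lebesgue) *
    ennpow (\<integral>\<^sup>+x. ennreal (w x powr (- 1 / (q - 1))) * indicator E x \<partial>lebesgue) (q - 1)"
proof -
  note [measurable] = m
  let ?f = "\<lambda>x. u x * ennreal (w x powr (1 / q)) * indicator E x"
  let ?g = "\<lambda>x. ennreal (w x powr (- (1 / q))) * indicator E x"
  have "ennpow (\<integral>\<^sup>+x. ?f x * ?g x \<partial>lebesgue) q \<le> (\<integral>\<^sup>+x. ennpow (?f x) q \<partial>lebesgue) *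
    ennpow (\<integral>\<^sup>+x. ennpow (?g x) (q / (q - 1)) \<partial>lebesgue) (q - 1)"
    by (rule Hoelder_nn_integral[OF q]) measurable
  also have "(\<integral>\<^sup>+x. ?f x * ?g x \<partial>lebesgue) = (\<integral>\<^sup>+x. u x * indicator E x \<partial>lebesgue)"
  proof (intro nn_integral_cong)
    fix x
    have "ennreal (w x powr (1 / q)) * ennreal (w x powr (- (1 / q))) = 1"
      using w[of x] by (simp flip: ennreal_mult powr_add)
    then show "?f x * ?g x = u x * indicator E x"
      by (auto split: split_indicator simp: mult.assoc)
  qed
  also have "(\<integral>\<^sup>+x. ennpow (?f x) q \<partial>lebesgue) = (\<integral>\<^sup>+x. ennpow (u x) q * ennreal (w x) * indicator E x \<partial>lebesgue)"
    using q w less_imp_le[OF w] by (intro nn_integral_cong) (auto split: split_indicator simp: ennpow_mult ennpow_ennreal powr_powr)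
  also have "(\<integral>\<^sup>+x. ennpow (?g x) (q / (q - 1)) \<partial>lebesgue) =
      (\<integral>\<^sup>+x. ennreal (w x powr (- 1 / (q - 1))) * indicator E x \<partial>lebesgue)"
    using q by (intro nn_integral_cong) (auto split: split_indicator simp: ennpow_ennreal powr_powr)
  finally show ?thesis .
qed

context oscillation_grid
begin

definition "cz_const = 16 * schur_const * 4 ^ DIM('a) + 8 * DIM('a) / (1 - decay)"

lemma cz_const_pos: "0 < cz_const"
  using schur_const_pos decay by (auto simp: cz_const_def intro!: add_pos_nonneg)

lemma nn_integral_avg_cubes:
  assumes [measurable]: "b \<in> borel_measurable lebesgue" and mj: "m \<le> j"
  shows "(\<integral>\<^sup>+x. avg j b x * indicator (D m z) x \<partial>lebesgue) \<le> (\<integral>\<^sup>+x. b x * indicator (D m z) x \<partial>lebesgue)"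
proof (rule nn_integral_saturated_mono[where k = j])
  fix x assume "x \<in> D m z"
  then show "D j x \<subseteq> D m z" using cube_mono[OF mj, of x] cube_eq[of x m z] by simp
  have "(\<integral>\<^sup>+y. avg j b y * indicator (D j x) y \<partial>lebesgue) = (\<integral>\<^sup>+y. avg j b x * indicator (D j x) y \<partial>lebesgue)"
    by (intro nn_integral_cong) (auto split: split_indicator simp: wavg_cube)
  also have "\<dots> = avg j b x * ennreal (vol j)"
    by (simp add: nn_integral_cube_const vol_eq)
  also have "\<dots> = (\<integral>\<^sup>+y. b y * indicator (D j x) y \<partial>lebesgue)"
    using vol_pos[of j] by (simp add: avg_eq vol_eq[symmetric] ennreal_divide_mult_cancel)
  finally show "(\<integral>\<^sup>+y. avg j b y * indicator (D j x) y \<partial>lebesgue) \<le> (\<integral>\<^sup>+y. b y * indicator (D j x) y \<partial>lebesgue)"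
    by simp
qed measurable

text \<open>
  The difference of \<open>f\<close> and its mean over a cube of level \<open>i\<close> has mean
  zero there, so the bump may be replaced by its deviation from a constant.
\<close>

lemma stopped_bump_pairing:
  assumes f: "integrable lebesgue f" and \<psi>: "\<psi> \<in> bumps j (D j x)" and ji: "j \<le> i"
  shows "norm (LINT y:D i u|lebesgue. (f y - (LINT v:D i u|lebesgue. f v) / of_real (vol i)) * \<psi> y) \<le>
    2 * DIM('a) * decay ^ (i - j) * (LINT y:D i u|lebesgue. norm (f y))"
proof -
  let ?P = "D i u"
  define a where "a = (LINT v:?P|lebesgue. f v) / of_real (vol i)"
  note [measurable] = bump_measurable[OF \<psi>] borel_measurable_integrable[OF f]
  have fP: "set_integrable lebesgue ?P f"
    using f unfolding set_integrable_def by (intro integrable_mult_indicator) auto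
  have cP: "set_integrable lebesgue ?P (\<lambda>_. c)" for c :: complex
    by (rule set_integrable_bounded_cube[of _ "norm c"]) auto
  have fa: "set_integrable lebesgue ?P (\<lambda>y. f y - a)"
    by (intro set_integral_diff fP cP)
  have zero: "(LINT y:?P|lebesgue. f y - a) = 0"
    using vol_pos[of i] set_integral_diff(2)[OF fP cP[of a]]
    by (simp add: set_integral_const measure_cube emeasure_cube a_def scaleR_conv_of_real)
  have fa\<psi>: "set_integrable lebesgue ?P (\<lambda>y. (f y - a) * \<psi> y)"
    by (rule set_integrable_bound[OF set_integrable_mult_left[of "of_real (DIM('a) + 1)", OF fa]])
      (use bump_bound[OF \<psi>] in \<open>auto simp: set_borel_measurable_def norm_mult add.commute simp del: of_real_add of_nat_add intro!: AE_I2 mult_left_mono\<close>)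
  have "(LINT y:?P|lebesgue. (f y - a) * \<psi> y) = (LINT y:?P|lebesgue. (f y - a) * \<psi> y - (f y - a) * \<psi> u)"
    by (subst set_integral_diff(2)[OF fa\<psi> set_integrable_mult_left[OF fa]]) (simp add: zero)
  also have "norm \<dots> \<le> (LINT y:?P|lebesgue. norm ((f y - a) * \<psi> y - (f y - a) * \<psi> u))"
    by (intro set_integral_norm_bound set_integral_diff fa\<psi> set_integrable_mult_left[OF fa])
  also have "\<dots> \<le> (LINT y:?P|lebesgue. (DIM('a) * decay ^ (i - j)) * (norm (f y) + norm a))"
  proof (rule set_integral_mono)
    show "set_integrable lebesgue ?P (\<lambda>y. norm ((f y - a) * \<psi> y - (f y - a) * \<psi> u))"
      by (intro set_integrable_norm set_integral_diff fa\<psi> set_integrable_mult_left[OF fa])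
    show "set_integrable lebesgue ?P (\<lambda>y. (DIM('a) * decay ^ (i - j)) * (norm (f y) + norm a))"
      by (intro set_integrable_mult_right set_integral_add set_integrable_norm fP)
        (use cP[of a] in \<open>auto intro!: set_integrable_norm\<close>)
    fix y assume y: "y \<in> ?P"
    have "norm (\<psi> y - \<psi> u) \<le> DIM('a) * decay ^ (i - j)"
      using bump_osc_le[OF \<psi>, of y "i - j" u] y ji by (simp add: decay_def)
    moreover have "norm (f y - a) \<le> norm (f y) + norm a" by (rule norm_triangle_ineq4)
    ultimately have "norm (f y - a) * norm (\<psi> y - \<psi> u) \<le> (norm (f y) + norm a) * (DIM('a) * decay ^ (i - j))"
      by (intro mult_mono) auto
    then show "norm ((f y - a) * \<psi> y - (f y - a) * \<psi> u) \<le> (DIM('a) * decay ^ (i - j)) * (norm (f y) + norm a)"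
      unfolding right_diff_distrib[symmetric] norm_mult by (simp only: mult.commute)
  qed
  also have "\<dots> = (DIM('a) * decay ^ (i - j)) * ((LINT y:?P|lebesgue. norm (f y)) + norm a * vol i)"
    using set_integrable_norm[OF fP] set_integrable_norm[OF cP[of a]]
    by (simp add: set_integral_add(2) set_integral_const measure_cube emeasure_cube mult.commute)
  also have "\<dots> \<le> (DIM('a) * decay ^ (i - j)) * ((LINT y:?P|lebesgue. norm (f y)) + (LINT y:?P|lebesgue. norm (f y)))"
  proof (intro mult_left_mono add_left_mono)
    have "norm a * vol i = norm (LINT v:?P|lebesgue. f v)"
      using vol_pos[of i] by (simp add: a_def norm_divide)
    also have "\<dots> \<le> (LINT y:?P|lebesgue. norm (f y))"
      by (rule set_integral_norm_bound[OF fP])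
    finally show "norm a * vol i \<le> (LINT y:?P|lebesgue. norm (f y))" .
  qed (use decay in auto)
  finally show ?thesis by (simp add: a_def mult.assoc)
qed

text \<open>
  Calderon--Zygmund decomposition at height \<open>h\<close>. Below \<open>D m z\<close>, stop at
  the first cube where the average of \<open>f\<close> in modulus exceeds \<open>h\<close>, or at
  level \<open>K + 1\<close>, and let \<open>g\<close> be the mean of \<open>f\<close> over the cube
  where the stopping occurs. Then \<open>g\<close> is bounded by a multiple of \<open>h\<close>, and
  almost orthogonality controls its square sum. At a point where the maximal function is at most
  \<open>h\<close> no cube of level up to \<open>K\<close> stops, so that the remainder \<open>f -
  g\<close> has mean zero on strictly smaller cubes than those whose oscillation is measured; the
  decay of bumps then controls its contribution in \<open>L\<^sup>1\<close>. Stopping at level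
  \<open>K + 1\<close> at the latest makes \<open>g\<close> constant on the cubes of that level.
\<close>

lemma local_good_set:
  assumes f: "integrable lebesgue f" and h: "0 < h" and \<mu>: "0 < \<mu>"
  shows "emeasure lebesgue {x \<in> D m z. ennreal (\<mu>\<^sup>2) < (\<Sum>j = m..K. (osc j f x)\<^sup>2) \<and>
      maxf (\<lambda>y. ennreal (norm (f y))) x \<le> ennreal h}
    \<le> ennreal (cz_const * (h\<^sup>2 / \<mu>\<^sup>2 + h / \<mu>) * vol m)" (is "emeasure _ ?G \<le> _")
proof (cases "?G = {}")
  case False
  let ?Q = "D m z"
  let ?n = "real DIM('a)"
  define nf where "nf y = ennreal (norm (f y))" for y
  note [measurable] = borel_measurable_integrable[OF f]
  have [measurable]: "nf \<in> borel_measurable lebesgue" unfolding nf_def by measurable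
  have good: "avg j nf x \<le> ennreal h" if "x \<in> ?G" for j x
    using that wavg_le_wmax[of "\<lambda>_. 1" j nf x] by (auto simp: nf_def[abs_def])
  obtain x0 where x0: "x0 \<in> ?G" using False by blast
  have avgQ: "avg m nf z \<le> ennreal h"
    using good[OF x0, of m] wavg_cube[of x0 m z] x0 by auto
  have mK: "m \<le> K"
    using x0 by (cases "m \<le> K") auto
  define stop where "stop j x \<longleftrightarrow> m \<le> j \<and> (j = Suc K \<or> ennreal h < avg j nf x)" for j x
  \<comment> \<open>\<open>\<tau> x\<close> is the level at which the cubes around \<open>x\<close> stop.\<close>
  define \<tau> where "\<tau> x = (LEAST j. stop j x)" for x
  have stopK: "stop (Suc K) x" for x using mK by (simp add: stop_def)
  have \<tau>_stop: "stop (\<tau> x) x" for x unfolding \<tau>_def by (rule LeastI) (rule stopK)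
  have \<tau>_least: "\<not> stop j x" if "j < \<tau> x" for j x using that not_less_Least unfolding \<tau>_def by blast
  have \<tau>_bounds: "m \<le> \<tau> x" "\<tau> x \<le> Suc K" for x
    using \<tau>_stop[of x] Least_le[of "\<lambda>j. stop j x", OF stopK] by (auto simp: stop_def \<tau>_def)
  have \<tau>_cube: "\<tau> y = \<tau> x" if y: "y \<in> D k x" "\<tau> x \<le> k" for x y k
  proof -
    have eq: "stop j y \<longleftrightarrow> stop j x" if "j \<le> \<tau> x" for j
    proof -
      have "y \<in> D j x" using cube_mono[of j k x] y that by auto
      then show ?thesis by (simp add: stop_def wavg_cube)
    qed
    show ?thesis unfolding \<tau>_def[of y]
    proof (rule Least_equality)
      show "stop (\<tau> x) y" using eq \<tau>_stop by blast
      show "\<tau> x \<le> j" if "stop j y" for j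
        using that eq[of j] \<tau>_least[of j x] by (cases "\<tau> x \<le> j") auto
    qed
  qed
  have \<tau>_fine: "\<tau> y = \<tau> x" if "y \<in> D (Suc K) x" for x y
    using \<tau>_cube[OF that \<tau>_bounds(2)] .
  have in_Q: "D j x \<subseteq> ?Q" if "x \<in> ?Q" "m \<le> j" for j x
    using cube_mono[OF that(2), of x] cube_eq[OF that(1)] by simp
  have in_Q_iff: "y \<in> ?Q \<longleftrightarrow> x \<in> ?Q" if "y \<in> D j x" "m \<le> j" for j x y
    using in_Q[of x j] in_Q[of y j] cube_eq[OF that(1)] that mem_cube by blast
  define g where "g x = (if x \<in> ?Q then (LINT v:D (\<tau> x) x|lebesgue. f v) / of_real (vol (\<tau> x)) else 0)" for x
  have g_cube: "g y = g x" if "y \<in> D k x" "\<tau> x \<le> k" for x y k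
    using \<tau>_cube[OF that] in_Q_iff[OF that(1)] \<tau>_bounds(1)[of x] that
      cube_eq_coarser[OF that(2,1)]
    by (simp add: g_def)
  have g_meas [measurable]: "g \<in> borel_measurable lebesgue"
    by (rule measurable_cubewise_constant[where k = "Suc K"]) (use g_cube \<tau>_bounds in blast)
  have [measurable]: "\<tau> \<in> borel_measurable lebesgue"
    by (rule measurable_cubewise_constant[where k = "Suc K"]) (rule \<tau>_fine)
  have fin_cube: "set_integrable lebesgue (D j x) f" for j x
    using f unfolding set_integrable_def by (intro integrable_mult_indicator) auto
  have nf_int: "(\<integral>\<^sup>+y. nf y * indicator (D j x) y \<partial>lebesgue) = ennreal (LINT y:D j x|lebesgue. norm (f y))" for j x
    unfolding nf_def by (intro nn_set_integral_eq set_integrable_norm fin_cube) auto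
  have avg_nf: "avg j nf x = ennreal ((LINT y:D j x|lebesgue. norm (f y)) / vol j)" for j x
    using vol_pos[of j] unfolding avg_eq nf_int vol_eq[symmetric]
    by (intro divide_ennreal) (auto simp: set_lebesgue_integral_def intro!: integral_nonneg_AE AE_I2)
  have g_bound: "norm (g x) \<le> 2 ^ DIM('a) * h" for x
  proof (cases "x \<in> ?Q")
    case True
    have "\<tau> x \<noteq> m"
    proof
      assume "\<tau> x = m"
      then have "ennreal h < avg m nf x" using \<tau>_stop[of x] mK by (simp add: stop_def)
      then show False using avgQ wavg_cube[OF True, of "\<lambda>_. 1" nf] by simp
    qed
    then obtain i where i: "\<tau> x = Suc i" "m \<le> i" "i \<le> K"
      using \<tau>_bounds[of x] by (cases "\<tau> x") auto
    then have "avg i nf x \<le> ennreal h"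
      using \<tau>_least[of i x] by (auto simp: stop_def)
    then have h_int: "(LINT y:D i x|lebesgue. norm (f y)) \<le> h * vol i"
      using h vol_pos[of i] by (simp add: avg_nf pos_divide_le_eq)
    have "norm (LINT v:D (Suc i) x|lebesgue. f v) \<le> (LINT v:D (Suc i) x|lebesgue. norm (f v))"
      by (rule set_integral_norm_bound[OF fin_cube])
    also have "\<dots> \<le> (LINT v:D i x|lebesgue. norm (f v))"
    proof -
      have "(\<integral>\<^sup>+y. nf y * indicator (D (Suc i) x) y \<partial>lebesgue) \<le> (\<integral>\<^sup>+y. nf y * indicator (D i x) y \<partial>lebesgue)"
        using cube_Suc_subset[of i x] by (intro nn_integral_mono) (auto split: split_indicator)
      then show ?thesis
        unfolding nf_int by (subst (asm) ennreal_le_iff) (auto simp: set_lebesgue_integral_def intro!: integral_nonneg_AE AE_I2)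
    qed
    also have "\<dots> \<le> h * vol i" by (rule h_int)
    also have "vol i = 2 ^ DIM('a) * vol (Suc i)"
    proof -
      have "side i = 2 * side (Suc i)" using side_add[of i 1] by simp
      then show ?thesis unfolding vol_eq by (simp only: power_mult_distrib)
    qed
    finally show ?thesis
      using True vol_pos[of "Suc i"] by (simp add: g_def i norm_divide pos_divide_le_eq mult.commute mult.left_commute)
  qed (use h in \<open>simp add: g_def\<close>)
  have g_int: "integrable lebesgue g"
  proof -
    have "set_integrable lebesgue ?Q g"
      by (rule set_integrable_bounded_cube[of _ "2 ^ DIM('a) * h"]) (use g_bound in auto)
    then show ?thesis
      unfolding set_integrable_def
      by (rule Bochner_Integration.integrable_cong[THEN iffD1, rotated -1]) (auto simp: indicator_def g_def)
  qed
  \<comment> \<open>\<open>b j\<close> is the density whose averages over cubes of level \<open>j\<close> dominate the oscillation of \<open>f - g\<close>.\<close>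
  define b where "b j u = ennreal (2 * ?n * decay ^ (\<tau> u - j)) * indicator {u \<in> ?Q. j < \<tau> u} u * nf u" for j u
  have [measurable]: "b j \<in> borel_measurable lebesgue" for j
  proof -
    have [measurable]: "(\<lambda>u. ennreal (2 * ?n * decay ^ (\<tau> u - j)) * indicator {u \<in> ?Q. j < \<tau> u} u) \<in> borel_measurable lebesgue"
    proof (rule measurable_cubewise_constant[where k = "Suc K"])
      fix x y assume y: "y \<in> D (Suc K) x"
      show "ennreal (2 * ?n * decay ^ (\<tau> y - j)) * indicator {u \<in> ?Q. j < \<tau> u} y =
         ennreal (2 * ?n * decay ^ (\<tau> x - j)) * indicator {u \<in> ?Q. j < \<tau> u} x"
        using \<tau>_fine[OF y] in_Q_iff[OF y] mK by (auto simp: indicator_def)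
    qed
    show ?thesis unfolding b_def by measurable
  qed
  have key: "osc j f x \<le> osc j g x + avg j (b j) x" if x: "x \<in> ?G" and j: "m \<le> j" "j \<le> K" for j x
  proof -
    let ?R = "D j x"
    have xQ: "x \<in> ?Q" using x by simp
    have RQ: "?R \<subseteq> ?Q" by (rule in_Q[OF xQ j(1)])
    \<comment> \<open>Since \<open>x\<close> is good, no cube containing \<open>D j x\<close> stops.\<close>
    have \<tau>R: "j < \<tau> u" if u: "u \<in> ?R" for u
    proof (rule ccontr)
      assume "\<not> ?thesis"
      then have le: "\<tau> u \<le> j" by simp
      then have "ennreal h < avg (\<tau> u) nf u" using \<tau>_stop[of u] j by (auto simp: stop_def)
      also have "avg (\<tau> u) nf u = avg (\<tau> u) nf x"
        by (rule wavg_cube) (use cube_mono[OF le, of x] u in blast)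
      also have "\<dots> \<le> ennreal h" by (rule good[OF x])
      finally show False by simp
    qed
    define E where "E i = {u \<in> ?R. \<tau> u = i}" for i
    have E_sat: "D i u \<subseteq> E i" if u: "u \<in> E i" for i u
    proof
      fix v assume v: "v \<in> D i u"
      have "j \<le> i" using \<tau>R[of u] u by (auto simp: E_def)
      then have "v \<in> ?R" using cube_mono[of j i u] v u cube_eq[of u j x] by (auto simp: E_def)
      then show "v \<in> E i" using \<tau>_cube[OF v] u by (auto simp: E_def)
    qed
    have E_sets [measurable]: "E i \<in> sets lebesgue" for i by (rule sets_saturated[OF E_sat])
    have R_union: "?R = (\<Union>i\<in>{Suc j..Suc K}. E i)"
      using \<tau>R \<tau>_bounds by (auto simp: E_def Suc_le_eq)
    have "ennreal (norm (LINT y|lebesgue. f y * \<psi> y)) \<le>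
        ennreal (norm (LINT y|lebesgue. g y * \<psi> y)) + (\<integral>\<^sup>+y. b j y * indicator ?R y \<partial>lebesgue)"
      if \<psi>: "\<psi> \<in> bumps j ?R" for \<psi>
    proof -
      note [measurable] = bump_measurable[OF \<psi>]
      have mult_int: "integrable lebesgue (\<lambda>y. h y * \<psi> y)" if "integrable lebesgue h" for h :: "'a \<Rightarrow> complex"
        by (rule Bochner_Integration.integrable_bound[OF integrable_mult_left[of "of_real (DIM('a) + 1)", OF that]])
          (use that bump_bound[OF \<psi>] in \<open>auto simp: norm_mult add.commute simp del: of_real_add of_nat_add intro!: AE_I2 mult_left_mono\<close>)
      have X_int: "set_integrable lebesgue E' (\<lambda>y. (f y - g y) * \<psi> y)" if "E' \<in> sets lebesgue" for E'
        unfolding set_integrable_def using that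
        by (intro integrable_mult_indicator mult_int Bochner_Integration.integrable_diff f g_int)
      have "(LINT y|lebesgue. f y * \<psi> y) = (LINT y|lebesgue. g y * \<psi> y) + (LINT y|lebesgue. (f y - g y) * \<psi> y)"
        using mult_int[OF f] mult_int[OF g_int] by (simp add: left_diff_distrib)
      then have "norm (LINT y|lebesgue. f y * \<psi> y) \<le> norm (LINT y|lebesgue. g y * \<psi> y) + norm (LINT y|lebesgue. (f y - g y) * \<psi> y)"
        by (metis norm_triangle_ineq)
      then have 1: "ennreal (norm (LINT y|lebesgue. f y * \<psi> y)) \<le>
        ennreal (norm (LINT y|lebesgue. g y * \<psi> y)) + ennreal (norm (LINT y|lebesgue. (f y - g y) * \<psi> y))"
        by (simp flip: ennreal_plus add: ennreal_leI)
      have "(LINT y|lebesgue. (f y - g y) * \<psi> y) = (LINT y:?R|lebesgue. (f y - g y) * \<psi> y)"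
        by (simp add: bump_integral_cube[OF \<psi>])
      also have "\<dots> = (\<Sum>i\<in>{Suc j..Suc K}. LINT y:E i|lebesgue. (f y - g y) * \<psi> y)"
        unfolding R_union using X_int E_sets
        by (intro set_integral_finite_Union) (auto simp: disjoint_family_on_def E_def)
      finally have "ennreal (norm (LINT y|lebesgue. (f y - g y) * \<psi> y)) \<le>
         ennreal (\<Sum>i\<in>{Suc j..Suc K}. norm (LINT y:E i|lebesgue. (f y - g y) * \<psi> y))"
        by (intro ennreal_leI) (simp only: norm_sum)
      also have "\<dots> = (\<Sum>i\<in>{Suc j..Suc K}. ennreal (norm (LINT y:E i|lebesgue. (f y - g y) * \<psi> y)))"
        by (rule sum_ennreal[symmetric]) simp
      also have "\<dots> \<le> (\<Sum>i\<in>{Suc j..Suc K}. \<integral>\<^sup>+y. b j y * indicator (E i) y \<partial>lebesgue)"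
      proof (rule sum_mono, rule norm_set_integral_le_cubes)
        fix i u assume i: "i \<in> {Suc j..Suc K}" and u: "u \<in> E i"
        show "D i u \<subseteq> E i" by (rule E_sat[OF u])
        have \<tau>u: "\<tau> v = i" "g v = g u" if "v \<in> D i u" for v
          using \<tau>_cube[OF that] g_cube[OF that] u by (auto simp: E_def)
        have uQ: "u \<in> ?Q" using u RQ by (auto simp: E_def)
        have gu: "g u = (LINT v:D i u|lebesgue. f v) / of_real (vol i)"
          using uQ \<tau>u(1)[of u] by (simp add: g_def)
        have "(LINT y:D i u|lebesgue. (f y - g y) * \<psi> y) = (LINT y:D i u|lebesgue. (f y - g u) * \<psi> y)"
          by (rule set_lebesgue_integral_cong) (auto dest: \<tau>u(2))
        then have "ennreal (norm (LINT y:D i u|lebesgue. (f y - g y) * \<psi> y)) \<le>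
           ennreal (2 * ?n * decay ^ (i - j) * (LINT y:D i u|lebesgue. norm (f y)))"
          using stopped_bump_pairing[OF f \<psi>, of i u] i by (intro ennreal_leI) (simp add: gu)
        also have "\<dots> = ennreal (2 * ?n * decay ^ (i - j)) * (\<integral>\<^sup>+y. nf y * indicator (D i u) y \<partial>lebesgue)"
          unfolding nf_int using decay by (intro ennreal_mult) (auto simp: set_lebesgue_integral_def intro!: integral_nonneg_AE AE_I2)
        also have "\<dots> = (\<integral>\<^sup>+y. ennreal (2 * ?n * decay ^ (i - j)) * (nf y * indicator (D i u) y) \<partial>lebesgue)"
          by (rule nn_integral_cmult[symmetric]) measurable
        also have "\<dots> = (\<integral>\<^sup>+y. b j y * indicator (D i u) y \<partial>lebesgue)"
        proof (intro nn_integral_cong)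
          fix y
          have "y \<in> ?Q" if "y \<in> D i u" using in_Q[OF uQ, of i] i j that by auto
          then show "ennreal (2 * ?n * decay ^ (i - j)) * (nf y * indicator (D i u) y) = b j y * indicator (D i u) y"
            using \<tau>u(1)[of y] i by (auto simp: b_def indicator_def)
        qed
        finally show "ennreal (norm (LINT y:D i u|lebesgue. (f y - g y) * \<psi> y)) \<le> \<dots>" .
      qed (auto intro: X_int)
      also have "\<dots> = (\<integral>\<^sup>+y. (\<Sum>i\<in>{Suc j..Suc K}. b j y * indicator (E i) y) \<partial>lebesgue)"
        by (rule nn_integral_sum[symmetric]) measurable
      also have "\<dots> = (\<integral>\<^sup>+y. b j y * indicator ?R y \<partial>lebesgue)"
        unfolding R_union
        unfolding sum_distrib_left[symmetric]
        by (intro nn_integral_cong, subst indicator_UN_disjoint) (auto simp: disjoint_family_on_def E_def)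
      finally show ?thesis using 1 by (meson add_left_mono order_trans)
    qed
    then have "(SUP \<psi>\<in>bumps j ?R. ennreal (norm (LINT y|lebesgue. f y * \<psi> y))) \<le>
      (SUP \<psi>\<in>bumps j ?R. ennreal (norm (LINT y|lebesgue. g y * \<psi> y))) + (\<integral>\<^sup>+y. b j y * indicator ?R y \<partial>lebesgue)"
      by (intro SUP_least) (meson SUP_upper add_right_mono order_trans)
    from divide_right_mono_ennreal[OF this, of "ennreal (side j ^ DIM('a))"]
    show ?thesis unfolding osc_def osc_on_def avg_eq add_divide_distrib_ennreal .
  qed
  define Sg where "Sg x = (\<Sum>j = m..K. (osc j g x)\<^sup>2)" for x
  define Sb where "Sb x = (\<Sum>j = m..K. avg j (b j) x)" for x
  have [measurable]: "Sg \<in> borel_measurable lebesgue" "Sb \<in> borel_measurable lebesgue"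
    unfolding Sg_def Sb_def by measurable
  have sub: "?G \<subseteq> {x \<in> ?Q. 1 \<le> ennreal (4 / \<mu>\<^sup>2) * Sg x} \<union> {x \<in> ?Q. 1 \<le> ennreal (2 / \<mu>) * Sb x}"
  proof (rule subsetI, rule ccontr)
    fix x assume x: "x \<in> ?G" and "x \<notin> {x \<in> ?Q. 1 \<le> ennreal (4 / \<mu>\<^sup>2) * Sg x} \<union> {x \<in> ?Q. 1 \<le> ennreal (2 / \<mu>) * Sb x}"
    then have lt: "ennreal (4 / \<mu>\<^sup>2) * Sg x < 1" "ennreal (2 / \<mu>) * Sb x < 1" by auto
    have "ennreal (\<mu>\<^sup>2) < (\<Sum>j = m..K. (osc j f x)\<^sup>2)" using x by simp
    also have "\<dots> \<le> (\<Sum>j = m..K. 2 * (osc j g x)\<^sup>2 + 2 * (avg j (b j) x)\<^sup>2)"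
      by (intro sum_mono order_trans[OF power_mono_ennreal[OF key[OF x]] ennreal_power2_add_le]) auto
    also have "\<dots> = 2 * Sg x + 2 * (\<Sum>j = m..K. (avg j (b j) x)\<^sup>2)"
      by (simp add: Sg_def sum.distrib sum_distrib_left)
    also have "\<dots> \<le> 2 * Sg x + 2 * (Sb x)\<^sup>2"
      unfolding Sb_def by (intro add_left_mono mult_left_mono ennreal_sum_squares_le) auto
    finally have less: "ennreal (\<mu>\<^sup>2) < 2 * Sg x + 2 * (Sb x)\<^sup>2" .
    obtain s where s: "Sg x = ennreal s" "0 \<le> s"
      using lt(1) \<mu> by (cases "Sg x") (auto simp: ennreal_mult_top)
    obtain t where t: "Sb x = ennreal t" "0 \<le> t"
      using lt(2) \<mu> by (cases "Sb x") (auto simp: ennreal_mult_top)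
    have s4: "s < \<mu>\<^sup>2 / 4" using lt(1) s \<mu> by (simp add: field_simps flip: ennreal_mult)
    have t2: "t < \<mu> / 2" using lt(2) t \<mu> by (simp add: field_simps flip: ennreal_mult)
    have "t\<^sup>2 \<le> (\<mu> / 2)\<^sup>2" using t t2 by (intro power_mono) auto
    then have "2 * s + 2 * t\<^sup>2 < \<mu>\<^sup>2" using s4 by (simp add: power2_eq_square)
    moreover have "\<mu>\<^sup>2 < 2 * s + 2 * t\<^sup>2"
      using less s t by (simp add: numeral_mult_ennreal ennreal_power ennreal_less_iff flip: ennreal_plus)
    ultimately show False by simp
  qed
  have "emeasure lebesgue ?G \<le> emeasure lebesgue {x \<in> ?Q. 1 \<le> ennreal (4 / \<mu>\<^sup>2) * Sg x} +
      emeasure lebesgue {x \<in> ?Q. 1 \<le> ennreal (2 / \<mu>) * Sb x}"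
    by (rule order_trans[OF emeasure_mono[OF sub] emeasure_subadditive]) measurable
  also have "emeasure lebesgue {x \<in> ?Q. 1 \<le> ennreal (4 / \<mu>\<^sup>2) * Sg x} \<le>
      ennreal (4 / \<mu>\<^sup>2) * (\<integral>\<^sup>+x. Sg x * indicator ?Q x \<partial>lebesgue)"
    using nn_integral_Markov_inequality[of Sg ?Q lebesgue "ennreal (4 / \<mu>\<^sup>2)"] by simp
  also have "emeasure lebesgue {x \<in> ?Q. 1 \<le> ennreal (2 / \<mu>) * Sb x} \<le>
      ennreal (2 / \<mu>) * (\<integral>\<^sup>+x. Sb x * indicator ?Q x \<partial>lebesgue)"
    using nn_integral_Markov_inequality[of Sb ?Q lebesgue "ennreal (2 / \<mu>)"] by simp
  also have "(\<integral>\<^sup>+x. Sg x * indicator ?Q x \<partial>lebesgue) \<le> ennreal (4 * schur_const * ((2 ^ DIM('a) * h)\<^sup>2 * vol m))"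
  proof -
    have "(\<integral>\<^sup>+x. Sg x * indicator ?Q x \<partial>lebesgue) \<le> ennreal (4 * schur_const * (LINT x:?Q|lebesgue. (norm (g x))\<^sup>2))"
      unfolding Sg_def by (rule osc_square_integral[OF g_meas g_bound]) (simp add: g_def)
    also have "\<dots> \<le> ennreal (4 * schur_const * (LINT x:?Q|lebesgue. (2 ^ DIM('a) * h)\<^sup>2))"
      using schur_const_pos g_bound
      by (intro ennreal_leI mult_left_mono set_integral_mono set_integrable_bounded_cube[of _ "(2 ^ DIM('a) * h)\<^sup>2"])
        (auto intro!: power_mono)
    finally show ?thesis by (simp add: set_integral_const measure_cube emeasure_cube mult.commute)
  qed
  also have "(\<integral>\<^sup>+x. Sb x * indicator ?Q x \<partial>lebesgue) \<le> ennreal (2 * ?n * (2 / (1 - decay)) * (h * vol m))"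
  proof -
    have "(\<integral>\<^sup>+x. Sb x * indicator ?Q x \<partial>lebesgue) = (\<Sum>j = m..K. \<integral>\<^sup>+x. avg j (b j) x * indicator ?Q x \<partial>lebesgue)"
      unfolding Sb_def sum_distrib_right by (rule nn_integral_sum) measurable
    also have "\<dots> \<le> (\<Sum>j = m..K. \<integral>\<^sup>+x. b j x * indicator ?Q x \<partial>lebesgue)"
      by (intro sum_mono nn_integral_avg_cubes) auto
    also have "\<dots> = (\<integral>\<^sup>+x. (\<Sum>j = m..K. b j x * indicator ?Q x) \<partial>lebesgue)"
      by (rule nn_integral_sum[symmetric]) measurable
    also have "\<dots> \<le> (\<integral>\<^sup>+x. ennreal (2 * ?n * (2 / (1 - decay))) * (nf x * indicator ?Q x) \<partial>lebesgue)"
    proof (intro nn_integral_mono)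
      fix x
      have "(\<Sum>j = m..K. b j x * indicator ?Q x) \<le>
        (\<Sum>j = m..K. ennreal (2 * ?n * decay ^ (max (\<tau> x) j - min (\<tau> x) j)) * (nf x * indicator ?Q x))"
        by (intro sum_mono) (auto simp: b_def indicator_def max_def min_def)
      also have "\<dots> = ennreal (2 * ?n * (\<Sum>j = m..K. decay ^ (max (\<tau> x) j - min (\<tau> x) j))) * (nf x * indicator ?Q x)"
        using decay by (simp add: sum_distrib_right[symmetric] sum_distrib_left)
      also have "\<dots> \<le> ennreal (2 * ?n * (2 / (1 - decay))) * (nf x * indicator ?Q x)"
        using sum_decay_le[of "\<tau> x" m K] by (intro mult_right_mono ennreal_leI mult_left_mono) auto
      finally show "(\<Sum>j = m..K. b j x * indicator ?Q x) \<le> ennreal (2 * ?n * (2 / (1 - decay))) * (nf x * indicator ?Q x)" .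
    qed
    also have "\<dots> = ennreal (2 * ?n * (2 / (1 - decay))) * (\<integral>\<^sup>+x. nf x * indicator ?Q x \<partial>lebesgue)"
      by (rule nn_integral_cmult) measurable
    also have "\<dots> \<le> ennreal (2 * ?n * (2 / (1 - decay))) * ennreal (h * vol m)"
    proof (rule mult_left_mono)
      show "(\<integral>\<^sup>+x. nf x * indicator ?Q x \<partial>lebesgue) \<le> ennreal (h * vol m)"
        using avgQ h vol_pos[of m] unfolding nf_int avg_nf by (simp add: pos_divide_le_eq)
    qed simp
    also have "\<dots> = ennreal (2 * ?n * (2 / (1 - decay)) * (h * vol m))"
      using decay h vol_pos[of m] by (intro ennreal_mult[symmetric]) auto
    finally show ?thesis .
  qed
  finally have "emeasure lebesgue ?G \<le> ennreal (4 / \<mu>\<^sup>2) * ennreal (4 * schur_const * ((2 ^ DIM('a) * h)\<^sup>2 * vol m)) +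
      ennreal (2 / \<mu>) * ennreal (2 * ?n * (2 / (1 - decay)) * (h * vol m))"
    by (simp add: mult_left_mono add_mono)
  also have "\<dots> = ennreal (16 * schur_const * 4 ^ DIM('a) * (h\<^sup>2 / \<mu>\<^sup>2) * vol m + 8 * ?n / (1 - decay) * (h / \<mu>) * vol m)"
  proof -
    have p2: "(2 ^ DIM('a) * h)\<^sup>2 = 4 ^ DIM('a) * h\<^sup>2"
      by (simp add: power_mult_distrib) (simp add: power2_eq_square flip: power_mult_distrib)
    have e1: "4 / \<mu>\<^sup>2 * (4 * schur_const * ((2 ^ DIM('a) * h)\<^sup>2 * vol m)) = 16 * schur_const * 4 ^ DIM('a) * (h\<^sup>2 / \<mu>\<^sup>2) * vol m"
      unfolding p2 by simp
    have e2: "2 / \<mu> * (2 * ?n * (2 / (1 - decay)) * (h * vol m)) = 8 * ?n / (1 - decay) * (h / \<mu>) * vol m"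
      by (simp add: ac_simps)
    have nn: "0 \<le> 4 / \<mu>\<^sup>2" "0 \<le> 2 / \<mu>" "0 \<le> 4 * schur_const * ((2 ^ DIM('a) * h)\<^sup>2 * vol m)"
      "0 \<le> 2 * ?n * (2 / (1 - decay)) * (h * vol m)"
      using schur_const_pos decay h \<mu> vol_pos[of m] by auto
    show ?thesis
      unfolding e1[symmetric] e2[symmetric] using nn by (simp only: ennreal_mult ennreal_plus mult_nonneg_nonneg)
  qed
  also have "\<dots> \<le> ennreal (cz_const * (h\<^sup>2 / \<mu>\<^sup>2 + h / \<mu>) * vol m)"
  proof (rule ennreal_leI)
    have "16 * schur_const * 4 ^ DIM('a) \<le> cz_const" "8 * ?n / (1 - decay) \<le> cz_const"
      using schur_const_pos decay by (auto simp: cz_const_def)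
    then have "16 * schur_const * 4 ^ DIM('a) * (h\<^sup>2 / \<mu>\<^sup>2) * vol m + 8 * ?n / (1 - decay) * (h / \<mu>) * vol m \<le>
       cz_const * (h\<^sup>2 / \<mu>\<^sup>2) * vol m + cz_const * (h / \<mu>) * vol m"
      using h \<mu> vol_pos[of m] by (intro add_mono mult_right_mono) auto
    then show "16 * schur_const * 4 ^ DIM('a) * (h\<^sup>2 / \<mu>\<^sup>2) * vol m + 8 * ?n / (1 - decay) * (h / \<mu>) * vol m \<le>
       cz_const * (h\<^sup>2 / \<mu>\<^sup>2 + h / \<mu>) * vol m"
      by (simp add: distrib_left distrib_right)
  qed
  finally show ?thesis .
next
  case True
  show ?thesis unfolding True by simp
qed

definition square_sum :: "nat \<Rightarrow> ('a \<Rightarrow> complex) \<Rightarrow> 'a \<Rightarrow> ennreal" where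
  "square_sum K f x = (\<Sum>j\<le>K. (osc j f x)\<^sup>2)"

lemma measurable_square_sum [measurable]: "square_sum K f \<in> borel_measurable lebesgue"
  unfolding square_sum_def by measurable

end

section \<open>The good-lambda inequality\<close>

locale weighted_oscillation_grid = muckenhoupt_grid D L w q A + oscillation_grid D L \<gamma>
  for D :: "nat \<Rightarrow> 'a::euclidean_space \<Rightarrow> 'a set" and L and w :: "'a \<Rightarrow> real" and q A \<gamma> :: real
begin

definition "\<theta> = 1 - 1 / (A * 2 powr q)"

text \<open>
  If \<open>E\<close> fills at most half of a cube, then its complement fills at least half, and by
  Hoelder's inequality and the \<open>A\<^sub>q\<close> condition carries a fixed proportion of the
  weight.
\<close>

lemma half_cube_weight:
  assumes [measurable]: "E \<in> sets lebesgue" and sub: "E \<subseteq> D k x"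
    and half: "emeasure lebesgue E \<le> ennreal (vol k / 2)"
  shows "(\<integral>\<^sup>+y. W y * indicator E y \<partial>lebesgue) \<le> ennreal \<theta> * (\<integral>\<^sup>+y. W y * indicator (D k x) y \<partial>lebesgue)"
    and \<theta>_nonneg_aux: "0 \<le> \<theta>"
proof -
  let ?Q = "D k x" and ?E' = "D k x - E"
  obtain c where c: "(\<integral>\<^sup>+y. W y * indicator ?Q y \<partial>lebesgue) = ennreal c" "0 < c"
    using nn_integral_cube_pos[of W k x] w_cube[of k x] w_pos
    by (cases "(\<integral>\<^sup>+y. W y * indicator ?Q y \<partial>lebesgue)") auto
  obtain s where s: "(\<integral>\<^sup>+y. V y * indicator ?Q y \<partial>lebesgue) = ennreal s" "0 < s"
    using nn_integral_cube_pos[of V k x] dual_cube[of k x] w_pos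
    by (cases "(\<integral>\<^sup>+y. V y * indicator ?Q y \<partial>lebesgue)") (auto simp: less_le)
  have split: "(\<integral>\<^sup>+y. W y * indicator E y \<partial>lebesgue) + (\<integral>\<^sup>+y. W y * indicator ?E' y \<partial>lebesgue) = ennreal c"
    unfolding c(1)[symmetric] using sub
    by (subst nn_integral_add[symmetric]) (auto intro!: nn_integral_cong split: split_indicator)
  obtain a b where ab: "(\<integral>\<^sup>+y. W y * indicator E y \<partial>lebesgue) = ennreal a" "0 \<le> a"
      "(\<integral>\<^sup>+y. W y * indicator ?E' y \<partial>lebesgue) = ennreal b" "0 \<le> b" "a + b = c"
    using split c(2)
    by (cases "(\<integral>\<^sup>+y. W y * indicator E y \<partial>lebesgue)"; cases "(\<integral>\<^sup>+y. W y * indicator ?E' y \<partial>lebesgue)")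
      (auto simp flip: ennreal_plus)
  have large: "ennreal (vol k / 2) \<le> emeasure lebesgue ?E'"
  proof -
    have "ennreal (vol k) = emeasure lebesgue E + emeasure lebesgue ?E'"
      using sub by (subst plus_emeasure) (auto simp: emeasure_cube_vol Un_absorb1)
    also have "\<dots> \<le> ennreal (vol k / 2) + emeasure lebesgue ?E'"
      using half by (rule add_right_mono)
    finally have le: "ennreal (vol k) \<le> ennreal (vol k / 2) + emeasure lebesgue ?E'" .
    then show ?thesis
      using vol_pos[of k] by (cases "emeasure lebesgue ?E'") (auto simp flip: ennreal_plus)
  qed
  have "ennpow (ennreal (vol k / 2)) q \<le> ennpow (\<integral>\<^sup>+y. 1 * indicator ?E' y \<partial>lebesgue) q"
    using large q by (intro ennpow_mono) auto
  also have "\<dots> \<le> (\<integral>\<^sup>+y. ennpow 1 q * W y * indicator ?E' y \<partial>lebesgue) *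
      ennpow (\<integral>\<^sup>+y. V y * indicator ?E' y \<partial>lebesgue) (q - 1)"
    by (rule weighted_Hoelder[OF q w_pos]) auto
  also have "\<dots> \<le> ennreal b * ennpow (ennreal s) (q - 1)"
  proof (intro mult_mono ennpow_mono)
    show "(\<integral>\<^sup>+y. V y * indicator ?E' y \<partial>lebesgue) \<le> ennreal s"
      unfolding s(1)[symmetric] by (intro nn_integral_mono) (auto split: split_indicator)
  qed (use ab q in auto)
  finally have "(vol k / 2) powr q \<le> b * s powr (q - 1)"
    using vol_pos[of k] ab s(2) by (simp add: ennpow_ennreal flip: ennreal_mult)
  then have "vol k powr q \<le> 2 powr q * (b * s powr (q - 1))"
    by (simp add: powr_divide pos_divide_le_eq mult.commute)
  then have "A * vol k powr q \<le> A * (2 powr q * (b * s powr (q - 1)))"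
    using A_pos by (intro mult_left_mono) auto
  moreover have "c * s powr (q - 1) \<le> A * vol k powr q"
    using Aq[of k x] c(2) s(2) A_pos vol_pos[of k] unfolding c(1) s(1) vol_eq[symmetric]
    by (simp add: ennpow_ennreal flip: ennreal_mult)
  ultimately have "c * s powr (q - 1) \<le> A * 2 powr q * b * s powr (q - 1)"
    by (simp add: mult.assoc)
  then have "c \<le> A * 2 powr q * b" using s(2) by simp
  then have "c / (A * 2 powr q) \<le> b" using A_pos by (simp add: pos_divide_le_eq mult.commute)
  then have "a \<le> \<theta> * c" using ab(5) by (simp add: \<theta>_def left_diff_distrib)
  show "0 \<le> \<theta>"
  proof (rule ccontr)
    assume "\<not> 0 \<le> \<theta>"
    then have "\<theta> * c < 0" using c(2) by (simp add: mult_less_0_iff)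
    then show False using \<open>a \<le> \<theta> * c\<close> ab(2) by simp
  qed
  then show "(\<integral>\<^sup>+y. W y * indicator E y \<partial>lebesgue) \<le> ennreal \<theta> * (\<integral>\<^sup>+y. W y * indicator (D k x) y \<partial>lebesgue)"
    unfolding ab(1) c(1) using c(2) \<open>a \<le> \<theta> * c\<close> by (simp flip: ennreal_mult)
qed

lemma \<theta>_nonneg: "0 \<le> \<theta>"
  by (rule \<theta>_nonneg_aux[of "{}" 0 0]) auto

text \<open>
  Consider the maximal cubes on which the partial square sum exceeds \<open>t\<^sup>2\<close>. On
  such a cube, a value above \<open>(a * t)\<^sup>2\<close> of the full sum must come from finer
  levels, and the points where this happens while the maximal function is at most \<open>e *
  t\<close> fill at most half of the cube. The factor \<open>\<theta>\<close> may be close to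
  \<open>1\<close>; it is compensated by taking \<open>a\<close> close to \<open>1\<close> rather
  than \<open>2\<close>.
\<close>

lemma good_lambda:
  assumes f: "integrable lebesgue f" and a: "1 < a" and e: "0 < e" and t: "0 < t"
    and small: "cz_const * (e\<^sup>2 / (a\<^sup>2 - 1) + e / sqrt (a\<^sup>2 - 1)) \<le> 1 / 2"
  shows "(\<integral>\<^sup>+x. W x * indicator {x. ennreal ((a * t)\<^sup>2) < square_sum K f x \<and>
      maxf (\<lambda>y. ennreal (norm (f y))) x \<le> ennreal (e * t)} x \<partial>lebesgue)
    \<le> ennreal \<theta> * (\<integral>\<^sup>+x. W x * indicator {x. ennreal (t\<^sup>2) < square_sum K f x} x \<partial>lebesgue)"
proof -
  define nf where "nf y = ennreal (norm (f y))" for y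
  note [measurable] = borel_measurable_integrable[OF f]
  have [measurable]: "nf \<in> borel_measurable lebesgue" unfolding nf_def by measurable
  define B where "B = {x. ennreal ((a * t)\<^sup>2) < square_sum K f x \<and> maxf nf x \<le> ennreal (e * t)}"
  have B_sets [measurable]: "B \<in> sets lebesgue"
  proof -
    have "{x \<in> space lebesgue. ennreal ((a * t)\<^sup>2) < square_sum K f x \<and> maxf nf x \<le> ennreal (e * t)} \<in> sets lebesgue"
      by measurable
    then show ?thesis by (simp add: B_def)
  qed
  define P where "P k x \<longleftrightarrow> k \<le> K \<and> ennreal (t\<^sup>2) < (\<Sum>j\<le>k. (osc j f x)\<^sup>2)" for k x
  have a2: "1 < a\<^sup>2" using a by (simp add: one_less_power)
  \<comment> \<open>The levels below the stopping cube have to contribute \<open>(a * t)\<^sup>2 - t\<^sup>2\<close>.\<close>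
  define \<mu> where "\<mu> = sqrt (a\<^sup>2 - 1) * t"
  have \<mu>: "0 < \<mu>" "\<mu>\<^sup>2 = (a\<^sup>2 - 1) * t\<^sup>2"
    using a2 t by (auto simp: \<mu>_def power_mult_distrib)
  have ex: "{x. \<exists>k. P k x} = {x. ennreal (t\<^sup>2) < square_sum K f x}"
  proof (intro set_eqI iffI)
    fix x assume "x \<in> {x. \<exists>k. P k x}"
    then obtain k where k: "k \<le> K" "ennreal (t\<^sup>2) < (\<Sum>j\<le>k. (osc j f x)\<^sup>2)" by (auto simp: P_def)
    moreover have "(\<Sum>j\<le>k. (osc j f x)\<^sup>2) \<le> square_sum K f x"
      unfolding square_sum_def using k by (intro sum_mono2) auto
    ultimately show "x \<in> {x. ennreal (t\<^sup>2) < square_sum K f x}" by auto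
  qed (auto simp: P_def square_sum_def)
  have "(\<integral>\<^sup>+x. (W x * indicator B x) * indicator {x. \<exists>k. P k x} x \<partial>lebesgue) \<le>
    (\<integral>\<^sup>+x. (ennreal \<theta> * W x) * indicator {x. \<exists>k. P k x} x \<partial>lebesgue)"
  proof (rule stopping_cubes)
    fix k x y assume y: "y \<in> D k x"
    have "osc j f y = osc j f x" if "j \<le> k" for j
      by (rule osc_cube) (use cube_mono[OF that] y in blast)
    then show "P k y = P k x" by (simp add: P_def)
  next
    fix k x assume P: "P k x" and first: "\<And>j. j < k \<Longrightarrow> \<not> P j x"
    define E where "E = B \<inter> D k x"
    have [measurable]: "E \<in> sets lebesgue" unfolding E_def by measurable
    have low: "(\<Sum>j<k. (osc j f x)\<^sup>2) \<le> ennreal (t\<^sup>2)"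
    proof (cases k)
      case (Suc l)
      then show ?thesis using first[of l] P by (auto simp: P_def lessThan_Suc_atMost not_less)
    qed simp
    have kK: "k \<le> K" using P by (simp add: P_def)
    have "E \<subseteq> {x' \<in> D k x. ennreal (\<mu>\<^sup>2) < (\<Sum>j = k..K. (osc j f x')\<^sup>2) \<and> maxf nf x' \<le> ennreal (e * t)}"
    proof
      fix y assume y: "y \<in> E"
      have eq: "osc j f y = osc j f x" if "j < k" for j
        by (rule osc_cube) (use cube_mono[of j k x] that y in \<open>auto simp: E_def\<close>)
      have "{..K} = {..<k} \<union> {k..K}" using kK by auto
      then have "square_sum K f y = (\<Sum>j<k. (osc j f y)\<^sup>2) + (\<Sum>j = k..K. (osc j f y)\<^sup>2)"
        unfolding square_sum_def by (simp add: sum.union_disjoint ivl_disj_int)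
      also have "(\<Sum>j<k. (osc j f y)\<^sup>2) = (\<Sum>j<k. (osc j f x)\<^sup>2)" by (simp add: eq)
      also have "\<dots> + (\<Sum>j = k..K. (osc j f y)\<^sup>2) \<le> ennreal (t\<^sup>2) + (\<Sum>j = k..K. (osc j f y)\<^sup>2)"
        using low by (rule add_right_mono)
      finally have "ennreal ((a * t)\<^sup>2) < ennreal (t\<^sup>2) + (\<Sum>j = k..K. (osc j f y)\<^sup>2)"
        using y by (auto simp: E_def B_def)
      moreover have "(a * t)\<^sup>2 = t\<^sup>2 + \<mu>\<^sup>2" unfolding \<mu>(2) by (simp add: algebra_simps power_mult_distrib)
      ultimately have "ennreal (t\<^sup>2) + ennreal (\<mu>\<^sup>2) < ennreal (t\<^sup>2) + (\<Sum>j = k..K. (osc j f y)\<^sup>2)"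
        by simp
      then have "ennreal (\<mu>\<^sup>2) < (\<Sum>j = k..K. (osc j f y)\<^sup>2)"
        by (simp add: ennreal_add_left_cancel_less)
      then show "y \<in> {x' \<in> D k x. ennreal (\<mu>\<^sup>2) < (\<Sum>j = k..K. (osc j f x')\<^sup>2) \<and> maxf nf x' \<le> ennreal (e * t)}"
        using y by (auto simp: E_def B_def)
    qed
    then have "emeasure lebesgue E \<le> emeasure lebesgue {x' \<in> D k x. ennreal (\<mu>\<^sup>2) < (\<Sum>j = k..K. (osc j f x')\<^sup>2) \<and>
        maxf nf x' \<le> ennreal (e * t)}"
      by (intro emeasure_mono) measurable
    also have "\<dots> \<le> ennreal (cz_const * ((e * t)\<^sup>2 / \<mu>\<^sup>2 + (e * t) / \<mu>) * vol k)"
      unfolding nf_def[abs_def] using e t \<mu>(1) by (intro local_good_set f) auto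
    also have "\<dots> \<le> ennreal (vol k / 2)"
    proof (rule ennreal_leI)
      have "(e * t)\<^sup>2 / \<mu>\<^sup>2 = e\<^sup>2 / (a\<^sup>2 - 1)" "(e * t) / \<mu> = e / sqrt (a\<^sup>2 - 1)"
        using t a2 unfolding \<mu>(2) by (auto simp: \<mu>_def power_mult_distrib)
      then show "cz_const * ((e * t)\<^sup>2 / \<mu>\<^sup>2 + (e * t) / \<mu>) * vol k \<le> vol k / 2"
        using mult_right_mono[OF small, of "vol k"] vol_pos[of k] by simp
    qed
    finally have "(\<integral>\<^sup>+y. W y * indicator E y \<partial>lebesgue) \<le> ennreal \<theta> * (\<integral>\<^sup>+y. W y * indicator (D k x) y \<partial>lebesgue)"
      by (intro half_cube_weight) (auto simp: E_def)
    also have "\<dots> = (\<integral>\<^sup>+y. (ennreal \<theta> * W y) * indicator (D k x) y \<partial>lebesgue)"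
      by (subst nn_integral_cmult[symmetric]) (auto simp: mult.assoc)
    finally show "(\<integral>\<^sup>+y. (W y * indicator B y) * indicator (D k x) y \<partial>lebesgue) \<le> \<dots>"
      by (simp add: E_def mult.assoc flip: indicator_inter_arith)
  qed measurable
  also have "(\<integral>\<^sup>+x. (W x * indicator B x) * indicator {x. \<exists>k. P k x} x \<partial>lebesgue) = (\<integral>\<^sup>+x. W x * indicator B x \<partial>lebesgue)"
  proof (intro nn_integral_cong)
    fix x
    have "t\<^sup>2 \<le> (a * t)\<^sup>2" using a t by (intro power_mono) auto
    then have "x \<in> {x. \<exists>k. P k x}" if "x \<in> B"
      unfolding ex using that by (auto simp: B_def intro: le_less_trans[OF ennreal_leI])
    then show "(W x * indicator B x) * indicator {x. \<exists>k. P k x} x = W x * indicator B x"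
      by (auto split: split_indicator)
  qed
  also have "(\<integral>\<^sup>+x. (ennreal \<theta> * W x) * indicator {x. \<exists>k. P k x} x \<partial>lebesgue) =
      ennreal \<theta> * (\<integral>\<^sup>+x. W x * indicator {x. ennreal (t\<^sup>2) < square_sum K f x} x \<partial>lebesgue)"
    unfolding ex by (subst nn_integral_cmult[symmetric]) (auto simp: mult.assoc)
  finally show ?thesis unfolding B_def nf_def[abs_def] .
qed

text \<open>
  Finiteness is what allows the square sum to be absorbed in the good-lambda argument; this is why
  the sum is truncated at level \<open>K\<close> and \<open>f\<close> is supported in a region of
  finite weight.
\<close>

lemma square_sum_finite:
  assumes f: "integrable lebesgue f"
    and U: "U \<in> sets lebesgue" "(\<integral>\<^sup>+x. W x * indicator U x \<partial>lebesgue) < top"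
      "\<And>x y. x \<notin> U \<Longrightarrow> y \<in> D 0 x \<Longrightarrow> f y = 0" and r: "0 < r"
  shows "(\<integral>\<^sup>+x. ennpow (square_sum K f x) r * W x \<partial>lebesgue) < top"
proof -
  note [measurable] = borel_measurable_integrable[OF f] U(1)
  define I where "I = (\<integral>\<^sup>+y. ennreal (norm (f y)) \<partial>lebesgue)"
  have I: "I < top" using f by (auto simp: integrable_iff_bounded I_def)
  define c where "c = (\<Sum>j\<le>K. (ennreal (real DIM('a) + 1) * (I / ennreal (vol j)))\<^sup>2)"
  have c: "c < top"
  proof -
    have "I / ennreal (vol j) < top" for j
      using I vol_pos[of j] by (cases I) (auto simp: divide_ennreal)
    then show ?thesis by (auto simp: c_def power_less_top_ennreal ennreal_mult_less_top simp del: ennreal_plus)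
  qed
  have "ennpow (square_sum K f x) r \<le> ennpow c r * indicator U x" for x
  proof (cases "x \<in> U")
    case True
    have "osc j f x \<le> ennreal (real DIM('a) + 1) * (I / ennreal (vol j))" for j
      by (rule order_trans[OF osc_le_avg[OF f]], unfold avg_eq vol_eq[symmetric] I_def)
        (intro mult_left_mono divide_right_mono_ennreal nn_integral_mono, auto split: split_indicator)
    then have "square_sum K f x \<le> c"
      unfolding square_sum_def c_def by (intro sum_mono power_mono_ennreal)
    then show ?thesis using True r by (simp add: ennpow_mono)
  next
    case False
    have "osc j f x = 0" for j
    proof -
      have "(\<integral>\<^sup>+y. ennreal (norm (f y)) * indicator (D j x) y \<partial>lebesgue) = (\<integral>\<^sup>+(y::'a). 0 \<partial>lebesgue)"
        by (rule nn_integral_cong) (use U(3)[OF False] cube_mono[of 0 j x] in \<open>auto split: split_indicator\<close>)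
      then show ?thesis using osc_le_avg[OF f, of j x] by (simp add: avg_eq)
    qed
    then show ?thesis by (simp add: square_sum_def)
  qed
  then have "(\<integral>\<^sup>+x. ennpow (square_sum K f x) r * W x \<partial>lebesgue) \<le> (\<integral>\<^sup>+x. ennpow c r * (W x * indicator U x) \<partial>lebesgue)"
    by (intro nn_integral_mono) (metis (no_types, lifting) mult.assoc mult.commute mult_right_mono zero_le)
  also have "\<dots> = ennpow c r * (\<integral>\<^sup>+x. W x * indicator U x \<partial>lebesgue)"
    by (rule nn_integral_cmult) measurable
  also have "\<dots> < top" using c U(2) by (simp add: ennreal_mult_less_top)
  finally show ?thesis .
qed

text \<open>
  Integration of the good-lambda inequality, followed by Muckenhoupt's theorem. The constant depends
  neither on the grid nor on \<open>K\<close>.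
\<close>

lemma square_sum_bounded:
  assumes f: "integrable lebesgue f"
    and U: "U \<in> sets lebesgue" "(\<integral>\<^sup>+x. W x * indicator U x \<partial>lebesgue) < top"
      "\<And>x y. x \<notin> U \<Longrightarrow> y \<in> D 0 x \<Longrightarrow> f y = 0"
    and a: "1 < a" "\<theta> * a powr q < 1" and e: "0 < e"
    and small: "cz_const * (e\<^sup>2 / (a\<^sup>2 - 1) + e / sqrt (a\<^sup>2 - 1)) \<le> 1 / 2"
  shows "(\<integral>\<^sup>+x. ennpow (square_sum K f x) (q / 2) * W x \<partial>lebesgue) \<le>
    ennreal (e powr (- q) / (a powr (- q) - \<theta>) * max_const) * (\<integral>\<^sup>+x. ennpow (ennreal (norm (f x))) q * W x \<partial>lebesgue)"
proof -
  define nf where "nf y = ennreal (norm (f y))" for y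
  note [measurable] = borel_measurable_integrable[OF f]
  have [measurable]: "nf \<in> borel_measurable lebesgue" unfolding nf_def by measurable
  define F where "F x = ennpow (square_sum K f x) (1 / 2)" for x
  have [measurable]: "F \<in> borel_measurable lebesgue" unfolding F_def by measurable
  have F_less: "ennreal s < F x \<longleftrightarrow> ennreal (s\<^sup>2) < square_sum K f x" if "0 < s" for s x
  proof -
    have "F x \<le> ennreal s \<longleftrightarrow> square_sum K f x \<le> ennreal (s\<^sup>2)"
      unfolding F_def using that by (subst ennpow_le_iff) (auto simp: ennpow_ennreal)
    then show ?thesis by (simp add: not_le[symmetric])
  qed
  have powF: "ennpow (square_sum K f x) (q / 2) = ennpow (F x) q" for x
    by (simp add: F_def ennpow_ennpow)
  define X where "X = (\<integral>\<^sup>+x. ennpow (F x) q * W x \<partial>lebesgue)"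
  define Y where "Y = (\<integral>\<^sup>+x. ennpow (maxf nf x) q * W x \<partial>lebesgue)"
  have X_fin: "X < top"
    unfolding X_def powF[symmetric] using q by (intro square_sum_finite[OF f U]) auto
  have "(\<integral>\<^sup>+x. ennpow (ennreal (1 / a) * F x) q * W x \<partial>lebesgue) \<le>
    ennreal \<theta> * X + (\<integral>\<^sup>+x. ennpow (ennreal (1 / e) * maxf nf x) q * W x \<partial>lebesgue)"
    unfolding X_def
  proof (rule nn_integral_ennpow_mono_distribution)
    fix t :: real assume t: "0 < t"
    have less_scale: "ennreal t < ennreal (1 / c) * z \<longleftrightarrow> ennreal (c * t) < z" if "0 < c" for c z
      using that t by (cases z) (auto simp: ennreal_less_iff ennreal_mult_top field_simps simp flip: ennreal_mult)
    have "(\<integral>\<^sup>+x. W x * indicator {x. ennreal t < ennreal (1 / a) * F x} x \<partial>lebesgue) \<le>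
      (\<integral>\<^sup>+x. W x * indicator {x. ennreal ((a * t)\<^sup>2) < square_sum K f x \<and> maxf nf x \<le> ennreal (e * t)} x +
         W x * indicator {x. ennreal t < ennreal (1 / e) * maxf nf x} x \<partial>lebesgue)"
      using a e t by (intro nn_integral_mono) (auto split: split_indicator simp: less_scale F_less not_le)
    also have "\<dots> = (\<integral>\<^sup>+x. W x * indicator {x. ennreal ((a * t)\<^sup>2) < square_sum K f x \<and> maxf nf x \<le> ennreal (e * t)} x \<partial>lebesgue)
        + (\<integral>\<^sup>+x. W x * indicator {x. ennreal t < ennreal (1 / e) * maxf nf x} x \<partial>lebesgue)"
      by (rule nn_integral_add) measurable
    also have "(\<integral>\<^sup>+x. W x * indicator {x. ennreal ((a * t)\<^sup>2) < square_sum K f x \<and> maxf nf x \<le> ennreal (e * t)} x \<partial>lebesgue)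
      \<le> ennreal \<theta> * (\<integral>\<^sup>+x. W x * indicator {x. ennreal t < F x} x \<partial>lebesgue)"
      unfolding F_less[OF t] nf_def[abs_def] by (rule good_lambda[OF f a(1) e t small])
    finally show "(\<integral>\<^sup>+x. W x * indicator {x. ennreal t < ennreal (1 / a) * F x} x \<partial>lebesgue) \<le>
      ennreal \<theta> * (\<integral>\<^sup>+x. W x * indicator {x. ennreal t < F x} x \<partial>lebesgue) +
      (\<integral>\<^sup>+x. W x * indicator {x. ennreal t < ennreal (1 / e) * maxf nf x} x \<partial>lebesgue)"
      by (simp add: add_right_mono)
  qed (use q in auto)
  also have "(\<integral>\<^sup>+x. ennpow (ennreal (1 / a) * F x) q * W x \<partial>lebesgue) = ennreal (a powr (- q)) * X"
  proof -
    have "(1 / a) powr q = a powr (- q)" by (simp add: powr_minus_divide powr_divide)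
    then show ?thesis
      unfolding X_def using q a
      by (subst nn_integral_cmult[symmetric]) (auto simp: ennpow_mult ennpow_ennreal mult.assoc)
  qed
  also have "(\<integral>\<^sup>+x. ennpow (ennreal (1 / e) * maxf nf x) q * W x \<partial>lebesgue) = ennreal (e powr (- q)) * Y"
  proof -
    have "(1 / e) powr q = e powr (- q)" by (simp add: powr_minus_divide powr_divide)
    then show ?thesis
      unfolding Y_def using q e
      by (subst nn_integral_cmult[symmetric]) (auto simp: ennpow_mult ennpow_ennreal mult.assoc)
  qed
  finally have main: "ennreal (a powr (- q)) * X \<le> ennreal \<theta> * X + ennreal (e powr (- q)) * Y" .
  have gap: "0 < a powr (- q) - \<theta>"
  proof -
    have "\<theta> < a powr (- q)" using a by (simp add: powr_minus field_simps)
    then show ?thesis using \<theta>_nonneg by simp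
  qed
  have "X \<le> ennreal (e powr (- q) / (a powr (- q) - \<theta>)) * Y"
  proof (cases Y)
    case (real y)
    obtain x where x: "X = ennreal x" "0 \<le> x" using X_fin by (cases X) auto
    have "ennreal (a powr (- q) * x) \<le> ennreal (\<theta> * x + e powr (- q) * y)"
      using main x \<theta>_nonneg real by (simp add: ennreal_mult ennreal_plus)
    then have "a powr (- q) * x \<le> \<theta> * x + e powr (- q) * y"
      using x real \<theta>_nonneg by (subst (asm) ennreal_le_iff) auto
    then have "x \<le> e powr (- q) / (a powr (- q) - \<theta>) * y"
      using gap by (simp add: field_simps)
    then show ?thesis using x real gap by (simp flip: ennreal_mult)
  next
    case top
    have "ennreal (e powr (- q) / (a powr (- q) - \<theta>)) \<noteq> 0" using gap e by simp
    then show ?thesis by (metis top ennreal_top_mult_left top_greatest)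
  qed
  also have "\<dots> \<le> ennreal (e powr (- q) / (a powr (- q) - \<theta>)) * (ennreal max_const * (\<integral>\<^sup>+x. ennpow (nf x) q * W x \<partial>lebesgue))"
    unfolding Y_def by (intro mult_left_mono maxf_bounded) auto
  also have "\<dots> = ennreal (e powr (- q) / (a powr (- q) - \<theta>) * max_const) * (\<integral>\<^sup>+x. ennpow (nf x) q * W x \<partial>lebesgue)"
    using gap by (subst ennreal_mult') (auto simp: mult.assoc)
  finally show ?thesis unfolding X_def powF nf_def .
qed

end

section \<open>Adjacent dyadic grids\<close>

text \<open>
  Half-open cubes of side \<open>L / 2 ^ k\<close> with vertices shifted by \<open>s b\<close> times
  the side in direction \<open>b\<close>. The sign of the shift alternates with the level: for
  \<open>s b = 1 / 3\<close> this makes the grids of successive levels nested, because \<open>2 * (1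
  / 3)\<close> and \<open>- 1 / 3\<close> differ by an integer.
\<close>

definition grid_cube :: "real \<Rightarrow> ('a \<Rightarrow> real) \<Rightarrow> nat \<Rightarrow> 'a::euclidean_space \<Rightarrow> 'a set" where
  "grid_cube L s k x = {y. \<forall>b\<in>Basis. \<lfloor>(y \<bullet> b) * 2 ^ k / L - (-1) ^ k * s b\<rfloor> = \<lfloor>(x \<bullet> b) * 2 ^ k / L - (-1) ^ k * s b\<rfloor>}"

lemma floor_third_shift_nested:
  fixes X Y e s :: real
  assumes e: "e = 1 \<or> e = -1" and s: "s = 0 \<or> s = 1 / 3"
    and eq: "\<lfloor>2 * X + e * s\<rfloor> = \<lfloor>2 * Y + e * s\<rfloor>"
  shows "\<lfloor>X - e * s\<rfloor> = \<lfloor>Y - e * s\<rfloor>"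
proof -
  obtain m :: int where m: "3 * e * s = of_int m"
  proof -
    have "3 * e * s = of_int 0 \<or> 3 * e * s = of_int 1 \<or> 3 * e * s = of_int (-1)"
      using e s by auto
    then show ?thesis using that by blast
  qed
  have half: "\<lfloor>Z - e * s\<rfloor> = (\<lfloor>2 * Z + e * s\<rfloor> - m) div 2" for Z
  proof -
    have "Z - e * s = (2 * Z + e * s - of_int m) / of_int 2"
      unfolding m[symmetric] by simp
    then have "\<lfloor>Z - e * s\<rfloor> = \<lfloor>2 * Z + e * s - of_int m\<rfloor> div 2"
      by (simp only: floor_divide_real_eq_div)
    then show ?thesis by (simp only: floor_diff_of_int)
  qed
  show ?thesis unfolding half eq ..
qed

text \<open>
  Points of the two lattices, one shifted by a third, are at least \<open>1 / 3\<close> apart, so a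
  short interval misses one of them.
\<close>

lemma third_shift_covers:
  fixes X \<rho> e :: real
  assumes \<rho>: "\<rho> \<le> 1 / 6" and e: "e = 1 \<or> e = -1"
  shows "\<exists>s\<in>{0, 1 / 3}. \<forall>y. \<bar>y - X\<bar> < \<rho> \<longrightarrow> \<lfloor>y - e * s\<rfloor> = \<lfloor>X - e * s\<rfloor>"
proof (rule ccontr)
  assume neg: "\<not> ?thesis"
  have near: "\<exists>m::int. \<bar>X - e * s - of_int m\<bar> < \<rho>" if s: "s \<in> {0, 1 / 3}" for s
  proof -
    obtain y where y: "\<bar>y - X\<bar> < \<rho>" "\<lfloor>y - e * s\<rfloor> \<noteq> \<lfloor>X - e * s\<rfloor>"
      using neg s by blast
    show ?thesis
    proof (cases "\<lfloor>y - e * s\<rfloor> < \<lfloor>X - e * s\<rfloor>")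
      case True
      then have "y - e * s < of_int \<lfloor>X - e * s\<rfloor>" by (simp add: floor_less_iff)
      then show ?thesis using y by (intro exI[of _ "\<lfloor>X - e * s\<rfloor>"]) linarith
    next
      case False
      then have "X - e * s < of_int \<lfloor>y - e * s\<rfloor>" using y by (simp add: floor_less_iff[symmetric])
      then show ?thesis using y by (intro exI[of _ "\<lfloor>y - e * s\<rfloor>"]) linarith
    qed
  qed
  obtain m n :: int where "\<bar>X - of_int m\<bar> < \<rho>" "\<bar>X - e * (1 / 3) - of_int n\<bar> < \<rho>"
    using near[of 0] near[of "1 / 3"] by auto
  then have close: "\<bar>of_int m - of_int n - e / 3\<bar> < 1 / 3" using \<rho> by linarith
  have "\<bar>of_int (3 * (m - n) - 1) :: real\<bar> < 1 \<or> \<bar>of_int (3 * (m - n) + 1) :: real\<bar> < 1"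
    using e
  proof
    assume "e = 1"
    then have "\<bar>of_int (3 * (m - n) - 1) :: real\<bar> < 1" using close unfolding abs_less_iff by simp
    then show ?thesis ..
  next
    assume "e = -1"
    then have "\<bar>of_int (3 * (m - n) + 1) :: real\<bar> < 1" using close unfolding abs_less_iff by simp
    then show ?thesis ..
  qed
  then have "\<bar>3 * (m - n) - 1\<bar> < 1 \<or> \<bar>3 * (m - n) + 1\<bar> < 1"
    by linarith
  then show False by presburger
qed

definition grid_shifts :: "('a::euclidean_space \<Rightarrow> real) set" where
  "grid_shifts = Basis \<rightarrow>\<^sub>E {0, 1 / 3}"

lemma finite_grid_shifts: "finite grid_shifts"
  unfolding grid_shifts_def by (intro finite_PiE) auto

text \<open>
  The shift is chosen separately in each coordinate.
\<close>

lemma ball_subset_grid_cube: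
  fixes x :: "'a::euclidean_space"
  assumes L: "0 < L" and r: "6 * r \<le> L / 2 ^ k"
  shows "\<exists>s\<in>grid_shifts. ball x r \<subseteq> grid_cube L s k x"
proof -
  let ?c = "2 ^ k / L"
  have "\<forall>b\<in>Basis. \<exists>s\<in>{0, 1 / 3}. \<forall>y. \<bar>y - (x \<bullet> b) * ?c\<bar> < r * ?c \<longrightarrow>
      \<lfloor>y - (-1) ^ k * s\<rfloor> = \<lfloor>(x \<bullet> b) * ?c - (-1) ^ k * s\<rfloor>"
  proof
    fix b :: 'a
    have "r * ?c \<le> 1 / 6" using L r by (simp add: field_simps)
    moreover have "(-1) ^ k = (1::real) \<or> (-1) ^ k = (-1::real)" by (cases "even k") auto
    ultimately show "\<exists>s\<in>{0, 1 / 3}. \<forall>y. \<bar>y - (x \<bullet> b) * ?c\<bar> < r * ?c \<longrightarrow>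
      \<lfloor>y - (-1) ^ k * s\<rfloor> = \<lfloor>(x \<bullet> b) * ?c - (-1) ^ k * s\<rfloor>"
      by (rule third_shift_covers)
  qed
  from bchoice[OF this[unfolded Bex_def]] obtain s where s: "\<And>b. b \<in> Basis \<Longrightarrow> s b \<in> {0, 1 / 3}"
    "\<And>b y. b \<in> Basis \<Longrightarrow> \<bar>y - (x \<bullet> b) * ?c\<bar> < r * ?c \<Longrightarrow>
      \<lfloor>y - (-1) ^ k * s b\<rfloor> = \<lfloor>(x \<bullet> b) * ?c - (-1) ^ k * s b\<rfloor>"
    by blast
  show ?thesis
  proof (rule bexI[of _ "restrict s Basis"])
    show "restrict s Basis \<in> grid_shifts" using s(1) by (auto simp: grid_shifts_def)
    show "ball x r \<subseteq> grid_cube L (restrict s Basis) k x"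
    proof
      fix y assume "y \<in> ball x r"
      then have n: "norm (y - x) < r" by (simp add: dist_norm norm_minus_commute)
      have "\<lfloor>(y \<bullet> b) * ?c - (-1) ^ k * s b\<rfloor> = \<lfloor>(x \<bullet> b) * ?c - (-1) ^ k * s b\<rfloor>" if b: "b \<in> Basis" for b
      proof (rule s(2)[OF b])
        have "\<bar>(y \<bullet> b) * ?c - (x \<bullet> b) * ?c\<bar> = \<bar>(y - x) \<bullet> b\<bar> * ?c"
          using L by (simp add: abs_mult inner_diff_left flip: left_diff_distrib diff_divide_distrib)
        also have "\<dots> < r * ?c"
          using Basis_le_norm[OF b, of "y - x"] n L by (intro mult_strict_right_mono) auto
        finally show "\<bar>(y \<bullet> b) * ?c - (x \<bullet> b) * ?c\<bar> < r * ?c" .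
      qed
      then show "y \<in> grid_cube L (restrict s Basis) k x" by (simp add: grid_cube_def)
    qed
  qed
qed

lemma dyadic_grid_grid_cube:
  fixes s :: "'a::euclidean_space \<Rightarrow> real"
  assumes L: "0 < L" and s: "s \<in> grid_shifts"
  shows "dyadic_grid (grid_cube L s) L"
proof
  show "0 < L" by fact
  fix x :: 'a and k
  let ?D = "grid_cube L s"
  show "x \<in> ?D k x" by (simp add: grid_cube_def)
  show "?D k y = ?D k x" if "y \<in> ?D k x" for y
    using that by (auto simp: grid_cube_def)
  show "?D (Suc k) x \<subseteq> ?D k x"
  proof
    fix y assume y: "y \<in> ?D (Suc k) x"
    have "\<lfloor>(y \<bullet> b) * 2 ^ k / L - (-1) ^ k * s b\<rfloor> = \<lfloor>(x \<bullet> b) * 2 ^ k / L - (-1) ^ k * s b\<rfloor>" if b: "b \<in> Basis" for b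
    proof (rule floor_third_shift_nested)
      show "(-1) ^ k = (1::real) \<or> (-1) ^ k = (-1::real)" by (cases "even k") auto
      show "s b = 0 \<or> s b = 1 / 3" using s b by (auto simp: grid_shifts_def)
      show "\<lfloor>2 * ((y \<bullet> b) * 2 ^ k / L) + (-1) ^ k * s b\<rfloor> = \<lfloor>2 * ((x \<bullet> b) * 2 ^ k / L) + (-1) ^ k * s b\<rfloor>"
        using y b by (simp add: grid_cube_def mult.left_commute)
    qed
    then show "y \<in> ?D k x" by (simp add: grid_cube_def)
  qed
  define l where "l = L / 2 ^ k"
  have l: "0 < l" using L by (simp add: l_def)
  define lo where "lo b = l * (of_int \<lfloor>(x \<bullet> b) * 2 ^ k / L - (-1) ^ k * s b\<rfloor> + (-1) ^ k * s b)" for b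
  have D_iff: "y \<in> ?D k x \<longleftrightarrow> (\<forall>b\<in>Basis. lo b \<le> y \<bullet> b \<and> y \<bullet> b < lo b + l)" for y
  proof -
    have "\<lfloor>(y \<bullet> b) * 2 ^ k / L - (-1) ^ k * s b\<rfloor> = m \<longleftrightarrow>
      l * (of_int m + (-1) ^ k * s b) \<le> y \<bullet> b \<and> y \<bullet> b < l * (of_int m + (-1) ^ k * s b) + l" for m b
    proof -
      have "(y \<bullet> b) * 2 ^ k / L = (y \<bullet> b) / l" by (simp add: l_def)
      then have "\<lfloor>(y \<bullet> b) * 2 ^ k / L - (-1) ^ k * s b\<rfloor> = m \<longleftrightarrow>
        of_int m + (-1) ^ k * s b \<le> (y \<bullet> b) / l \<and> (y \<bullet> b) / l < of_int m + (-1) ^ k * s b + 1"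
        by (simp only: floor_eq_iff) linarith
      then show ?thesis
        using l by (simp add: pos_le_divide_eq pos_divide_less_eq distrib_left distrib_right mult.commute)
    qed
    then show ?thesis unfolding grid_cube_def lo_def by blast
  qed
  have D_eq: "?D k x = (\<Inter>b\<in>Basis. {y. lo b \<le> y \<bullet> b} \<inter> {y. y \<bullet> b < lo b + l})"
    using D_iff by auto
  show D_borel: "?D k x \<in> sets borel"
    unfolding D_eq by (intro sets.finite_INT sets.Int) (auto simp: closed_halfspace_component_ge open_halfspace_component_lt)
  define a where "a = (\<Sum>b\<in>Basis. lo b *\<^sub>R b)"
  define c where "c = (\<Sum>b\<in>Basis. (lo b + l) *\<^sub>R b)"
  have ac: "a \<bullet> b = lo b" "c \<bullet> b = lo b + l" if "b \<in> Basis" for b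
    using that by (simp_all add: a_def c_def)
  have vol: "(\<Prod>b\<in>Basis. (c - a) \<bullet> b) = l ^ DIM('a)"
    by (simp add: inner_diff_left ac)
  show "emeasure lborel (?D k x) = ennreal ((L / 2 ^ k) ^ DIM('a))"
  proof (rule antisym)
    have "?D k x \<subseteq> cbox a c" by (auto simp: D_iff mem_box ac less_imp_le)
    then have "emeasure lborel (?D k x) \<le> emeasure lborel (cbox a c)" by (intro emeasure_mono) auto
    also have "\<dots> = ennreal (l ^ DIM('a))"
      using l by (subst emeasure_lborel_cbox) (auto simp: ac vol)
    finally show "emeasure lborel (?D k x) \<le> ennreal ((L / 2 ^ k) ^ DIM('a))" by (simp add: l_def)
    have "box a c \<subseteq> ?D k x" by (auto simp: D_iff mem_box ac less_imp_le)
    then have "emeasure lborel (box a c) \<le> emeasure lborel (?D k x)" using D_borel by (intro emeasure_mono) auto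
    moreover have "emeasure lborel (box a c) = ennreal (l ^ DIM('a))"
      using l by (subst emeasure_lborel_box) (auto simp: ac vol)
    ultimately show "ennreal ((L / 2 ^ k) ^ DIM('a)) \<le> emeasure lborel (?D k x)" by (simp add: l_def)
  qed
  show "norm (y - x) \<le> DIM('a) * (L / 2 ^ k)" if y: "y \<in> ?D k x" for y
  proof -
    have "x \<in> ?D k x" by (simp add: grid_cube_def)
    then have "\<bar>(y - x) \<bullet> b\<bar> \<le> l" if "b \<in> Basis" for b
      using y that unfolding D_iff inner_diff_left by fastforce
    then have "(\<Sum>b\<in>Basis. \<bar>(y - x) \<bullet> b\<bar>) \<le> (\<Sum>b\<in>(Basis::'a set). l)" by (intro sum_mono) auto
    then show ?thesis using norm_le_l1[of "y - x"] by (simp add: l_def)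
  qed
  show "countable (range (?D k))"
  proof (rule countable_subset)
    let ?F = "\<lambda>m. {y::'a. \<forall>b\<in>Basis. \<lfloor>(y \<bullet> b) * 2 ^ k / L - (-1) ^ k * s b\<rfloor> = m b}"
    show "range (?D k) \<subseteq> ?F ` (Basis \<rightarrow>\<^sub>E (UNIV :: int set))"
    proof
      fix Q assume "Q \<in> range (?D k)"
      then obtain x where "Q = ?D k x" by auto
      then have Q: "Q = ?F (restrict (\<lambda>b. \<lfloor>(x \<bullet> b) * 2 ^ k / L - (-1) ^ k * s b\<rfloor>) Basis)"
        by (simp add: grid_cube_def)
      show "Q \<in> ?F ` (Basis \<rightarrow>\<^sub>E (UNIV :: int set))" unfolding Q by (rule imageI) auto
    qed
    show "countable (?F ` (Basis \<rightarrow>\<^sub>E (UNIV :: int set)))"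
      by (intro countable_image countable_PiE) auto
  qed
qed

section \<open>Test functions and measurability of the square function\<close>

lemma test_function_outside:
  assumes "\<phi> \<in> test_class \<gamma>" "1 < norm x"
  shows "\<phi> x = 0"
proof (rule ccontr)
  assume "\<phi> x \<noteq> 0"
  then have "x \<in> closure {x. \<phi> x \<noteq> 0}" using closure_subset[of "{x. \<phi> x \<noteq> 0}"] by auto
  then have "x \<in> cball 0 1" using assms(1) by (auto simp: test_class_def)
  then show False using assms(2) by simp
qed

lemma test_function_outside_dilate:
  assumes "\<phi> \<in> test_class \<gamma>" "0 < t" "t < norm (z - u)"
  shows "\<phi> ((1 / t) *\<^sub>R (z - u)) = 0"
proof (rule test_function_outside[OF assms(1)])
  show "1 < norm ((1 / t) *\<^sub>R (z - u))"
    unfolding norm_scaleR using assms by simp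
qed

lemma test_function_Hoelder: "\<phi> \<in> test_class \<gamma> \<Longrightarrow> norm (\<phi> x - \<phi> y) \<le> norm (x - y) powr \<gamma>"
  by (simp add: test_class_def)

lemma test_function_bound:
  fixes \<phi> :: "'a::euclidean_space \<Rightarrow> complex"
  assumes \<phi>: "\<phi> \<in> test_class \<gamma>" and \<gamma>: "0 < \<gamma>" "\<gamma> \<le> 1"
  shows "norm (\<phi> x) \<le> 3"
proof (cases "norm x \<le> 1")
  case False
  then show ?thesis using test_function_outside[OF \<phi>, of x] by simp
next
  case True
  obtain b :: 'a where b: "b \<in> Basis" using nonempty_Basis by blast
  have "norm (3 *\<^sub>R b) \<le> norm (x + 3 *\<^sub>R b) + norm x"
    using norm_triangle_ineq4[of "x + 3 *\<^sub>R b" x] by simp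
  then have "1 < norm (x + 3 *\<^sub>R b)" using True b by simp
  then have "norm (\<phi> x) \<le> norm (x - (x + 3 *\<^sub>R b)) powr \<gamma>"
    using test_function_outside[OF \<phi>] test_function_Hoelder[OF \<phi>, of x "x + 3 *\<^sub>R b"] by simp
  also have "\<dots> = 3 powr \<gamma>" using b by simp
  also have "\<dots> \<le> 3 powr 1" using \<gamma> by (intro powr_mono) auto
  finally show ?thesis by simp
qed

lemma test_function_continuous:
  assumes "\<phi> \<in> test_class \<gamma>" "0 < \<gamma>"
  shows "continuous_on UNIV \<phi>"
  using test_function_Hoelder[OF assms(1)] by (intro Hoelder_continuous[OF assms(2), of 1]) auto

lemma reflected_dilation_integral:
  fixes \<phi> :: "'a::euclidean_space \<Rightarrow> complex"
  assumes \<phi>: "\<phi> \<in> test_class \<gamma>" and \<gamma>: "0 < \<gamma>" and t: "0 < t"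
  shows "(LINT u|lebesgue. \<phi> ((1 / t) *\<^sub>R (z - u))) = 0"
proof -
  have [measurable]: "\<phi> \<in> borel_measurable borel"
    using test_function_continuous[OF \<phi> \<gamma>] by (rule borel_measurable_continuous_onI)
  have "lborel = density (distr lborel borel (\<lambda>x. (1 / t) *\<^sub>R z + (- 1 / t) *\<^sub>R x)) (\<lambda>_::'a. ennreal (\<bar>- 1 / t\<bar> ^ DIM('a)))"
    using t by (subst lborel_affine[of "- 1 / t" "(1 / t) *\<^sub>R z"]) auto
  then have "(LINT u|lborel. \<phi> u) = (LINT u|density (distr lborel borel (\<lambda>x. (1 / t) *\<^sub>R z + (- 1 / t) *\<^sub>R x)) (\<lambda>_::'a. ennreal (\<bar>- 1 / t\<bar> ^ DIM('a))). \<phi> u)"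
    by simp
  also have "\<dots> = (LINT u|lborel. (\<bar>- 1 / t\<bar> ^ DIM('a)) *\<^sub>R \<phi> ((1 / t) *\<^sub>R z + (- 1 / t) *\<^sub>R u))"
    by (subst integral_density) (auto simp: integral_distr)
  also have "\<dots> = (1 / t ^ DIM('a)) *\<^sub>R (LINT u|lborel. \<phi> ((1 / t) *\<^sub>R (z - u)))"
    using t by (simp add: scaleR_diff_right power_divide)
  finally have "(1 / t ^ DIM('a)) *\<^sub>R (LINT u|lborel. \<phi> ((1 / t) *\<^sub>R (z - u))) = (LINT u|lborel. \<phi> u)" by simp
  also have "\<dots> = (LINT u|lebesgue. \<phi> u)"
    by (rule integral_completion[symmetric]) simp
  also have "\<dots> = 0" using \<phi> by (simp add: test_class_def)
  finally have "(LINT u|lborel. \<phi> ((1 / t) *\<^sub>R (z - u))) = 0" using t by simp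
  then show ?thesis by (subst integral_completion) auto
qed

lemma convol_dilate_eq:
  fixes f :: "'a::euclidean_space \<Rightarrow> complex"
  shows "convol f (dilate t \<phi>) z = of_real (1 / t ^ DIM('a)) * (LINT u|lebesgue. f u * \<phi> ((1 / t) *\<^sub>R (z - u)))"
proof -
  have "convol f (dilate t \<phi>) z = (LINT u|lebesgue. of_real (1 / t ^ DIM('a)) * (f u * \<phi> ((1 / t) *\<^sub>R (z - u))))"
    unfolding convol_def dilate_def by (intro Bochner_Integration.integral_cong) (auto simp: mult.left_commute)
  then show ?thesis by (simp only: integral_mult_right_zero)
qed

definition intrinsic_sup :: "real \<Rightarrow> ('a::euclidean_space \<Rightarrow> complex) \<Rightarrow> real \<Rightarrow> 'a \<Rightarrow> ennreal" where
  "intrinsic_sup \<gamma> f t z = (SUP \<phi>\<in>test_class \<gamma>. ennreal (norm (convol f (dilate t \<phi>) z)))"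

text \<open>
  Up to the factor \<open>24\<close>, a test function dilated to height \<open>t\<close> and
  reflected about \<open>z\<close> is a bump for any cube that contains its support and whose side
  is at most \<open>24 * t\<close>.
\<close>

lemma (in oscillation_grid) intrinsic_sup_le_osc:
  assumes f: "f \<in> borel_measurable lebesgue" and t: "0 < t" "side k \<le> 24 * t"
    and sub: "cball z t \<subseteq> D k x" and eq: "\<And>u. u \<in> D k x \<Longrightarrow> f' u = f u"
  shows "intrinsic_sup \<gamma> f t z \<le> ennreal (24 ^ Suc DIM('a)) * osc k f' x"
  unfolding intrinsic_sup_def
proof (rule SUP_least)
  fix \<phi> :: "'a \<Rightarrow> complex" assume \<phi>: "\<phi> \<in> test_class \<gamma>"
  define \<psi> where "\<psi> u = \<phi> ((1 / t) *\<^sub>R (z - u)) / 24" for u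
  have supp: "\<phi> ((1 / t) *\<^sub>R (z - u)) = 0" if "u \<notin> D k x" for u
  proof (rule test_function_outside_dilate[OF \<phi> t(1)])
    show "t < norm (z - u)" using sub that by (auto simp: dist_norm not_le[symmetric])
  qed
  have \<psi>: "\<psi> \<in> bumps k (D k x)"
    unfolding bumps_def
  proof (intro CollectI conjI allI impI)
    show "\<psi> u = 0" if "u \<notin> D k x" for u using supp[OF that] by (simp add: \<psi>_def)
    show "(LINT x|lebesgue. \<psi> x) = 0"
      using reflected_dilation_integral[OF \<phi> \<gamma>(1) t(1), of z] by (simp add: \<psi>_def)
    fix u v
    have "norm (\<phi> ((1 / t) *\<^sub>R (z - u)) - \<phi> ((1 / t) *\<^sub>R (z - v))) \<le> norm ((1 / t) *\<^sub>R (z - u) - (1 / t) *\<^sub>R (z - v)) powr \<gamma>"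
      by (rule test_function_Hoelder[OF \<phi>])
    also have "norm ((1 / t) *\<^sub>R (z - u) - (1 / t) *\<^sub>R (z - v)) = norm (u - v) / t"
      using t by (simp add: norm_minus_commute flip: scaleR_diff_right)
    also have "(norm (u - v) / t) powr \<gamma> \<le> (24 * (norm (u - v) / side k)) powr \<gamma>"
    proof (rule powr_mono2)
      have "norm (u - v) / t \<le> norm (u - v) / (side k / 24)"
        using t side_pos[of k] by (intro divide_left_mono) auto
      then show "norm (u - v) / t \<le> 24 * (norm (u - v) / side k)" by (simp add: mult.commute)
    qed (use \<gamma> t in auto)
    also have "\<dots> = 24 powr \<gamma> * (norm (u - v) / side k) powr \<gamma>" by (rule powr_mult)
    also have "\<dots> \<le> 24 powr 1 * (norm (u - v) / side k) powr \<gamma>"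
      using \<gamma> by (intro mult_right_mono powr_mono) auto
    finally show "norm (\<psi> u - \<psi> v) \<le> (norm (u - v) / side k) powr \<gamma>"
      by (simp add: \<psi>_def norm_divide flip: diff_divide_distrib)
  qed
  have "(LINT u|lebesgue. f u * \<phi> ((1 / t) *\<^sub>R (z - u))) = (LINT u|lebesgue. 24 * (f' u * \<psi> u))"
    using supp eq by (intro Bochner_Integration.integral_cong refl) (auto simp: \<psi>_def, metis)
  also have "\<dots> = 24 * (LINT u|lebesgue. f' u * \<psi> u)" by simp
  finally have "norm (convol f (dilate t \<phi>) z) = 24 / t ^ DIM('a) * norm (LINT u|lebesgue. f' u * \<psi> u)"
    using t by (simp add: convol_dilate_eq norm_mult norm_divide norm_power)
  also have "\<dots> \<le> 24 ^ Suc DIM('a) / side k ^ DIM('a) * norm (LINT u|lebesgue. f' u * \<psi> u)"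
  proof (rule mult_right_mono)
    have "side k ^ DIM('a) \<le> (24 * t) ^ DIM('a)" using t side_pos[of k] by (intro power_mono) auto
    then show "24 / t ^ DIM('a) \<le> 24 ^ Suc DIM('a) / side k ^ DIM('a)"
      using t side_pos[of k] by (simp add: power_mult_distrib field_simps)
  qed simp
  finally have "ennreal (norm (convol f (dilate t \<phi>) z)) \<le> ennreal (24 ^ Suc DIM('a) * (norm (LINT u|lebesgue. f' u * \<psi> u) / side k ^ DIM('a)))"
    by (intro ennreal_leI) simp
  also have "\<dots> = ennreal (24 ^ Suc DIM('a)) * (ennreal (norm (LINT u|lebesgue. f' u * \<psi> u)) / ennreal (side k ^ DIM('a)))"
    using side_pos[of k] by (subst ennreal_mult) (auto simp: divide_ennreal)
  also have "\<dots> \<le> ennreal (24 ^ Suc DIM('a)) * osc k f' x"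
    unfolding osc_def osc_on_def using \<psi> by (intro mult_left_mono divide_right_mono_ennreal SUP_upper) auto
  finally show "ennreal (norm (convol f (dilate t \<phi>) z)) \<le> ennreal (24 ^ Suc DIM('a)) * osc k f' x" .
qed

text \<open>
  At large heights only the size of the kernels is used.
\<close>

lemma intrinsic_sup_le_average:
  fixes f :: "'a::euclidean_space \<Rightarrow> complex"
  assumes \<gamma>: "0 < \<gamma>" "\<gamma> \<le> 1" and f [measurable]: "f \<in> borel_measurable lebesgue" and t: "0 < t"
    and E [measurable]: "E \<in> sets lebesgue" and sub: "cball z t \<subseteq> E"
  shows "intrinsic_sup \<gamma> f t z \<le> ennreal (3 / t ^ DIM('a)) * (\<integral>\<^sup>+u. ennreal (norm (f u)) * indicator E u \<partial>lebesgue)"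
  unfolding intrinsic_sup_def
proof (rule SUP_least)
  fix \<phi> :: "'a \<Rightarrow> complex" assume \<phi>: "\<phi> \<in> test_class \<gamma>"
  let ?g = "\<lambda>u. f u * \<phi> ((1 / t) *\<^sub>R (z - u))"
  have "ennreal (norm (convol f (dilate t \<phi>) z)) = ennreal (1 / t ^ DIM('a)) * ennreal (norm (LINT u|lebesgue. ?g u))"
    using t by (simp add: convol_dilate_eq norm_mult norm_divide norm_power flip: ennreal_mult)
  also have "ennreal (norm (LINT u|lebesgue. ?g u)) \<le> (\<integral>\<^sup>+u. ennreal (norm (?g u)) \<partial>lebesgue)"
    by (cases "integrable lebesgue ?g") (auto simp: integral_norm_bound_ennreal not_integrable_integral_eq)
  also have "\<dots> \<le> (\<integral>\<^sup>+u. 3 * (ennreal (norm (f u)) * indicator E u) \<partial>lebesgue)"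
  proof (intro nn_integral_mono)
    fix u
    show "ennreal (norm (?g u)) \<le> 3 * (ennreal (norm (f u)) * indicator E u)"
    proof (cases "u \<in> E")
      case True
      have "norm (?g u) \<le> 3 * norm (f u)"
        using mult_left_mono[OF test_function_bound[OF \<phi> \<gamma>], of "norm (f u)" "(1 / t) *\<^sub>R (z - u)"]
        by (simp add: norm_mult mult.commute)
      then show ?thesis using True by (simp add: numeral_mult_ennreal ennreal_leI)
    next
      case False
      then have "t < norm (z - u)" using sub by (auto simp: dist_norm not_le[symmetric])
      then show ?thesis using test_function_outside_dilate[OF \<phi> t] by simp
    qed
  qed
  also have "\<dots> = 3 * (\<integral>\<^sup>+u. ennreal (norm (f u)) * indicator E u \<partial>lebesgue)"
    by (rule nn_integral_cmult) measurable
  finally have "ennreal (norm (convol f (dilate t \<phi>) z)) \<le>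
    ennreal (1 / t ^ DIM('a)) * (3 * (\<integral>\<^sup>+u. ennreal (norm (f u)) * indicator E u \<partial>lebesgue))"
    by (simp add: mult_left_mono)
  also have "\<dots> = ennreal (3 / t ^ DIM('a)) * (\<integral>\<^sup>+u. ennreal (norm (f u)) * indicator E u \<partial>lebesgue)"
  proof -
    have "ennreal (1 / t ^ DIM('a)) * 3 = ennreal (3 / t ^ DIM('a))"
      using t numeral_mult_ennreal[of "1 / t ^ DIM('a)"] by (simp add: mult.commute)
    then show ?thesis by (simp add: mult.assoc[symmetric])
  qed
  finally show "ennreal (norm (convol f (dilate t \<phi>) z)) \<le>
    ennreal (3 / t ^ DIM('a)) * (\<integral>\<^sup>+u. ennreal (norm (f u)) * indicator E u \<partial>lebesgue)" .
qed

lemma convol_dilate_continuous: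
  fixes f :: "'a::euclidean_space \<Rightarrow> complex"
  assumes \<gamma>: "0 < \<gamma>" "\<gamma> \<le> 1" and f: "\<And>R. set_integrable lebesgue (ball 0 R) f"
    and f_meas [measurable]: "f \<in> borel_measurable lebesgue" and \<phi>: "\<phi> \<in> test_class \<gamma>"
  shows "continuous_on {p. 0 < snd p} (\<lambda>p. convol f (dilate (snd p) \<phi>) (fst p))"
  unfolding continuous_on_sequentially
proof (intro allI ballI impI, elim conjE)
  fix X :: "nat \<Rightarrow> 'a \<times> real" and p assume p: "p \<in> {p. 0 < snd p}"
    and X: "\<forall>n. X n \<in> {p. 0 < snd p}" "X \<longlonglongrightarrow> p"
  have zlim: "(\<lambda>n. fst (X n)) \<longlonglongrightarrow> fst p" and tlim: "(\<lambda>n. snd (X n)) \<longlonglongrightarrow> snd p"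
    using X(2) by (auto intro: tendsto_fst tendsto_snd)
  have p0: "snd p \<noteq> 0" using p by simp
  obtain R1 where R1: "\<And>n. norm (fst (X n)) \<le> R1"
    using convergent_imp_Bseq[OF convergentI[OF zlim]] by (auto simp: Bseq_def)
  obtain R2 where R2: "\<And>n. norm (snd (X n)) \<le> R2"
    using convergent_imp_Bseq[OF convergentI[OF tlim]] by (auto simp: Bseq_def)
  define R where "R = R1 + R2 + 1"
  have \<phi>c: "continuous_on UNIV \<phi>" by (rule test_function_continuous[OF \<phi> \<gamma>(1)])
  have [measurable]: "\<phi> \<in> borel_measurable borel"
    using \<phi>c by (rule borel_measurable_continuous_onI)
  have meas: "(\<lambda>u. \<phi> ((1 / t) *\<^sub>R (z - u))) \<in> borel_measurable lebesgue" for t z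
    by (intro measurable_completion) measurable
  have inv: "(\<lambda>n. 1 / snd (X n)) \<longlonglongrightarrow> 1 / snd p"
    using tlim p0 by (intro tendsto_divide tendsto_const) auto
  have "(\<lambda>n. LINT u|lebesgue. f u * \<phi> ((1 / snd (X n)) *\<^sub>R (fst (X n) - u))) \<longlonglongrightarrow>
    (LINT u|lebesgue. f u * \<phi> ((1 / snd p) *\<^sub>R (fst p - u)))"
  proof (rule integral_dominated_convergence[where w = "\<lambda>u. norm (indicat_real (ball 0 R) u *\<^sub>R f u) * 3"])
    show "integrable lebesgue (\<lambda>u. norm (indicat_real (ball 0 R) u *\<^sub>R f u) * 3)"
      using f[of R] by (intro integrable_mult_left integrable_norm) (simp add: set_integrable_def)
    show "AE u in lebesgue. (\<lambda>n. f u * \<phi> ((1 / snd (X n)) *\<^sub>R (fst (X n) - u))) \<longlonglongrightarrow> f u * \<phi> ((1 / snd p) *\<^sub>R (fst p - u))"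
    proof (intro AE_I2 tendsto_mult tendsto_const)
      fix u
      have "(\<lambda>n. (1 / snd (X n)) *\<^sub>R (fst (X n) - u)) \<longlonglongrightarrow> (1 / snd p) *\<^sub>R (fst p - u)"
        by (intro tendsto_scaleR inv tendsto_diff zlim tendsto_const)
      then show "(\<lambda>n. \<phi> ((1 / snd (X n)) *\<^sub>R (fst (X n) - u))) \<longlonglongrightarrow> \<phi> ((1 / snd p) *\<^sub>R (fst p - u))"
        by (rule continuous_on_tendsto_compose[OF \<phi>c]) auto
    qed
    show "AE u in lebesgue. norm (f u * \<phi> ((1 / snd (X n)) *\<^sub>R (fst (X n) - u))) \<le> norm (indicat_real (ball 0 R) u *\<^sub>R f u) * 3" for n
    proof (intro AE_I2)
      fix u
      show "norm (f u * \<phi> ((1 / snd (X n)) *\<^sub>R (fst (X n) - u))) \<le> norm (indicat_real (ball 0 R) u *\<^sub>R f u) * 3"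
      proof (cases "u \<in> ball 0 R")
        case True
        then show ?thesis
          using mult_left_mono[OF test_function_bound[OF \<phi> \<gamma>], of "norm (f u)"] by (simp add: norm_mult)
      next
        case False
        have t: "0 < snd (X n)" using X(1) by simp
        have "norm u \<le> norm (fst (X n)) + norm (fst (X n) - u)"
          using norm_triangle_ineq4[of "fst (X n)" "fst (X n) - u"] by simp
        then have "snd (X n) < norm (fst (X n) - u)"
          using False R1[of n] R2[of n] by (simp add: R_def)
        then show ?thesis using test_function_outside_dilate[OF \<phi> t] by simp
      qed
    qed
  qed (use meas in measurable)
  moreover have "(\<lambda>n. complex_of_real (1 / snd (X n) ^ DIM('a))) \<longlonglongrightarrow> of_real (1 / snd p ^ DIM('a))"
    using tlim p0 by (intro tendsto_of_real tendsto_divide tendsto_const tendsto_power) auto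
  ultimately show "((\<lambda>p. convol f (dilate (snd p) \<phi>) (fst p)) \<circ> X) \<longlonglongrightarrow> convol f (dilate (snd p) \<phi>) (fst p)"
    unfolding convol_dilate_eq comp_def by (intro tendsto_mult)
qed

text \<open>
  The supremum runs over an uncountable family, but its members are continuous in \<open>(z,
  t)\<close>; the supremum is therefore lower semicontinuous.
\<close>

lemma intrinsic_sup_measurable:
  fixes f :: "'a::euclidean_space \<Rightarrow> complex"
  assumes \<gamma>: "0 < \<gamma>" "\<gamma> \<le> 1" and f: "\<And>R. set_integrable lebesgue (ball 0 R) f"
    and f_meas: "f \<in> borel_measurable lebesgue"
  shows "(\<lambda>p. if 0 < snd p then intrinsic_sup \<gamma> f (snd p) (fst p) else 0) \<in> borel_measurable borel"
proof (rule borel_measurableI_greater)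
  fix c :: ennreal
  have op: "open {p::'a \<times> real. 0 < snd p}"
    by (intro open_Collect_less continuous_intros)
  have "{p \<in> space borel. c < (if 0 < snd p then intrinsic_sup \<gamma> f (snd p) (fst p) else 0)} =
    (\<Union>\<phi>\<in>test_class \<gamma>. (\<lambda>p. ennreal (norm (convol f (dilate (snd p) \<phi>) (fst p)))) -` {c<..} \<inter> {p. 0 < snd p})"
    by (auto simp: intrinsic_sup_def less_SUP_iff split: if_splits)
  also have "open \<dots>"
  proof (intro open_UN ballI)
    fix \<phi> :: "'a \<Rightarrow> complex" assume \<phi>: "\<phi> \<in> test_class \<gamma>"
    have "continuous_on {p. 0 < snd p} (\<lambda>p. ennreal (norm (convol f (dilate (snd p) \<phi>) (fst p))))"
      by (intro continuous_on_ennreal continuous_on_norm convol_dilate_continuous[OF \<gamma> f f_meas \<phi>])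
    then show "open ((\<lambda>p. ennreal (norm (convol f (dilate (snd p) \<phi>) (fst p)))) -` {c<..} \<inter> {p. 0 < snd p})"
      by (rule continuous_on_open_vimage[OF op, THEN iffD1, rule_format]) auto
  qed
  finally show "{p \<in> space borel. c < (if 0 < snd p then intrinsic_sup \<gamma> f (snd p) (fst p) else 0)} \<in> sets borel"
    by simp
qed

definition area_density :: "real \<Rightarrow> ('a::euclidean_space \<Rightarrow> complex) \<Rightarrow> 'a \<times> real \<Rightarrow> ennreal" where
  "area_density \<gamma> f p = (if 0 < snd p then (intrinsic_sup \<gamma> f (snd p) (fst p))\<^sup>2 * ennreal (1 / snd p ^ (DIM('a) + 1)) else 0)"

lemma area_density_measurable:
  fixes f :: "'a::euclidean_space \<Rightarrow> complex"
  assumes \<gamma>: "0 < \<gamma>" "\<gamma> \<le> 1" and f: "\<And>R. set_integrable lebesgue (ball 0 R) f"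
    and f_meas: "f \<in> borel_measurable lebesgue"
  shows "area_density \<gamma> f \<in> borel_measurable borel"
proof -
  note [measurable] = intrinsic_sup_measurable[OF assms]
  have "area_density \<gamma> f = (\<lambda>p. (if 0 < snd p then intrinsic_sup \<gamma> f (snd p) (fst p) else 0)\<^sup>2 * ennreal (1 / snd p ^ (DIM('a) + 1)))"
    by (auto simp: area_density_def fun_eq_iff)
  moreover have "(snd :: 'a \<times> real \<Rightarrow> real) \<in> borel_measurable borel"
    by (intro borel_measurable_continuous_onI continuous_intros)
  ultimately show ?thesis by simp
qed

lemma intrinsic_square_eq:
  "intrinsic_square \<gamma> f x = ennpow (\<integral>\<^sup>+p. area_density \<gamma> f p * indicator (cone x) p \<partial>lborel) (1 / 2)"
  unfolding intrinsic_square_def nn_integral_completion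
  by (intro arg_cong2[where f = ennpow] nn_integral_cong refl)
    (auto simp: area_density_def intrinsic_sup_def cone_def indicator_def)

lemma intrinsic_square_measurable:
  fixes f :: "'a::euclidean_space \<Rightarrow> complex"
  assumes "0 < \<gamma>" "\<gamma> \<le> 1" "\<And>R. set_integrable lebesgue (ball 0 R) f" "f \<in> borel_measurable lebesgue"
  shows "intrinsic_square \<gamma> f \<in> borel_measurable borel"
proof -
  note [measurable] = area_density_measurable[OF assms]
  have "open {q::'a \<times> ('a \<times> real). 0 < snd (snd q) \<and> norm (fst q - fst (snd q)) < snd (snd q)}"
    by (intro open_Collect_conj open_Collect_less continuous_intros)
  then have "{q::'a \<times> ('a \<times> real). snd q \<in> cone (fst q)} \<in> sets borel"
    by (simp add: cone_def case_prod_beta)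
  then have [measurable]: "{q::'a \<times> ('a \<times> real). snd q \<in> cone (fst q)} \<in> sets (borel \<Otimes>\<^sub>M lborel)"
  proof -
    have "sets (borel \<Otimes>\<^sub>M lborel) = sets ((borel :: 'a measure) \<Otimes>\<^sub>M (borel :: ('a \<times> real) measure))"
      by (rule sets_pair_measure_cong) simp_all
    also have "\<dots> = sets (borel :: ('a \<times> ('a \<times> real)) measure)" by (simp only: borel_prod)
    finally show "{q::'a \<times> ('a \<times> real). snd q \<in> cone (fst q)} \<in> sets borel \<Longrightarrow> ?thesis" by simp
  qed
  define h where "h q = area_density \<gamma> f (snd q) * indicator {q::'a \<times> ('a \<times> real). snd q \<in> cone (fst q)} q" for q
  have "h \<in> borel_measurable (borel \<Otimes>\<^sub>M lborel)"
    unfolding h_def by measurable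
  moreover have "case_prod (\<lambda>x p. h (x, p)) = h" by (simp add: fun_eq_iff split_beta)
  ultimately have "(\<lambda>x. \<integral>\<^sup>+p. h (x, p) \<partial>lborel) \<in> borel_measurable borel"
    using lborel.borel_measurable_nn_integral[of "\<lambda>x p. h (x, p)" borel] by simp
  moreover have "h (x, p) = area_density \<gamma> f p * indicator (cone x) p" for x p
    by (simp add: h_def indicator_def)
  ultimately have "(\<lambda>x. \<integral>\<^sup>+p. area_density \<gamma> f p * indicator (cone x) p \<partial>lborel) \<in> borel_measurable borel"
    by simp
  then show ?thesis unfolding intrinsic_square_eq[abs_def] by measurable
qed

section \<open>Discretization of the area integral\<close>

definition shell :: "'a::euclidean_space \<Rightarrow> real \<Rightarrow> ('a \<times> real) set" where
  "shell x a = {p \<in> cone x. a \<le> snd p \<and> snd p \<le> 2 * a}"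

definition shell_const :: "'a::euclidean_space itself \<Rightarrow> real" where
  "shell_const _ = 2 ^ DIM('a) * unit_ball_vol DIM('a)"

text \<open>
  The volume of the shell is at most a multiple of \<open>a ^ (DIM('a) + 1)\<close>, which cancels
  the weight \<open>1 / t ^ (DIM('a) + 1)\<close>.
\<close>

lemma shell_integral_le:
  fixes x :: "'a::euclidean_space"
  assumes a: "0 < a" and b: "\<And>z t. (z, t) \<in> shell x a \<Longrightarrow> intrinsic_sup \<gamma> f t z \<le> b"
  shows "(\<integral>\<^sup>+p. area_density \<gamma> f p * indicator (shell x a) p \<partial>lborel) \<le> ennreal (shell_const TYPE('a)) * b\<^sup>2"
proof -
  let ?c = "ennreal (1 / a ^ (DIM('a) + 1))"
  have "(\<integral>\<^sup>+p. area_density \<gamma> f p * indicator (shell x a) p \<partial>lborel) \<le>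
    (\<integral>\<^sup>+p. (b\<^sup>2 * ?c) * indicator (ball x (2 * a) \<times> {a..2 * a}) p \<partial>lborel)"
  proof (intro nn_integral_mono)
    fix p :: "'a \<times> real"
    show "area_density \<gamma> f p * indicator (shell x a) p \<le> (b\<^sup>2 * ?c) * indicator (ball x (2 * a) \<times> {a..2 * a}) p"
    proof (cases "p \<in> shell x a")
      case True
      then have p: "norm (x - fst p) < snd p" "a \<le> snd p" "snd p \<le> 2 * a"
        by (auto simp: shell_def cone_def case_prod_beta)
      then have "p \<in> ball x (2 * a) \<times> {a..2 * a}" by (auto simp: dist_norm mem_Times_iff)
      moreover have "intrinsic_sup \<gamma> f (snd p) (fst p) \<le> b" using b[of "fst p" "snd p"] True by simp
      moreover have "1 / snd p ^ (DIM('a) + 1) \<le> 1 / a ^ (DIM('a) + 1)"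
        using a p by (intro divide_left_mono power_mono mult_pos_pos zero_less_power) auto
      ultimately show ?thesis
        using True by (auto simp: area_density_def simp del: power_Suc add_Suc_right intro!: mult_mono power_mono_ennreal ennreal_leI)
    qed simp
  qed
  also have "\<dots> = (b\<^sup>2 * ?c) * emeasure lborel (ball x (2 * a) \<times> {a..2 * a})"
    by (rule nn_integral_cmult_indicator) (auto simp: borel_Times)
  also have "emeasure lborel (ball x (2 * a) \<times> {a..2 * a}) = emeasure lborel (ball x (2 * a)) * emeasure lborel {a..2 * a}"
    unfolding lborel_prod[symmetric] by (rule lborel.emeasure_pair_measure_Times) auto
  also have "\<dots> = ennreal (unit_ball_vol DIM('a) * (2 * a) ^ DIM('a) * a)"
    using a by (simp add: emeasure_ball ennreal_mult)
  also have "(b\<^sup>2 * ?c) * ennreal (unit_ball_vol DIM('a) * (2 * a) ^ DIM('a) * a) = ennreal (shell_const TYPE('a)) * b\<^sup>2"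
  proof -
    have "1 / a ^ (DIM('a) + 1) * (unit_ball_vol DIM('a) * (2 * a) ^ DIM('a) * a) = shell_const TYPE('a)"
      using a by (simp add: shell_const_def power_mult_distrib)
    then have "?c * ennreal (unit_ball_vol DIM('a) * (2 * a) ^ DIM('a) * a) = ennreal (shell_const TYPE('a))"
      using a by (subst ennreal_mult[symmetric]) auto
    then show ?thesis by (simp only: mult.assoc) (simp only: mult.commute)
  qed
  finally show ?thesis .
qed

lemma cone_subset_shells:
  fixes x :: "'a::euclidean_space"
  assumes L: "0 < L"
  shows "cone x \<subseteq> (\<Union>k. shell x (L / 2 ^ k / 24)) \<union> (\<Union>i. shell x (2 ^ i * L / 12))"
proof
  fix p assume p: "p \<in> cone x"
  define t where "t = snd p"
  have t: "0 < t" using p by (auto simp: cone_def t_def)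
  show "p \<in> (\<Union>k. shell x (L / 2 ^ k / 24)) \<union> (\<Union>i. shell x (2 ^ i * L / 12))"
  proof (cases "t \<le> L / 12")
    case True
    obtain k0 where "(1 / 2) ^ k0 < 24 * t / L"
      using real_arch_pow_inv[of "24 * t / L" "1 / 2"] t L by auto
    then have ex: "L / 2 ^ k0 / 24 \<le> t" using L t by (simp add: field_simps)
    define k where "k = (LEAST k. L / 2 ^ k / 24 \<le> t)"
    have k: "L / 2 ^ k / 24 \<le> t" unfolding k_def by (rule LeastI) (rule ex)
    have "t \<le> 2 * (L / 2 ^ k / 24)"
    proof (cases k)
      case 0
      then show ?thesis using True by simp
    next
      case (Suc j)
      then have "\<not> L / 2 ^ j / 24 \<le> t" using not_less_Least[of j "\<lambda>k. L / 2 ^ k / 24 \<le> t"] by (simp add: k_def)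
      then show ?thesis using Suc by simp
    qed
    then have "p \<in> shell x (L / 2 ^ k / 24)" using p k by (simp add: shell_def t_def)
    then show ?thesis by blast
  next
    case False
    obtain i0 where "12 * t / L < 2 ^ i0" using real_arch_pow[of 2 "12 * t / L"] by auto
    then have ex: "t \<le> 2 * (2 ^ i0 * L / 12)" using L t by (simp add: field_simps)
    define i where "i = (LEAST i. t \<le> 2 * (2 ^ i * L / 12))"
    have i: "t \<le> 2 * (2 ^ i * L / 12)" unfolding i_def by (rule LeastI) (rule ex)
    have "2 ^ i * L / 12 \<le> t"
    proof (cases i)
      case 0
      then show ?thesis using False by simp
    next
      case (Suc j)
      then have "\<not> t \<le> 2 * (2 ^ j * L / 12)"
        using not_less_Least[of j "\<lambda>i. t \<le> 2 * (2 ^ i * L / 12)"] by (simp add: i_def)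
      then show ?thesis using Suc by simp
    qed
    then have "p \<in> shell x (2 ^ i * L / 12)" using p i by (simp add: shell_def t_def)
    then show ?thesis by blast
  qed
qed

lemma shell_borel [measurable]: "shell (x::'a::euclidean_space) a \<in> sets borel"
proof -
  have op: "open {p::'a \<times> real. 0 < snd p \<and> norm (x - fst p) < snd p}"
    by (intro open_Collect_conj open_Collect_less continuous_intros)
  have cl: "closed {p::'a \<times> real. a \<le> snd p \<and> snd p \<le> 2 * a}"
    by (intro closed_Collect_conj closed_Collect_le continuous_intros)
  have eq: "shell x a = {p. 0 < snd p \<and> norm (x - fst p) < snd p} \<inter> {p. a \<le> snd p \<and> snd p \<le> 2 * a}"
    by (auto simp: shell_def cone_def)
  show ?thesis
    unfolding eq by (intro sets.Int borel_open[OF op] borel_closed[OF cl])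
qed

lemma suminf_ennreal_upper: "f i \<le> (\<Sum>i. f i :: ennreal)"
  using sum_le_suminf[of f "{i}"] by (simp add: summableI)

text \<open>
  Heights up to \<open>L / 12\<close> are distributed over the levels of the grids: at a height
  between \<open>1 / 24\<close> and \<open>1 / 12\<close> of the side, the kernels are supported in
  a ball about \<open>x\<close> of radius a sixth of the side, which fits into a cube of one of the
  grids. With \<open>L = r / DIM('a)\<close>, all these cubes lie in \<open>ball y (2 * r)\<close>,
  so only the restriction \<open>f'\<close> of \<open>f\<close> enters. The remaining heights are
  bounded by averages over the balls \<open>ball y (2 ^ Suc i * r)\<close>.
\<close>

lemma area_integral_le:
  fixes f :: "'a::euclidean_space \<Rightarrow> complex"
  assumes \<gamma>: "0 < \<gamma>" "\<gamma> \<le> 1" and f: "\<And>R. set_integrable lebesgue (ball 0 R) f"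
    and f_meas: "f \<in> borel_measurable lebesgue" and r: "0 < r" and x: "x \<in> ball y r"
  defines "L \<equiv> r / DIM('a)" and "f' \<equiv> \<lambda>u. if u \<in> ball y (2 * r) then f u else 0"
  shows "(\<integral>\<^sup>+p. area_density \<gamma> f p * indicator (cone x) p \<partial>lborel) \<le>
    ennreal (shell_const TYPE('a) * 24 ^ (2 * Suc DIM('a))) *
      (\<Sum>s\<in>grid_shifts. SUP K. oscillation_grid.square_sum (grid_cube L s) L \<gamma> K f' x) +
    ennreal (shell_const TYPE('a)) * (\<Sum>i. (ennreal (3 / (2 ^ i * L / 12) ^ DIM('a)) *
      (\<integral>\<^sup>+u. ennreal (norm (f u)) * indicator (ball y (2 ^ Suc i * r)) u \<partial>lebesgue))\<^sup>2)"
proof -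
  let ?n = "real DIM('a)"
  let ?\<kappa> = "shell_const TYPE('a)"
  have n1: "1 \<le> ?n" by (simp add: Suc_leI)
  have L: "0 < L" "?n * L = r" "L \<le> r"
    using r n1 by (auto simp: L_def divide_le_eq mult_le_cancel_left1)
  have \<kappa>: "0 \<le> ?\<kappa>" by (simp add: shell_const_def)
  note [measurable] = area_density_measurable[OF \<gamma> f f_meas]
  have xy: "norm (x - y) < r" using x by (simp add: dist_norm norm_minus_commute)
  define a where "a s k = (oscillation_grid.osc (grid_cube L s) L \<gamma> k f' x)\<^sup>2" for s k
  define b where "b i = ennreal (3 / (2 ^ i * L / 12) ^ DIM('a)) *
      (\<integral>\<^sup>+u. ennreal (norm (f u)) * indicator (ball y (2 ^ Suc i * r)) u \<partial>lebesgue)" for i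
  have grid: "oscillation_grid (grid_cube L s) L \<gamma>" if "s \<in> grid_shifts" for s
    using dyadic_grid_grid_cube[OF L(1) that] \<gamma> by (simp add: oscillation_grid_def oscillation_grid_axioms_def)
  have near_sub: "cball z t \<subseteq> ball x (2 * t)" if "(z, t) \<in> shell x c" for z t c
  proof
    fix u assume "u \<in> cball z t"
    then have "norm (x - u) \<le> norm (x - z) + norm (z - u)" "norm (z - u) \<le> t"
      using norm_triangle_ineq[of "x - z" "z - u"] by (auto simp: dist_norm)
    then show "u \<in> ball x (2 * t)" using that by (auto simp: shell_def cone_def dist_norm)
  qed
  have small: "(\<integral>\<^sup>+p. area_density \<gamma> f p * indicator (shell x (L / 2 ^ k / 24)) p \<partial>lborel) \<le>
      ennreal (?\<kappa> * 24 ^ (2 * Suc DIM('a))) * (\<Sum>s\<in>grid_shifts. a s k)" for k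
  proof -
    obtain s where s: "s \<in> grid_shifts" "ball x (L / 2 ^ k / 6) \<subseteq> grid_cube L s k x"
      using ball_subset_grid_cube[OF L(1), of "L / 2 ^ k / 6" k x] by auto
    interpret oscillation_grid "grid_cube L s" L \<gamma> by (rule grid[OF s(1)])
    have "intrinsic_sup \<gamma> f t z \<le> ennreal (24 ^ Suc DIM('a)) * osc k f' x"
      if zt: "(z, t) \<in> shell x (L / 2 ^ k / 24)" for z t
    proof (rule intrinsic_sup_le_osc[OF f_meas])
      have t: "0 < t" "L / 2 ^ k / 24 \<le> t" "t \<le> 2 * (L / 2 ^ k / 24)"
        using zt by (auto simp: shell_def cone_def)
      show "0 < t" by fact
      show "side k \<le> 24 * t" using t by (simp add: side_def)
      have "ball x (2 * t) \<subseteq> ball x (L / 2 ^ k / 6)" using t by (intro subset_ball) simp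
      then show "cball z t \<subseteq> grid_cube L s k x" using near_sub[OF zt] s(2) by blast
      fix u assume "u \<in> grid_cube L s k x"
      then have "norm (u - x) \<le> ?n * (L / 2 ^ k)" by (rule cube_diam)
      also have "\<dots> \<le> ?n * (L / 1)" using L(1) by (intro mult_left_mono divide_left_mono) auto
      finally have "norm (u - x) \<le> r" using L by simp
      then have "norm (u - y) < 2 * r" using xy norm_triangle_ineq[of "u - x" "x - y"] by simp
      then show "f' u = f u" by (simp add: f'_def dist_norm norm_minus_commute)
    qed
    then have "(\<integral>\<^sup>+p. area_density \<gamma> f p * indicator (shell x (L / 2 ^ k / 24)) p \<partial>lborel) \<le>
      ennreal ?\<kappa> * (ennreal (24 ^ Suc DIM('a)) * osc k f' x)\<^sup>2"
      using L by (intro shell_integral_le) auto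
    also have "\<dots> = ennreal (?\<kappa> * 24 ^ (2 * Suc DIM('a))) * a s k"
    proof -
      have "(ennreal (24 ^ Suc DIM('a)))\<^sup>2 = ennreal (24 ^ (2 * Suc DIM('a)))"
        by (subst ennreal_power) (auto simp: power_mult[symmetric] mult.commute simp del: power_Suc mult_Suc_right mult_Suc)
      then show ?thesis unfolding a_def power_mult_distrib using \<kappa> by (simp only: ennreal_mult zero_le_power zero_le_numeral mult.assoc)
    qed
    also have "\<dots> \<le> ennreal (?\<kappa> * 24 ^ (2 * Suc DIM('a))) * (\<Sum>s\<in>grid_shifts. a s k)"
      using s(1) finite_grid_shifts by (intro mult_left_mono member_le_sum) auto
    finally show ?thesis .
  qed
  have large: "(\<integral>\<^sup>+p. area_density \<gamma> f p * indicator (shell x (2 ^ i * L / 12)) p \<partial>lborel) \<le> ennreal ?\<kappa> * (b i)\<^sup>2" for i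
  proof (rule shell_integral_le)
    show "0 < 2 ^ i * L / 12" using L by simp
    fix z t assume zt: "(z, t) \<in> shell x (2 ^ i * L / 12)"
    then have t: "0 < t" "2 ^ i * L / 12 \<le> t" "t \<le> 2 * (2 ^ i * L / 12)"
      by (auto simp: shell_def cone_def)
    have "cball z t \<subseteq> ball y (2 ^ Suc i * r)"
    proof
      fix u assume "u \<in> cball z t"
      then have "u \<in> ball x (2 * t)" using near_sub[OF zt] by blast
      then have "norm (u - x) < 2 * t" by (simp add: dist_norm norm_minus_commute)
      then have "norm (u - y) < 2 * t + r" using xy norm_triangle_ineq[of "u - x" "x - y"] by simp
      also have "\<dots> \<le> 2 ^ i * r / 3 + 2 ^ i * r"
      proof (rule add_mono)
        have "2 ^ i * L \<le> 2 ^ i * r" using L by simp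
        then show "2 * t \<le> 2 ^ i * r / 3" using t(3) by linarith
        show "r \<le> 2 ^ i * r" using r by (simp add: mult_le_cancel_right1)
      qed
      also have "\<dots> \<le> 2 ^ Suc i * r" using r by simp
      finally show "u \<in> ball y (2 ^ Suc i * r)" by (simp add: dist_norm norm_minus_commute)
    qed
    then have "intrinsic_sup \<gamma> f t z \<le> ennreal (3 / t ^ DIM('a)) *
        (\<integral>\<^sup>+u. ennreal (norm (f u)) * indicator (ball y (2 ^ Suc i * r)) u \<partial>lebesgue)"
      by (intro intrinsic_sup_le_average \<gamma> f_meas t) auto
    also have "\<dots> \<le> b i"
      unfolding b_def using t L
      by (intro mult_right_mono ennreal_leI divide_left_mono power_mono mult_pos_pos zero_less_power) auto
    finally show "intrinsic_sup \<gamma> f t z \<le> b i" .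
  qed
  have "(\<integral>\<^sup>+p. area_density \<gamma> f p * indicator (cone x) p \<partial>lborel) \<le>
    (\<integral>\<^sup>+p. (\<Sum>k. area_density \<gamma> f p * indicator (shell x (L / 2 ^ k / 24)) p) +
        (\<Sum>i. area_density \<gamma> f p * indicator (shell x (2 ^ i * L / 12)) p) \<partial>lborel)"
  proof (intro nn_integral_mono)
    fix p
    show "area_density \<gamma> f p * indicator (cone x) p \<le>
      (\<Sum>k. area_density \<gamma> f p * indicator (shell x (L / 2 ^ k / 24)) p) +
        (\<Sum>i. area_density \<gamma> f p * indicator (shell x (2 ^ i * L / 12)) p)"
    proof (cases "p \<in> cone x")
      case True
      then consider k where "p \<in> shell x (L / 2 ^ k / 24)" | i where "p \<in> shell x (2 ^ i * L / 12)"
        using cone_subset_shells[OF L(1), of x] by blast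
      then show ?thesis
      proof cases
        case (1 k)
        then show ?thesis
          using suminf_ennreal_upper[of "\<lambda>k. area_density \<gamma> f p * indicator (shell x (L / 2 ^ k / 24)) p" k] True
          by (auto intro: add_increasing2)
      next
        case (2 i)
        then show ?thesis
          using suminf_ennreal_upper[of "\<lambda>i. area_density \<gamma> f p * indicator (shell x (2 ^ i * L / 12)) p" i] True
          by (auto intro: add_increasing)
      qed
    qed simp
  qed
  also have "\<dots> = (\<Sum>k. \<integral>\<^sup>+p. area_density \<gamma> f p * indicator (shell x (L / 2 ^ k / 24)) p \<partial>lborel) +
     (\<Sum>i. \<integral>\<^sup>+p. area_density \<gamma> f p * indicator (shell x (2 ^ i * L / 12)) p \<partial>lborel)"
    by (simp add: nn_integral_add nn_integral_suminf del: ennreal_suminf_cmult)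
  also have "\<dots> \<le> (\<Sum>k. ennreal (?\<kappa> * 24 ^ (2 * Suc DIM('a))) * (\<Sum>s\<in>grid_shifts. a s k)) + (\<Sum>i. ennreal ?\<kappa> * (b i)\<^sup>2)"
    by (intro add_mono suminf_le small large summableI)
  also have "\<dots> = ennreal (?\<kappa> * 24 ^ (2 * Suc DIM('a))) * (\<Sum>s\<in>grid_shifts. \<Sum>k. a s k) + ennreal ?\<kappa> * (\<Sum>i. (b i)\<^sup>2)"
    by (simp only: ennreal_suminf_cmult suminf_sum[OF summableI])
  also have "\<dots> \<le> ennreal (?\<kappa> * 24 ^ (2 * Suc DIM('a))) *
      (\<Sum>s\<in>grid_shifts. SUP K. oscillation_grid.square_sum (grid_cube L s) L \<gamma> K f' x) + ennreal ?\<kappa> * (\<Sum>i. (b i)\<^sup>2)"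
  proof (intro add_right_mono mult_left_mono sum_mono)
    fix s :: "'a \<Rightarrow> real" assume s: "s \<in> grid_shifts"
    interpret oscillation_grid "grid_cube L s" L \<gamma> by (rule grid[OF s])
    show "(\<Sum>k. a s k) \<le> (SUP K. square_sum K f' x)"
      unfolding suminf_eq_SUP a_def square_sum_def
      by (rule SUP_mono, rule_tac x = n in bexI) (auto intro!: sum_mono2)
  qed simp
  finally show ?thesis unfolding b_def .
qed

section \<open>Muckenhoupt weights on balls\<close>

lemma ball_lebesgue [measurable]: "ball (z::'a::euclidean_space) r \<in> sets lebesgue"
  by auto

locale muckenhoupt_weight =
  fixes w :: "'a::euclidean_space \<Rightarrow> real" and q C :: real
  assumes q: "1 < q" and C: "0 < C"
    and w_pos: "0 < w x"
    and w_measurable [measurable]: "w \<in> borel_measurable lebesgue"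
    and w_ball: "(\<integral>\<^sup>+x. ennreal (w x) * indicator (ball z r) x \<partial>lebesgue) < top"
    and dual_ball: "(\<integral>\<^sup>+x. ennreal (w x powr (- 1 / (q - 1))) * indicator (ball z r) x \<partial>lebesgue) < top"
    and Aq_ball: "0 < r \<Longrightarrow> (\<integral>\<^sup>+x. ennreal (w x) * indicator (ball z r) x \<partial>lebesgue) *
      ennpow (\<integral>\<^sup>+x. ennreal (w x powr (- 1 / (q - 1))) * indicator (ball z r) x \<partial>lebesgue) (q - 1)
      \<le> ennreal C * ennpow (emeasure lebesgue (ball z r)) q"

text \<open>
  The integral of the weight over a ball is positive, so the \<open>A\<^sub>q\<close> condition
  forces that of the dual weight to be finite.
\<close>

lemma muckenhoupt_weight_exists:
  fixes w :: "'a::euclidean_space \<Rightarrow> real"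
  assumes q: "1 < q" and w: "w \<in> Muckenhoupt q"
  shows "\<exists>C. muckenhoupt_weight w q C"
proof -
  obtain C where C: "0 < C" "\<And>z r. 0 < r \<Longrightarrow>
        ((\<integral>\<^sup>+x\<in>ball z r. ennreal (w x) \<partial>lebesgue) / emeasure lebesgue (ball z r)) *
        ennpow ((\<integral>\<^sup>+x\<in>ball z r. ennreal (w x powr (- 1 / (q - 1))) \<partial>lebesgue)
                  / emeasure lebesgue (ball z r)) (q - 1) \<le> ennreal C"
    using w by (auto simp: Muckenhoupt_def)
  have pos: "0 < w x" for x using w by (auto simp: Muckenhoupt_def is_weight_def)
  have int: "set_integrable lebesgue K w" if "compact K" for K
    using w that by (auto simp: Muckenhoupt_def is_weight_def)
  have m [measurable]: "w \<in> borel_measurable lebesgue"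
  proof (rule borel_measurable_LIMSEQ_real)
    show "(\<lambda>x. indicat_real (cball 0 (real i)) x *\<^sub>R w x) \<in> borel_measurable lebesgue" for i
      using int[of "cball 0 (real i)"] by (auto simp: set_integrable_def)
    fix x :: 'a
    obtain i0 where "norm x \<le> real i0" using real_arch_simple by blast
    then show "(\<lambda>i. indicat_real (cball 0 (real i)) x *\<^sub>R w x) \<longlonglongrightarrow> w x"
      by (intro tendsto_eventually eventually_sequentiallyI[of i0]) (auto simp: indicator_def)
  qed
  have wfin: "(\<integral>\<^sup>+x. ennreal (w x) * indicator (ball z r) x \<partial>lebesgue) < top" for z r
  proof -
    have "(\<integral>\<^sup>+x. ennreal (w x) * indicator (ball z r) x \<partial>lebesgue) \<le> (\<integral>\<^sup>+x. ennreal (w x) * indicator (cball z r) x \<partial>lebesgue)"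
      by (intro nn_integral_mono) (auto split: split_indicator)
    also have "\<dots> = ennreal (LINT x:cball z r|lebesgue. w x)"
      by (rule nn_set_integral_eq[OF int]) (auto simp: less_imp_le pos)
    finally show ?thesis using le_less_trans ennreal_less_top by blast
  qed
  have wpos: "0 < (\<integral>\<^sup>+x. ennreal (w x) * indicator (ball z r) x \<partial>lebesgue)" if r: "0 < r" for z r
  proof (rule ccontr)
    assume "\<not> ?thesis"
    then have "(\<integral>\<^sup>+x. ennreal (w x) * indicator (ball z r) x \<partial>lebesgue) = 0" by simp
    then have "AE x in lebesgue. ennreal (w x) * indicator (ball z r) x = 0"
      by (subst (asm) nn_integral_0_iff_AE) auto
    then have "AE x in lebesgue. x \<notin> ball z r"
      by eventually_elim (use pos in \<open>auto simp: indicator_def not_le[symmetric] ennreal_eq_0_iff split: if_splits\<close>)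
    then have "emeasure lebesgue (ball z r) = 0"
      by (subst (asm) AE_iff_measurable[of "ball z r"]) auto
    then show False using r unit_ball_vol_pos[of "real DIM('a)"] by (simp add: emeasure_ball)
  qed
  have A: "(\<integral>\<^sup>+x. ennreal (w x) * indicator (ball z r) x \<partial>lebesgue) *
      ennpow (\<integral>\<^sup>+x. ennreal (w x powr (- 1 / (q - 1))) * indicator (ball z r) x \<partial>lebesgue) (q - 1)
      \<le> ennreal C * ennpow (emeasure lebesgue (ball z r)) q \<and>
      (\<integral>\<^sup>+x. ennreal (w x powr (- 1 / (q - 1))) * indicator (ball z r) x \<partial>lebesgue) < top"
      if r: "0 < r" for z r
  proof -
    obtain a where a: "(\<integral>\<^sup>+x. ennreal (w x) * indicator (ball z r) x \<partial>lebesgue) = ennreal a" "0 < a"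
      using wpos[OF r, of z] wfin[of z r] by (cases "(\<integral>\<^sup>+x. ennreal (w x) * indicator (ball z r) x \<partial>lebesgue)") auto
    obtain d where d: "emeasure lebesgue (ball z r) = ennreal d" "0 < d"
      using r unit_ball_vol_pos[of "real DIM('a)"] by (simp add: emeasure_ball)
    let ?V = "(\<integral>\<^sup>+x. ennreal (w x powr (- 1 / (q - 1))) * indicator (ball z r) x \<partial>lebesgue)"
    have le: "ennreal (a / d) * ennpow (?V / ennreal d) (q - 1) \<le> ennreal C"
      using C(2)[OF r, of z] a(2) d(2) unfolding a(1) d(1) by (simp add: divide_ennreal)
    show ?thesis
    proof (cases ?V)
      case (real v)
      have 1: "a / d * (v / d) powr (q - 1) \<le> C"
        using le a d real C q by (simp add: divide_ennreal ennpow_ennreal flip: ennreal_mult)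
      have 2: "a / d * (v / d) powr (q - 1) = a * v powr (q - 1) / d powr q"
        using d real by (simp add: powr_divide powr_diff)
      have "a * v powr (q - 1) / d powr q \<le> C" using 1 unfolding 2 .
      then have "a * v powr (q - 1) \<le> C * d powr q"
        using d(2) by (simp add: pos_divide_le_eq)
      then show ?thesis
        using a d real C by (simp add: ennpow_ennreal flip: ennreal_mult)
    next
      case top
      then have "ennpow (?V / ennreal d) (q - 1) = top" using d by (simp add: ennreal_top_divide)
      then have "ennreal (a / d) * ennpow (?V / ennreal d) (q - 1) = top"
        using a d by (simp add: ennreal_mult_top)
      then show ?thesis using le by (simp add: top_unique)
    qed
  qed
  have "muckenhoupt_weight w q C"
  proof
    fix z :: 'a and r
    show "(\<integral>\<^sup>+x. ennreal (w x powr (- 1 / (q - 1))) * indicator (ball z r) x \<partial>lebesgue) < top"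
    proof (cases "0 < r")
      case True
      then show ?thesis using A by blast
    next
      case False
      then have B: "ball z r = {}" by (simp add: ball_empty)
      show ?thesis unfolding B by simp
    qed
  qed (use q C pos wfin A in auto)
  then show ?thesis by blast
qed

context muckenhoupt_weight
begin

abbreviation wt :: "'a \<Rightarrow> ennreal" where "wt x \<equiv> ennreal (w x)"
abbreviation dwt :: "'a \<Rightarrow> ennreal" where "dwt x \<equiv> ennreal (w x powr (- 1 / (q - 1)))"
abbreviation wball :: "'a \<Rightarrow> real \<Rightarrow> real" where "wball y r \<equiv> weight_of w (ball y r)"

lemma w_integrable: "set_integrable lebesgue (ball z r) w"
proof -
  have eq: "(\<integral>\<^sup>+x. ennreal (norm (indicat_real (ball z r) x *\<^sub>R w x)) \<partial>lebesgue) = (\<integral>\<^sup>+x. wt x * indicator (ball z r) x \<partial>lebesgue)"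
    using w_pos by (intro nn_integral_cong) (auto split: split_indicator simp: less_imp_le abs_of_pos)
  show ?thesis
    unfolding set_integrable_def integrable_iff_bounded eq using w_ball by auto
qed

lemma weight_of_ball: "(\<integral>\<^sup>+x. wt x * indicator (ball z r) x \<partial>lebesgue) = ennreal (wball z r)"
  unfolding weight_of_def by (rule nn_set_integral_eq[OF w_integrable]) (simp add: less_imp_le w_pos)

lemma wball_nonneg: "0 \<le> wball z r"
  unfolding weight_of_def set_lebesgue_integral_def
  by (intro integral_nonneg_AE AE_I2) (simp add: less_imp_le w_pos)

definition bvol :: "real \<Rightarrow> real" where "bvol r = measure lebesgue (ball (0::'a) r)"

lemma bvol_eq: "0 < r \<Longrightarrow> bvol r = unit_ball_vol DIM('a) * r ^ DIM('a)"
  by (simp add: bvol_def content_ball)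

lemma emeasure_ball_bvol: "0 < r \<Longrightarrow> emeasure lebesgue (ball (z::'a) r) = ennreal (bvol r)"
  by (simp add: bvol_eq emeasure_ball)

lemma bvol_pos: "0 < r \<Longrightarrow> 0 < bvol r"
  using unit_ball_vol_pos[of "real DIM('a)"] by (simp add: bvol_eq)

lemma bvol_scale: "0 < r \<Longrightarrow> 0 < c \<Longrightarrow> bvol (c * r) = c ^ DIM('a) * bvol r"
  by (simp add: bvol_eq power_mult_distrib)

lemma weighted_average_le:
  assumes [measurable]: "u \<in> borel_measurable lebesgue" and r: "0 < r"
  shows "ennpow (\<integral>\<^sup>+x. u x * indicator (ball z r) x \<partial>lebesgue) q * ennreal (wball z r) \<le>
    ennreal (C * bvol r powr q) * (\<integral>\<^sup>+x. ennpow (u x) q * wt x * indicator (ball z r) x \<partial>lebesgue)"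
proof -
  let ?X = "\<integral>\<^sup>+x. ennpow (u x) q * wt x * indicator (ball z r) x \<partial>lebesgue"
  let ?Y = "\<integral>\<^sup>+x. dwt x * indicator (ball z r) x \<partial>lebesgue"
  have "ennpow (\<integral>\<^sup>+x. u x * indicator (ball z r) x \<partial>lebesgue) q * ennreal (wball z r) \<le>
    (?X * ennpow ?Y (q - 1)) * ennreal (wball z r)"
    by (intro mult_right_mono weighted_Hoelder[OF q w_pos]) auto
  also have "\<dots> = ?X * (ennreal (wball z r) * ennpow ?Y (q - 1))" by (simp only: ac_simps)
  also have "\<dots> \<le> ?X * ennreal (C * bvol r powr q)"
  proof (rule mult_left_mono)
    show "ennreal (wball z r) * ennpow ?Y (q - 1) \<le> ennreal (C * bvol r powr q)"
      using Aq_ball[OF r, of z] bvol_pos[OF r] C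
      unfolding emeasure_ball_bvol[OF r] weight_of_ball by (simp add: ennpow_ennreal flip: ennreal_mult)
  qed simp
  finally show ?thesis by (simp only: mult.commute)
qed

text \<open>
  The \<open>A\<^sub>q\<close> condition tested on an indicator function. With \<open>E\<close> a
  smaller ball it yields doubling, with \<open>E\<close> an annulus reverse doubling.
\<close>

lemma weight_of_large_subset:
  assumes E [measurable]: "E \<in> sets lebesgue" and sub: "E \<subseteq> ball z r" and r: "0 < r" and \<delta>: "0 < \<delta>"
    and large: "ennreal (\<delta> * bvol r) \<le> emeasure lebesgue E"
  shows "ennreal (wball z r) \<le> ennreal (C * \<delta> powr (- q)) * (\<integral>\<^sup>+x. wt x * indicator E x \<partial>lebesgue)"
proof -
  let ?u = "\<lambda>x. indicator E x :: ennreal"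
  have "ennpow (ennreal (\<delta> * bvol r)) q * ennreal (wball z r) \<le> ennpow (\<integral>\<^sup>+x. ?u x * indicator (ball z r) x \<partial>lebesgue) q * ennreal (wball z r)"
  proof (intro mult_right_mono ennpow_mono)
    have "(\<integral>\<^sup>+x. ?u x * indicator (ball z r) x \<partial>lebesgue) = (\<integral>\<^sup>+x. indicator E x \<partial>lebesgue)"
      using sub by (intro nn_integral_cong) (auto split: split_indicator)
    then show "ennreal (\<delta> * bvol r) \<le> (\<integral>\<^sup>+x. ?u x * indicator (ball z r) x \<partial>lebesgue)"
      using large by simp
  qed (use q in auto)
  also have "\<dots> \<le> ennreal (C * bvol r powr q) * (\<integral>\<^sup>+x. ennpow (?u x) q * wt x * indicator (ball z r) x \<partial>lebesgue)"
    by (rule weighted_average_le[OF _ r]) measurable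
  also have "(\<integral>\<^sup>+x. ennpow (?u x) q * wt x * indicator (ball z r) x \<partial>lebesgue) = (\<integral>\<^sup>+x. wt x * indicator E x \<partial>lebesgue)"
    using sub by (intro nn_integral_cong) (auto split: split_indicator)
  finally have le: "ennreal ((\<delta> * bvol r) powr q) * ennreal (wball z r) \<le>
    ennreal (C * bvol r powr q) * (\<integral>\<^sup>+x. wt x * indicator E x \<partial>lebesgue)"
    using \<delta> bvol_pos[OF r] by (simp add: ennpow_ennreal)
  let ?c = "(\<delta> * bvol r) powr (- q)"
  have "ennreal (wball z r) = ennreal ?c * (ennreal ((\<delta> * bvol r) powr q) * ennreal (wball z r))"
    using \<delta> bvol_pos[OF r] by (simp add: mult.assoc[symmetric] powr_minus flip: ennreal_mult)
  also have "\<dots> \<le> ennreal ?c * (ennreal (C * bvol r powr q) * (\<integral>\<^sup>+x. wt x * indicator E x \<partial>lebesgue))"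
    using le by (rule mult_left_mono) simp
  also have "\<dots> = ennreal (C * \<delta> powr (- q)) * (\<integral>\<^sup>+x. wt x * indicator E x \<partial>lebesgue)"
  proof -
    have "?c * (C * bvol r powr q) = C * \<delta> powr (- q)"
      using bvol_pos[OF r] by (simp add: powr_mult powr_minus)
    then have "ennreal ?c * ennreal (C * bvol r powr q) = ennreal (C * \<delta> powr (- q))"
      using C by (subst ennreal_mult[symmetric]) auto
    then show ?thesis by (simp only: mult.assoc[symmetric])
  qed
  finally show ?thesis .
qed

lemma wball_pos:
  assumes r: "0 < r"
  shows "0 < wball z r"
proof (rule ccontr)
  assume "\<not> 0 < wball z r"
  then have "(\<integral>\<^sup>+x. wt x * indicator (ball z r) x \<partial>lebesgue) = 0"
    unfolding weight_of_ball by (simp add: ennreal_eq_0_iff)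
  then have "AE x in lebesgue. wt x * indicator (ball z r) x = 0"
    by (subst (asm) nn_integral_0_iff_AE) auto
  then have "AE x in lebesgue. x \<notin> ball z r"
    by eventually_elim (use w_pos in \<open>auto simp: indicator_def not_le[symmetric] ennreal_eq_0_iff split: if_splits\<close>)
  then have "emeasure lebesgue (ball z r) = 0"
    by (subst (asm) AE_iff_measurable[of "ball z r"]) auto
  then show False using bvol_pos[OF r] by (simp only: emeasure_ball_bvol[OF r]) simp
qed

lemma doubling:
  assumes r: "0 < r"
  shows "wball z (2 * r) \<le> C * (2 ^ DIM('a)) powr q * wball z r"
proof -
  have "ennreal (wball z (2 * r)) \<le> ennreal (C * (1 / 2 ^ DIM('a)) powr (- q)) * (\<integral>\<^sup>+x. wt x * indicator (ball z r) x \<partial>lebesgue)"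
    using r by (intro weight_of_large_subset) (auto simp: emeasure_ball_bvol bvol_scale simp del: emeasure_completion)
  then show ?thesis
  proof -
    have "(1 / 2 ^ DIM('a) :: real) powr (- q) = (2 ^ DIM('a)) powr q"
      by (simp add: powr_minus powr_divide)
    then show ?thesis
      using \<open>ennreal _ \<le> _\<close> C wball_nonneg[of z r] unfolding weight_of_ball
      by (simp flip: ennreal_mult)
  qed
qed

definition "shrink = 1 - 1 / (C * 2 powr q)"

text \<open>
  The annulus fills at least half of the larger ball and so carries a fixed proportion of its
  weight.
\<close>

lemma reverse_doubling:
  assumes r: "0 < r"
  shows "wball z r \<le> shrink * wball z (2 * r)"
proof -
  let ?E = "ball z (2 * r) - ball z r"
  have sub: "ball z r \<subseteq> ball z (2 * r)" using r by (intro subset_ball) simp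
  have "ennreal (wball z (2 * r)) \<le> ennreal (C * (1 / 2) powr (- q)) * (\<integral>\<^sup>+x. wt x * indicator ?E x \<partial>lebesgue)"
  proof (rule weight_of_large_subset)
    have "ennreal (bvol (2 * r)) = ennreal (bvol r) + emeasure lebesgue ?E"
      using r sub plus_emeasure[of "ball z r" lebesgue ?E]
      by (simp add: emeasure_ball_bvol Un_absorb1 del: emeasure_completion)
    moreover have "bvol r \<le> bvol (2 * r) / 2"
    proof -
      have "(2::real) ^ 1 \<le> 2 ^ DIM('a)" by (intro power_increasing) (auto simp: Suc_leI)
      then have "2 * bvol r \<le> 2 ^ DIM('a) * bvol r" using bvol_pos[OF r] by (intro mult_right_mono) auto
      then show ?thesis using r by (simp add: bvol_scale)
    qed
    ultimately have le: "ennreal (bvol (2 * r)) \<le> ennreal (bvol (2 * r) / 2) + emeasure lebesgue ?E"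
      by (metis add_right_mono ennreal_leI)
    then show "ennreal (1 / 2 * bvol (2 * r)) \<le> emeasure lebesgue ?E"
      using bvol_pos[of "2 * r"] r
      by (cases "emeasure lebesgue ?E") (auto simp flip: ennreal_plus simp del: emeasure_completion)
  qed (use r in auto)
  moreover have split: "(\<integral>\<^sup>+x. wt x * indicator (ball z r) x \<partial>lebesgue) + (\<integral>\<^sup>+x. wt x * indicator ?E x \<partial>lebesgue) = ennreal (wball z (2 * r))"
    unfolding weight_of_ball[symmetric] using sub
    by (subst nn_integral_add[symmetric]) (auto intro!: nn_integral_cong split: split_indicator)
  moreover obtain b where b: "(\<integral>\<^sup>+x. wt x * indicator ?E x \<partial>lebesgue) = ennreal b" "0 \<le> b"
    using split by (cases "(\<integral>\<^sup>+x. wt x * indicator ?E x \<partial>lebesgue)") auto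
  ultimately have "wball z (2 * r) \<le> C * 2 powr q * b" "wball z r + b = wball z (2 * r)"
    using C wball_nonneg[of z r] wball_nonneg[of z "2 * r"] unfolding weight_of_ball
    by (auto simp: powr_divide powr_minus simp flip: ennreal_mult ennreal_plus)
  moreover from this have "wball z (2 * r) / (C * 2 powr q) \<le> b"
    using C by (simp add: pos_divide_le_eq mult.commute)
  ultimately show ?thesis by (simp add: shrink_def left_diff_distrib)
qed

lemma shrink: "0 < shrink" "shrink < 1"
proof -
  have "0 < shrink * wball 0 (2 * 1)"
    using reverse_doubling[of 1 0] wball_pos[of 1 0] by simp
  then show "0 < shrink" using wball_nonneg[of 0 "2 * 1"] by (simp add: zero_less_mult_iff)
  show "shrink < 1" using C by (simp add: shrink_def)
qed

lemma iterated_reverse_doubling: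
  assumes r: "0 < r"
  shows "wball z r \<le> shrink ^ i * wball z (2 ^ i * r)"
proof (induction i)
  case (Suc i)
  note Suc
  also have "shrink ^ i * wball z (2 ^ i * r) \<le> shrink ^ i * (shrink * wball z (2 * (2 ^ i * r)))"
    using r shrink by (intro mult_left_mono reverse_doubling) auto
  finally show ?case by (simp add: ac_simps)
qed simp

text \<open>
  The \<open>A\<^sub>q\<close> constant on cubes: a cube of side \<open>l\<close> is contained in
  the ball of radius \<open>2 * DIM('a) * l\<close> about any of its points.
\<close>

definition "grid_Aq = C * (unit_ball_vol DIM('a) * (2 * DIM('a)) ^ DIM('a)) powr q"

lemma grid_Aq_pos: "0 < grid_Aq"
proof -
  have "0 < unit_ball_vol DIM('a) * (2 * DIM('a)) ^ DIM('a)"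
    using unit_ball_vol_pos[of "real DIM('a)"] by (intro mult_pos_pos zero_less_power) auto
  then have "0 < (unit_ball_vol DIM('a) * (2 * DIM('a)) ^ DIM('a)) powr q"
    by (metis less_irrefl powr_gt_zero)
  then show ?thesis unfolding grid_Aq_def by (rule mult_pos_pos[OF C])
qed

lemma muckenhoupt_grid_cubes:
  assumes L: "0 < L" and s: "s \<in> grid_shifts"
  shows "muckenhoupt_grid (grid_cube L s) L w q grid_Aq"
proof -
  interpret dyadic_grid "grid_cube L s" L by (rule dyadic_grid_grid_cube[OF L s])
  let ?D = "grid_cube L s"
  let ?R = "\<lambda>k. 2 * DIM('a) * side k"
  have R: "0 < ?R k" for k using side_pos[of k] by simp
  have sub: "?D k x \<subseteq> ball x (?R k)" for k x
  proof
    fix u assume "u \<in> ?D k x"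
    then have "norm (u - x) \<le> DIM('a) * side k" using cube_diam by (simp add: side_def)
    also have "\<dots> < ?R k" using side_pos[of k] by simp
    finally show "u \<in> ball x (?R k)" by (simp add: dist_norm norm_minus_commute)
  qed
  have mono: "(\<integral>\<^sup>+y. u y * indicator (?D k x) y \<partial>lebesgue) \<le> (\<integral>\<^sup>+y. u y * indicator (ball x (?R k)) y \<partial>lebesgue)" for u k x
    using sub[of k x] by (intro nn_integral_mono) (auto split: split_indicator)
  show ?thesis
  proof
    fix k x
    show "(\<integral>\<^sup>+y. wt y * indicator (?D k x) y \<partial>lebesgue) < top"
      using le_less_trans[OF mono w_ball] .
    show "(\<integral>\<^sup>+y. dwt y * indicator (?D k x) y \<partial>lebesgue) < top"
      using le_less_trans[OF mono dual_ball] .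
    have "(\<integral>\<^sup>+y. wt y * indicator (?D k x) y \<partial>lebesgue) * ennpow (\<integral>\<^sup>+y. dwt y * indicator (?D k x) y \<partial>lebesgue) (q - 1)
      \<le> (\<integral>\<^sup>+y. wt y * indicator (ball x (?R k)) y \<partial>lebesgue) * ennpow (\<integral>\<^sup>+y. dwt y * indicator (ball x (?R k)) y \<partial>lebesgue) (q - 1)"
      using q by (intro mult_mono ennpow_mono mono) auto
    also have "\<dots> \<le> ennreal C * ennpow (emeasure lebesgue (ball x (?R k))) q"
      by (rule Aq_ball[OF R])
    also have "emeasure lebesgue (ball x (?R k)) = ennreal (unit_ball_vol DIM('a) * (2 * DIM('a)) ^ DIM('a) * side k ^ DIM('a))"
      unfolding emeasure_ball_bvol[OF R] bvol_eq[OF R] by (simp add: power_mult_distrib mult.assoc)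
    also have "ennreal C * ennpow (ennreal (unit_ball_vol DIM('a) * (2 * DIM('a)) ^ DIM('a) * side k ^ DIM('a))) q =
        ennreal grid_Aq * ennpow (ennreal (side k ^ DIM('a))) q"
      using C side_pos[of k] by (simp add: grid_Aq_def ennpow_ennreal powr_mult flip: ennreal_mult)
    finally show "(\<integral>\<^sup>+y. wt y * indicator (?D k x) y \<partial>lebesgue) * ennpow (\<integral>\<^sup>+y. dwt y * indicator (?D k x) y \<partial>lebesgue) (q - 1)
      \<le> ennreal grid_Aq * ennpow (ennreal (side k ^ DIM('a))) q" .
  qed (use q grid_Aq_pos w_pos in auto)
qed

text \<open>
  Choice of the parameters of the good-lambda inequality, first \<open>a\<close> close to
  \<open>1\<close>, then \<open>e\<close> small, followed by monotone convergence in the truncation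
  level.
\<close>

lemma square_sum_uniform_bound:
  assumes \<gamma>: "0 < \<gamma>" "\<gamma> \<le> 1"
  shows "\<exists>K0\<ge>0. \<forall>L s f y R. 0 < L \<longrightarrow> s \<in> grid_shifts \<longrightarrow> integrable lebesgue f \<longrightarrow> (\<forall>x. x \<notin> ball y R \<longrightarrow> f x = 0) \<longrightarrow>
    (\<integral>\<^sup>+x. ennpow (SUP K. oscillation_grid.square_sum (grid_cube L s) L \<gamma> K f x) (q / 2) * wt x \<partial>lebesgue) \<le>
    ennreal K0 * (\<integral>\<^sup>+x. ennpow (ennreal (norm (f x))) q * wt x \<partial>lebesgue)"
proof -
  define \<theta>0 where "\<theta>0 = 1 - 1 / (grid_Aq * 2 powr q)"
  have \<theta>01: "\<theta>0 < 1" using grid_Aq_pos by (simp add: \<theta>0_def)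
  obtain a :: real where a: "1 < a" "\<theta>0 * a powr q < 1"
  proof (cases "\<theta>0 \<le> 0")
    case True
    then have "\<theta>0 * 2 powr q \<le> 0" by (intro mult_nonpos_nonneg) auto
    then show ?thesis by (intro that[of 2]) auto
  next
    case False
    define b where "b = (1 + 1 / \<theta>0) / 2"
    have b: "1 < b" "\<theta>0 * b < 1" using False \<theta>01 by (auto simp: b_def field_simps)
    show ?thesis
    proof (rule that[of "b powr (1 / q)"])
      show "1 < b powr (1 / q)" using b q by (intro gr_one_powr) auto
      show "\<theta>0 * (b powr (1 / q)) powr q < 1" using b q by (simp add: powr_powr)
    qed
  qed
  define cz where "cz = oscillation_grid.cz_const TYPE('a) \<gamma>"
  obtain s0 :: "'a \<Rightarrow> real" where s0: "s0 \<in> grid_shifts"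
    using ball_subset_grid_cube[of 1 0 0 0] by auto
  have cz: "0 < cz"
    unfolding cz_def using dyadic_grid_grid_cube[OF zero_less_one s0] \<gamma>
    by (intro oscillation_grid.cz_const_pos[where D = "grid_cube 1 s0" and L = 1])
      (simp add: oscillation_grid_def oscillation_grid_axioms_def)
  define M where "M = 1 / (a\<^sup>2 - 1) + 1 / sqrt (a\<^sup>2 - 1)"
  have a2: "1 < a\<^sup>2" using a by (simp add: one_less_power)
  have M: "0 < M" using a2 by (simp add: M_def add_pos_pos)
  define e where "e = min 1 (1 / (2 * cz * M))"
  have e: "0 < e" "e \<le> 1" "cz * (e * M) \<le> 1 / 2"
  proof -
    show "0 < e" "e \<le> 1" using cz M by (auto simp: e_def)
    have "e \<le> 1 / (2 * cz * M)" by (simp add: e_def)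
    then show "cz * (e * M) \<le> 1 / 2" using cz M by (simp add: field_simps)
  qed
  have small: "cz * (e\<^sup>2 / (a\<^sup>2 - 1) + e / sqrt (a\<^sup>2 - 1)) \<le> 1 / 2"
  proof -
    have "e\<^sup>2 \<le> e" using e by (simp add: power2_eq_square mult_left_le)
    then have "e\<^sup>2 / (a\<^sup>2 - 1) + e / sqrt (a\<^sup>2 - 1) \<le> e * M"
      using a2 by (simp add: M_def distrib_left divide_right_mono)
    then have "cz * (e\<^sup>2 / (a\<^sup>2 - 1) + e / sqrt (a\<^sup>2 - 1)) \<le> cz * (e * M)"
      using cz by (intro mult_left_mono) auto
    then show ?thesis using e(3) by linarith
  qed
  define K0 where "K0 = max 0 (e powr (- q) / (a powr (- q) - \<theta>0) * muckenhoupt_grid.max_const q grid_Aq)"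
  show ?thesis
  proof (intro exI[of _ K0] conjI allI impI)
    show "0 \<le> K0" by (simp add: K0_def)
    fix L :: real and s :: "'a \<Rightarrow> real" and f :: "'a \<Rightarrow> complex" and y :: 'a and R :: real
    assume L: "0 < L" and s: "s \<in> grid_shifts" and f: "integrable lebesgue f" and supp: "\<forall>x. x \<notin> ball y R \<longrightarrow> f x = 0"
    interpret muckenhoupt_grid "grid_cube L s" L w q grid_Aq by (rule muckenhoupt_grid_cubes[OF L s])
    interpret weighted_oscillation_grid "grid_cube L s" L w q grid_Aq \<gamma>
      using \<gamma> by unfold_locales auto
    have \<theta>_eq: "weighted_oscillation_grid.\<theta> q grid_Aq = \<theta>0"
      by (simp only: \<theta>0_def weighted_oscillation_grid.\<theta>_def[OF weighted_oscillation_grid_axioms])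
    have U: "f v = 0" if "x \<notin> ball y (R + real DIM('a) * L)" "v \<in> grid_cube L s 0 x" for x v
    proof -
      have "norm (v - x) \<le> real DIM('a) * L" using cube_diam[OF that(2)] by simp
      moreover have "R + real DIM('a) * L \<le> norm (x - y)" using that(1) by (simp add: dist_norm norm_minus_commute)
      moreover have "norm (x - y) \<le> norm (v - x) + norm (v - y)"
        using norm_triangle_ineq4[of "v - y" "v - x"] by simp
      ultimately have "R \<le> norm (v - y)" by simp
      then show ?thesis using supp by (simp add: dist_norm norm_minus_commute)
    qed
    have "(\<integral>\<^sup>+x. ennpow (SUP K. square_sum K f x) (q / 2) * wt x \<partial>lebesgue) =
      (\<integral>\<^sup>+x. (SUP K. ennpow (square_sum K f x) (q / 2) * wt x) \<partial>lebesgue)"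
      using q by (simp add: ennpow_SUP SUP_mult_right_ennreal)
    also have "\<dots> = (SUP K. \<integral>\<^sup>+x. ennpow (square_sum K f x) (q / 2) * wt x \<partial>lebesgue)"
    proof (rule nn_integral_monotone_convergence_SUP)
      show "incseq (\<lambda>K x. ennpow (square_sum K f x) (q / 2) * wt x)"
        using q unfolding incseq_def le_fun_def square_sum_def
        by (auto intro!: mult_right_mono ennpow_mono sum_mono2)
    qed measurable
    also have "\<dots> \<le> ennreal K0 * (\<integral>\<^sup>+x. ennpow (ennreal (norm (f x))) q * wt x \<partial>lebesgue)"
    proof (rule SUP_least)
      fix K
      have "(\<integral>\<^sup>+x. ennpow (square_sum K f x) (q / 2) * wt x \<partial>lebesgue) \<le>
        ennreal (e powr (- q) / (a powr (- q) - weighted_oscillation_grid.\<theta> q grid_Aq) * max_const) *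
          (\<integral>\<^sup>+x. ennpow (ennreal (norm (f x))) q * wt x \<partial>lebesgue)"
      proof (rule square_sum_bounded[OF f])
        show "ball y (R + real DIM('a) * L) \<in> sets lebesgue" by measurable
        show "weighted_oscillation_grid.\<theta> q grid_Aq * a powr q < 1" using a(2) by (simp only: \<theta>_eq)
        show "cz_const * (e\<^sup>2 / (a\<^sup>2 - 1) + e / sqrt (a\<^sup>2 - 1)) \<le> 1 / 2" using small by (simp add: cz_def)
      qed (use U a(1) e(1) w_ball in auto)
      also have "\<dots> \<le> ennreal K0 * (\<integral>\<^sup>+x. ennpow (ennreal (norm (f x))) q * wt x \<partial>lebesgue)"
        by (intro mult_right_mono ennreal_leI) (auto simp: K0_def \<theta>_eq)
      finally show "(\<integral>\<^sup>+x. ennpow (square_sum K f x) (q / 2) * wt x \<partial>lebesgue) \<le> \<dots>" .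
    qed
    finally show "(\<integral>\<^sup>+x. ennpow (SUP K. square_sum K f x) (q / 2) * wt x \<partial>lebesgue) \<le>
      ennreal K0 * (\<integral>\<^sup>+x. ennpow (ennreal (norm (f x))) q * wt x \<partial>lebesgue)" .
  qed
qed

end

section \<open>The local estimate\<close>

lemma ennreal_suminf_squares_le: "(\<Sum>i. (f i)\<^sup>2) \<le> (\<Sum>i. f i :: ennreal)\<^sup>2"
  unfolding suminf_eq_SUP[of "\<lambda>i. (f i)\<^sup>2"]
proof (rule SUP_least)
  fix n
  have "(\<Sum>i<n. (f i)\<^sup>2) \<le> (\<Sum>i<n. f i)\<^sup>2" by (rule ennreal_sum_squares_le) simp
  also have "\<dots> \<le> (\<Sum>i. f i)\<^sup>2" by (intro power_mono_ennreal sum_le_suminf summableI) auto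
  finally show "(\<Sum>i<n. (f i)\<^sup>2) \<le> (\<Sum>i. f i)\<^sup>2" .
qed

lemma suminf_ennreal_geometric:
  assumes "0 \<le> c" "c < 1"
  shows "(\<Sum>i. ennreal (c ^ i)) = ennreal (1 / (1 - c))"
  using assms by (intro suminf_ennreal_eq geometric_sums) auto

lemma power_powr:
  assumes "0 < (x::real)"
  shows "(x ^ n) powr a = (x powr a) ^ n"
proof -
  have "(x ^ n) powr a = x powr (real n * a)"
    using assms by (simp add: powr_realpow[symmetric] powr_powr)
  also have "\<dots> = (x powr a) ^ n"
    using assms by (simp add: powr_realpow[symmetric] powr_powr mult.commute)
  finally show ?thesis .
qed

lemma powr_less_1: "0 < x \<Longrightarrow> x < 1 \<Longrightarrow> 0 < a \<Longrightarrow> x powr a < (1::real)"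
  using powr_less_mono2[of a x 1] by simp

lemma weighted_norm_ball:
  "0 < q \<Longrightarrow> weighted_norm w q (\<lambda>x. g x * indicator (ball y r) x) =
    ennpow (\<integral>\<^sup>+x. ennpow (g x) q * ennreal (w x) * indicator (ball y r) x \<partial>lebesgue) (1 / q)"
  unfolding weighted_norm_def
  by (intro arg_cong2[where f = ennpow] nn_integral_cong refl) (auto split: split_indicator)

context muckenhoupt_weight
begin

text \<open>
  The averages that bound the part of the square function coming from heights above \<open>r / (12 *
  DIM('a))\<close>.
\<close>

definition tail_average :: "('a \<Rightarrow> complex) \<Rightarrow> 'a \<Rightarrow> real \<Rightarrow> nat \<Rightarrow> ennreal" where
  "tail_average f y r i = ennreal (3 / (2 ^ i * (r / DIM('a)) / 12) ^ DIM('a)) *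
      (\<integral>\<^sup>+u. ennreal (norm (f u)) * indicator (ball y (2 ^ Suc i * r)) u \<partial>lebesgue)"

abbreviation fnorm :: "('a \<Rightarrow> complex) \<Rightarrow> 'a \<Rightarrow> real \<Rightarrow> ennreal" where
  "fnorm f y r \<equiv> weighted_norm w q (\<lambda>x. ennreal (norm (f x)) * indicator (ball y r) x)"

abbreviation snorm :: "real \<Rightarrow> ('a \<Rightarrow> complex) \<Rightarrow> 'a \<Rightarrow> real \<Rightarrow> ennreal" where
  "snorm \<gamma> f y r \<equiv> weighted_norm w q (\<lambda>x. intrinsic_square \<gamma> f x * indicator (ball y r) x)"

text \<open>
  On \<open>ball y r\<close> the discretized square function is split into the square sums of the
  grids, which are bounded on weighted \<open>L\<^sup>q\<close>, and the tail, which is constant in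
  \<open>x\<close>.
\<close>

lemma local_square_bound:
  assumes \<gamma>: "0 < \<gamma>" "\<gamma> \<le> 1"
  shows "\<exists>K\<ge>0. \<forall>f y r. 0 < r \<longrightarrow> f \<in> borel_measurable lebesgue \<longrightarrow> (\<forall>R. set_integrable lebesgue (ball 0 R) f) \<longrightarrow>
    snorm \<gamma> f y r \<le> ennreal K * (fnorm f y (2 * r) + (\<Sum>i. tail_average f y r i) * ennreal (wball y r powr (1 / q)))"
proof -
  obtain K0 where K0: "0 \<le> K0" "\<And>L s f y R. 0 < L \<Longrightarrow> s \<in> grid_shifts \<Longrightarrow> integrable lebesgue f \<Longrightarrow> (\<And>x. x \<notin> ball y R \<Longrightarrow> f x = 0) \<Longrightarrow>
    (\<integral>\<^sup>+x. ennpow (SUP K. oscillation_grid.square_sum (grid_cube L s) L \<gamma> K f x) (q / 2) * wt x \<partial>lebesgue) \<le>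
    ennreal K0 * (\<integral>\<^sup>+x. ennpow (ennreal (norm (f x))) q * wt x \<partial>lebesgue)"
    using square_sum_uniform_bound[OF \<gamma>] by blast
  define c1 where "c1 = shell_const TYPE('a) * 24 ^ (2 * Suc DIM('a))"
  define c2 where "c2 = shell_const TYPE('a)"
  have c: "0 \<le> c1" "0 \<le> c2" by (auto simp: c1_def c2_def shell_const_def)
  define m where "m = real (card (grid_shifts :: ('a \<Rightarrow> real) set))"
  define k1 where "k1 = 2 powr (q / 2) * (c1 powr (q / 2) * m powr (q / 2))"
  define k2 where "k2 = 2 powr (q / 2) * c2 powr (q / 2)"
  define K where "K = 2 powr (1 / q) * max ((k1 * (m * K0)) powr (1 / q)) (k2 powr (1 / q))"
  have k: "0 \<le> k1" "0 \<le> k2" by (auto simp: k1_def k2_def)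
  have m0: "0 \<le> m" by (simp add: m_def)
  show ?thesis
  proof (intro exI[of _ K] conjI allI impI)
    show "0 \<le> K" by (simp add: K_def le_max_iff_disj)
    fix f :: "'a \<Rightarrow> complex" and y :: 'a and r :: real
    assume r: "0 < r" and f_meas [measurable]: "f \<in> borel_measurable lebesgue"
      and f: "\<forall>R. set_integrable lebesgue (ball 0 R) f"
    let ?B = "ball y r"
    define L where "L = r / DIM('a)"
    have L: "0 < L" using r by (simp add: L_def)
    define f' where "f' u = (if u \<in> ball y (2 * r) then f u else 0)" for u
    have f'_int: "integrable lebesgue f'"
    proof -
      have "set_integrable lebesgue (ball y (2 * r)) f"
      proof (rule set_integrable_subset[OF f[rule_format, of "norm y + 2 * r"]])
        show "ball y (2 * r) \<subseteq> ball 0 (norm y + 2 * r)"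
        proof
          fix x assume "x \<in> ball y (2 * r)"
          then show "x \<in> ball 0 (norm y + 2 * r)"
            using norm_triangle_ineq[of y "x - y"] by (simp add: dist_norm norm_minus_commute)
        qed
      qed auto
      then show ?thesis
        unfolding set_integrable_def
        by (rule Bochner_Integration.integrable_cong[THEN iffD1, rotated -1]) (auto simp: indicator_def f'_def)
    qed
    define F where "F s x = (SUP K. oscillation_grid.square_sum (grid_cube L s) L \<gamma> K f' x)" for s x
    define T where "T = (\<Sum>i. (tail_average f y r i)\<^sup>2)"
    have F_meas: "F s \<in> borel_measurable lebesgue" if s: "s \<in> grid_shifts" for s
    proof -
      interpret oscillation_grid "grid_cube L s" L \<gamma>
        using dyadic_grid_grid_cube[OF L s] \<gamma> by (simp add: oscillation_grid_def oscillation_grid_axioms_def)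
      show ?thesis unfolding F_def by measurable
    qed
    have pt: "ennpow (intrinsic_square \<gamma> f x) q \<le> ennreal k1 * (\<Sum>s\<in>grid_shifts. ennpow (F s x) (q / 2)) + ennreal k2 * ennpow T (q / 2)"
      if x: "x \<in> ?B" for x
    proof -
      let ?S = "\<Sum>s\<in>grid_shifts. F s x"
      have "(\<integral>\<^sup>+p. area_density \<gamma> f p * indicator (cone x) p \<partial>lborel) \<le> ennreal c1 * ?S + ennreal c2 * T"
        unfolding c1_def c2_def F_def T_def tail_average_def L_def f'_def[abs_def]
        using f by (intro area_integral_le \<gamma> f_meas r x) blast
      then have "ennpow (\<integral>\<^sup>+p. area_density \<gamma> f p * indicator (cone x) p \<partial>lborel) (q / 2) \<le> ennpow (ennreal c1 * ?S + ennreal c2 * T) (q / 2)"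
        using q by (intro ennpow_mono) auto
      also have "\<dots> \<le> ennreal (2 powr (q / 2)) * (ennpow (ennreal c1 * ?S) (q / 2) + ennpow (ennreal c2 * T) (q / 2))"
        using q by (intro ennpow_add_le) auto
      also have "ennpow (ennreal c1 * ?S) (q / 2) = ennreal (c1 powr (q / 2)) * ennpow ?S (q / 2)"
        using q c by (simp add: ennpow_mult ennpow_ennreal)
      also have "ennpow (ennreal c2 * T) (q / 2) = ennreal (c2 powr (q / 2)) * ennpow T (q / 2)"
        using q c by (simp add: ennpow_mult ennpow_ennreal)
      also have "ennpow ?S (q / 2) \<le> ennreal (m powr (q / 2)) * (\<Sum>s\<in>grid_shifts. ennpow (F s x) (q / 2))"
        unfolding m_def using q by (intro ennpow_sum_le finite_grid_shifts) auto
      finally have "ennpow (\<integral>\<^sup>+p. area_density \<gamma> f p * indicator (cone x) p \<partial>lborel) (q / 2) \<le>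
        ennreal (2 powr (q / 2)) * (ennreal (c1 powr (q / 2)) * (ennreal (m powr (q / 2)) * (\<Sum>s\<in>grid_shifts. ennpow (F s x) (q / 2))) +
          ennreal (c2 powr (q / 2)) * ennpow T (q / 2))"
        by (simp add: mult_left_mono add_right_mono)
      also have "\<dots> = ennreal k1 * (\<Sum>s\<in>grid_shifts. ennpow (F s x) (q / 2)) + ennreal k2 * ennpow T (q / 2)"
        by (simp add: k1_def k2_def ennreal_mult distrib_left mult.assoc)
      finally show ?thesis
        by (simp add: intrinsic_square_eq ennpow_ennpow)
    qed
    have "(\<integral>\<^sup>+x. ennpow (intrinsic_square \<gamma> f x) q * wt x * indicator ?B x \<partial>lebesgue) \<le>
      (\<integral>\<^sup>+x. ennreal k1 * (\<Sum>s\<in>grid_shifts. ennpow (F s x) (q / 2) * wt x) + (ennreal k2 * ennpow T (q / 2)) * (wt x * indicator ?B x) \<partial>lebesgue)"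
    proof (intro nn_integral_mono)
      fix x
      show "ennpow (intrinsic_square \<gamma> f x) q * wt x * indicator ?B x \<le>
        ennreal k1 * (\<Sum>s\<in>grid_shifts. ennpow (F s x) (q / 2) * wt x) + (ennreal k2 * ennpow T (q / 2)) * (wt x * indicator ?B x)"
      proof (cases "x \<in> ?B")
        case True
        then show ?thesis
          using mult_right_mono[OF pt[OF True], of "wt x"]
          by (simp add: distrib_right sum_distrib_right[symmetric] mult.assoc)
      qed simp
    qed
    also have "\<dots> = ennreal k1 * (\<Sum>s\<in>grid_shifts. \<integral>\<^sup>+x. ennpow (F s x) (q / 2) * wt x \<partial>lebesgue) +
        (ennreal k2 * ennpow T (q / 2)) * ennreal (wball y r)"
      using F_meas by (simp add: nn_integral_add nn_integral_cmult nn_integral_sum weight_of_ball)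
    also have "(\<Sum>s\<in>grid_shifts. \<integral>\<^sup>+x. ennpow (F s x) (q / 2) * wt x \<partial>lebesgue) \<le>
        (\<Sum>s\<in>(grid_shifts :: ('a \<Rightarrow> real) set). ennreal K0 * (\<integral>\<^sup>+x. ennpow (ennreal (norm (f' x))) q * wt x \<partial>lebesgue))"
      unfolding F_def by (intro sum_mono K0(2)[OF L _ f'_int, of _ y "2 * r"]) (auto simp: f'_def)
    also have "\<dots> = ennreal (m * K0) * (\<integral>\<^sup>+x. ennpow (ennreal (norm (f' x))) q * wt x \<partial>lebesgue)"
      using K0(1) by (simp add: m_def ennreal_mult ennreal_of_nat_eq_real_of_nat mult.assoc)
    also have "(\<integral>\<^sup>+x. ennpow (ennreal (norm (f' x))) q * wt x \<partial>lebesgue) =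
        (\<integral>\<^sup>+x. ennpow (ennreal (norm (f x))) q * wt x * indicator (ball y (2 * r)) x \<partial>lebesgue)"
      by (intro nn_integral_cong) (auto simp: f'_def split: split_indicator)
    finally have main: "(\<integral>\<^sup>+x. ennpow (intrinsic_square \<gamma> f x) q * wt x * indicator ?B x \<partial>lebesgue) \<le>
      ennreal (k1 * (m * K0)) * (\<integral>\<^sup>+x. ennpow (ennreal (norm (f x))) q * wt x * indicator (ball y (2 * r)) x \<partial>lebesgue) +
      ennreal k2 * (ennpow T (q / 2) * ennreal (wball y r))"
      using k m0 K0(1) by (simp add: ennreal_mult mult.assoc mult_left_mono add_right_mono)
    let ?X = "\<integral>\<^sup>+x. ennpow (ennreal (norm (f x))) q * wt x * indicator (ball y (2 * r)) x \<partial>lebesgue"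
    have "snorm \<gamma> f y r = ennpow (\<integral>\<^sup>+x. ennpow (intrinsic_square \<gamma> f x) q * wt x * indicator ?B x \<partial>lebesgue) (1 / q)"
      using q by (intro weighted_norm_ball) auto
    also have "\<dots> \<le> ennpow (ennreal (k1 * (m * K0)) * ?X + ennreal k2 * (ennpow T (q / 2) * ennreal (wball y r))) (1 / q)"
      using q main by (intro ennpow_mono) auto
    also have "\<dots> \<le> ennreal (2 powr (1 / q)) * (ennpow (ennreal (k1 * (m * K0)) * ?X) (1 / q) + ennpow (ennreal k2 * (ennpow T (q / 2) * ennreal (wball y r))) (1 / q))"
      using q by (intro ennpow_add_le) auto
    also have "ennpow (ennreal (k1 * (m * K0)) * ?X) (1 / q) = ennreal ((k1 * (m * K0)) powr (1 / q)) * fnorm f y (2 * r)"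
      using q k m0 K0(1) by (simp add: ennpow_mult ennpow_ennreal weighted_norm_ball)
    also have "ennpow (ennreal k2 * (ennpow T (q / 2) * ennreal (wball y r))) (1 / q) =
        ennreal (k2 powr (1 / q)) * (ennpow T (1 / 2) * ennreal (wball y r powr (1 / q)))"
      using q k wball_nonneg by (simp add: ennpow_mult ennpow_ennreal ennpow_ennpow)
    also have "ennreal (2 powr (1 / q)) * (ennreal ((k1 * (m * K0)) powr (1 / q)) * fnorm f y (2 * r) +
        ennreal (k2 powr (1 / q)) * (ennpow T (1 / 2) * ennreal (wball y r powr (1 / q)))) \<le>
      ennreal (2 powr (1 / q)) * (ennreal (max ((k1 * (m * K0)) powr (1 / q)) (k2 powr (1 / q))) * fnorm f y (2 * r) +
        ennreal (max ((k1 * (m * K0)) powr (1 / q)) (k2 powr (1 / q))) * ((\<Sum>i. tail_average f y r i) * ennreal (wball y r powr (1 / q))))"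
    proof (intro mult_left_mono add_mono mult_mono ennreal_leI)
      have "ennpow T (1 / 2) \<le> ennpow ((\<Sum>i. tail_average f y r i)\<^sup>2) (1 / 2)"
        unfolding T_def by (intro ennpow_mono ennreal_suminf_squares_le) auto
      then show "ennpow T (1 / 2) \<le> (\<Sum>i. tail_average f y r i)"
        by (simp add: ennpow_ennpow flip: ennpow_two)
    qed auto
    also have "\<dots> = ennreal K * (fnorm f y (2 * r) + (\<Sum>i. tail_average f y r i) * ennreal (wball y r powr (1 / q)))"
      unfolding K_def by (subst ennreal_mult) (auto simp: distrib_left mult.assoc le_max_iff_disj)
    finally show "snorm \<gamma> f y r \<le> ennreal K * (fnorm f y (2 * r) + (\<Sum>i. tail_average f y r i) * ennreal (wball y r powr (1 / q)))" .
  qed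
qed

text \<open>
  Hoelder's inequality and the \<open>A\<^sub>q\<close> condition replace an average by a weighted
  norm.
\<close>

lemma tail_average_le:
  assumes r: "0 < r" and f [measurable]: "f \<in> borel_measurable lebesgue"
  shows "tail_average f y r i \<le> ennreal (3 * C powr (1 / q) * unit_ball_vol DIM('a) * (24 * DIM('a)) ^ DIM('a)) *
    (ennreal (wball y (2 ^ Suc i * r) powr (- 1 / q)) * fnorm f y (2 ^ Suc i * r))"
proof -
  let ?R = "2 ^ Suc i * r"
  have R: "0 < ?R" using r by simp
  let ?I = "\<integral>\<^sup>+u. ennreal (norm (f u)) * indicator (ball y ?R) u \<partial>lebesgue"
  let ?X = "\<integral>\<^sup>+x. ennpow (ennreal (norm (f x))) q * wt x * indicator (ball y ?R) x \<partial>lebesgue"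
  define v where "v = wball y ?R"
  have v: "0 < v" unfolding v_def by (rule wball_pos[OF R])
  have "ennpow (ennpow ?I q * ennreal v) (1 / q) \<le> ennpow (ennreal (C * bvol ?R powr q) * ?X) (1 / q)"
    unfolding v_def using q by (intro ennpow_mono weighted_average_le R) auto
  then have le: "?I * ennreal (v powr (1 / q)) \<le> ennreal (C powr (1 / q) * bvol ?R) * fnorm f y ?R"
    using q C v bvol_pos[OF R] by (simp add: ennpow_mult ennpow_ennpow ennpow_ennreal weighted_norm_ball powr_mult powr_powr)
  have "?I = (?I * ennreal (v powr (1 / q))) * ennreal (v powr (- 1 / q))"
    using v by (simp add: mult.assoc flip: ennreal_mult powr_add)
  also have "\<dots> \<le> (ennreal (C powr (1 / q) * bvol ?R) * fnorm f y ?R) * ennreal (v powr (- 1 / q))"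
    using le by (rule mult_right_mono) simp
  finally have "tail_average f y r i \<le> ennreal (3 / (2 ^ i * (r / DIM('a)) / 12) ^ DIM('a)) *
    ((ennreal (C powr (1 / q) * bvol ?R) * fnorm f y ?R) * ennreal (v powr (- 1 / q)))"
    unfolding tail_average_def by (rule mult_left_mono) simp
  also have "\<dots> = (ennreal (3 / (2 ^ i * (r / DIM('a)) / 12) ^ DIM('a)) * ennreal (C powr (1 / q) * bvol ?R)) *
      (ennreal (v powr (- 1 / q)) * fnorm f y ?R)"
    by (simp only: ac_simps)
  also have "ennreal (3 / (2 ^ i * (r / DIM('a)) / 12) ^ DIM('a)) * ennreal (C powr (1 / q) * bvol ?R) =
      ennreal (3 * C powr (1 / q) * unit_ball_vol DIM('a) * (24 * DIM('a)) ^ DIM('a))"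
  proof -
    have "?R = (24 * DIM('a)) * (2 ^ i * (r / DIM('a)) / 12)" by simp
    then have "?R ^ DIM('a) = (24 * DIM('a)) ^ DIM('a) * (2 ^ i * (r / DIM('a)) / 12) ^ DIM('a)"
      by (metis of_nat_mult of_nat_numeral of_nat_power power_mult_distrib)
    moreover have "(2 ^ i * (r / DIM('a)) / 12) ^ DIM('a) \<noteq> 0" using r by simp
    ultimately have "3 / (2 ^ i * (r / DIM('a)) / 12) ^ DIM('a) * (C powr (1 / q) * bvol ?R) =
      3 * C powr (1 / q) * unit_ball_vol DIM('a) * (24 * DIM('a)) ^ DIM('a)"
      unfolding bvol_eq[OF R] by simp
    then show ?thesis
      using r C bvol_pos[OF R] by (subst ennreal_mult[symmetric]) auto
  qed
  finally show ?thesis unfolding v_def .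
qed

text \<open>
  The nonpositive exponent \<open>e\<close> is the one of the amalgam norm. Doubling compares the
  weights of \<open>ball y r\<close> and \<open>ball y (2 * r)\<close> for the main term. In the
  tail, reverse doubling turns the positive exponent \<open>e + 1 / q\<close>, which equals \<open>1
  / \<alpha> - 1 / p\<close>, into geometric decay; this is where \<open>\<alpha> < p\<close> is
  used.
\<close>

lemma amalgam_local_bound:
  assumes \<gamma>: "0 < \<gamma>" "\<gamma> \<le> 1" and e: "e \<le> 0" "0 < e + 1 / q"
  shows "\<exists>K\<ge>0. \<forall>f y r. 0 < r \<longrightarrow> f \<in> borel_measurable lebesgue \<longrightarrow> (\<forall>R. set_integrable lebesgue (ball 0 R) f) \<longrightarrow>
    ennreal (wball y r powr e) * snorm \<gamma> f y r \<le> ennreal K *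
      (\<Sum>i. ennreal ((shrink powr (e + 1 / q)) ^ i) * (ennreal (wball y (2 ^ Suc i * r) powr e) * fnorm f y (2 ^ Suc i * r)))"
proof -
  obtain K0 where K0: "0 \<le> K0" "\<And>f y r. 0 < r \<Longrightarrow> f \<in> borel_measurable lebesgue \<Longrightarrow> (\<forall>R. set_integrable lebesgue (ball 0 R) f) \<Longrightarrow>
    snorm \<gamma> f y r \<le> ennreal K0 * (fnorm f y (2 * r) + (\<Sum>i. tail_average f y r i) * ennreal (wball y r powr (1 / q)))"
    using local_square_bound[OF \<gamma>] by blast
  define \<rho> where "\<rho> = shrink powr (e + 1 / q)"
  have \<rho>: "0 < \<rho>" "\<rho> < 1"
    using shrink e by (auto simp: \<rho>_def intro: powr_less_1)
  define d where "d = (C * (2 ^ DIM('a)) powr q) powr (- e)"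
  define c where "c = 3 * C powr (1 / q) * unit_ball_vol DIM('a) * (24 * DIM('a)) ^ DIM('a)"
  have c: "0 \<le> c" by (simp add: c_def)
  have d: "0 \<le> d" by (simp add: d_def)
  show ?thesis
    unfolding \<rho>_def[symmetric]
  proof (intro exI[of _ "K0 * (d + c)"] conjI allI impI)
    show "0 \<le> K0 * (d + c)" using K0(1) c d by simp
    fix f :: "'a \<Rightarrow> complex" and y :: 'a and r :: real
    assume r: "0 < r" and f_meas: "f \<in> borel_measurable lebesgue" and f: "\<forall>R. set_integrable lebesgue (ball 0 R) f"
    define h where "h i = ennreal (wball y (2 ^ Suc i * r) powr e) * fnorm f y (2 ^ Suc i * r)" for i
    let ?S = "\<Sum>i. ennreal (\<rho> ^ i) * h i"
    have v: "0 < wball y r" by (rule wball_pos[OF r])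
    have near: "ennreal (wball y r powr e) * fnorm f y (2 * r) \<le> ennreal d * ?S"
    proof -
      have v2: "0 < wball y (2 * r)" using r by (intro wball_pos) auto
      have "wball y (2 * r) / (C * (2 ^ DIM('a)) powr q) \<le> wball y r"
        using doubling[OF r, of y] C by (simp add: pos_divide_le_eq mult.commute)
      then have "wball y r powr e \<le> (wball y (2 * r) / (C * (2 ^ DIM('a)) powr q)) powr e"
        using e(1) v2 C by (intro powr_mono2') auto
      also have "\<dots> = d * wball y (2 * r) powr e"
        unfolding powr_divide d_def powr_minus by (simp add: divide_inverse mult.commute)
      finally have "ennreal (wball y r powr e) * fnorm f y (2 * r) \<le> ennreal (d * wball y (2 * r) powr e) * fnorm f y (2 * r)"
        by (intro mult_right_mono ennreal_leI) auto
      also have "\<dots> = ennreal d * (ennreal (\<rho> ^ 0) * h 0)"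
        using d by (simp add: h_def ennreal_mult mult.assoc)
      also have "\<dots> \<le> ennreal d * ?S"
        by (intro mult_left_mono suminf_ennreal_upper) auto
      finally show ?thesis .
    qed
    have far: "ennreal (wball y r powr e) * ((\<Sum>i. tail_average f y r i) * ennreal (wball y r powr (1 / q))) \<le> ennreal c * ?S"
    proof -
      have "ennreal (wball y r powr e) * ((\<Sum>i. tail_average f y r i) * ennreal (wball y r powr (1 / q))) =
        (\<Sum>i. ennreal (wball y r powr (e + 1 / q)) * tail_average f y r i)"
        using v by (simp add: powr_add ennreal_mult ac_simps)
      also have "\<dots> \<le> (\<Sum>i. ennreal c * (ennreal (\<rho> ^ i) * h i))"
      proof (intro suminf_le summableI)
        fix i
        let ?v = "wball y (2 ^ Suc i * r)"
        have vi: "0 < ?v" using r by (intro wball_pos) auto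
        have "wball y r powr (e + 1 / q) \<le> (shrink ^ Suc i * ?v) powr (e + 1 / q)"
          using iterated_reverse_doubling[OF r, of y "Suc i"] e(2) v by (intro powr_mono2) auto
        also have "\<dots> = \<rho> ^ Suc i * ?v powr (e + 1 / q)"
          by (simp only: \<rho>_def powr_mult power_powr[OF shrink(1)])
        also have "\<dots> \<le> \<rho> ^ i * ?v powr (e + 1 / q)"
          using \<rho> by (intro mult_right_mono power_decreasing) auto
        finally have le: "wball y r powr (e + 1 / q) \<le> \<rho> ^ i * ?v powr (e + 1 / q)" .
        have "ennreal (wball y r powr (e + 1 / q)) * tail_average f y r i \<le>
          ennreal (\<rho> ^ i * ?v powr (e + 1 / q)) * (ennreal c * (ennreal (?v powr (- 1 / q)) * fnorm f y (2 ^ Suc i * r)))"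
          unfolding c_def by (intro mult_mono ennreal_leI le tail_average_le r f_meas) auto
        also have "\<dots> = ennreal c * (ennreal (\<rho> ^ i) * (ennreal (?v powr (e + 1 / q)) * ennreal (?v powr (- 1 / q)) * fnorm f y (2 ^ Suc i * r)))"
          using \<rho> by (subst ennreal_mult) (auto simp: ac_simps)
        also have "ennreal (?v powr (e + 1 / q)) * ennreal (?v powr (- 1 / q)) = ennreal (?v powr e)"
          using vi by (simp flip: ennreal_mult powr_add)
        finally show "ennreal (wball y r powr (e + 1 / q)) * tail_average f y r i \<le> ennreal c * (ennreal (\<rho> ^ i) * h i)"
          by (simp only: h_def)
      qed
      also have "\<dots> = ennreal c * ?S" by simp
      finally show ?thesis .
    qed
    have "ennreal (wball y r powr e) * snorm \<gamma> f y r \<le>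
      ennreal (wball y r powr e) * (ennreal K0 * (fnorm f y (2 * r) + (\<Sum>i. tail_average f y r i) * ennreal (wball y r powr (1 / q))))"
      by (intro mult_left_mono K0(2) r f_meas f) auto
    also have "\<dots> = ennreal K0 * (ennreal (wball y r powr e) * fnorm f y (2 * r) +
        ennreal (wball y r powr e) * ((\<Sum>i. tail_average f y r i) * ennreal (wball y r powr (1 / q))))"
      by (simp only: distrib_left mult.left_commute)
    also have "\<dots> \<le> ennreal K0 * (ennreal d * ?S + ennreal c * ?S)"
      by (intro mult_left_mono add_mono near far) auto
    also have "\<dots> = ennreal (K0 * (d + c)) * ?S"
      using K0(1) c d by (simp add: ennreal_mult distrib_right mult.assoc)
    finally show "ennreal (wball y r powr e) * snorm \<gamma> f y r \<le> ennreal (K0 * (d + c)) *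
      (\<Sum>i. ennreal (\<rho> ^ i) * (ennreal (wball y (2 ^ Suc i * r) powr e) * fnorm f y (2 ^ Suc i * r)))"
      unfolding h_def .
  qed
qed

end

section \<open>Amalgam norms\<close>

text \<open>
  The triangle inequality for a series with geometric weights. For finite \<open>p\<close>, write
  \<open>\<rho> = s\<^sup>2\<close>; one factor \<open>s ^ i\<close> makes the sum comparable to the
  supremum of \<open>s ^ i * h i\<close>, and the power \<open>p\<close> of the supremum is at most
  the sum of the powers.
\<close>

lemma Lebesgue_norm_geometric_sum:
  fixes h :: "nat \<Rightarrow> 'a::euclidean_space \<Rightarrow> ennreal" and p :: ereal
  assumes p: "1 < p" and \<rho>: "0 < \<rho>" "\<rho> < 1"
  shows "\<exists>G\<ge>0. \<forall>H h Nm K. 0 \<le> K \<longrightarrow> H \<in> borel_measurable lebesgue \<longrightarrow> (\<forall>i. h i \<in> borel_measurable lebesgue) \<longrightarrow>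
    (\<forall>i. Lebesgue_norm p (h i) \<le> Nm) \<longrightarrow> (\<forall>y::'a. H y \<le> ennreal K * (\<Sum>i. ennreal (\<rho> ^ i) * h i y)) \<longrightarrow>
    Lebesgue_norm p H \<le> ennreal (K * G) * Nm"
proof (cases "p = \<infinity>")
  case True
  show ?thesis
  proof (intro exI[of _ "1 / (1 - \<rho>)"] conjI allI impI)
    show "0 \<le> 1 / (1 - \<rho>)" using \<rho> by simp
    fix H :: "'a \<Rightarrow> ennreal" and h Nm and K :: real
    assume K: "0 \<le> K" and H: "H \<in> borel_measurable lebesgue" "\<forall>y. H y \<le> ennreal K * (\<Sum>i. ennreal (\<rho> ^ i) * h i y)"
      and h: "\<forall>i. h i \<in> borel_measurable lebesgue" "\<forall>i. Lebesgue_norm p (h i) \<le> Nm"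
    have "AE y in lebesgue. h i y \<le> Nm" for i
      using esssup_AE[of "h i" lebesgue]
      by eventually_elim (use h(2) True in \<open>auto simp: Lebesgue_norm_def intro: order_trans\<close>)
    then have "AE y in lebesgue. \<forall>i. h i y \<le> Nm" by (simp add: AE_all_countable)
    then have "AE y in lebesgue. H y \<le> ennreal (K * (1 / (1 - \<rho>))) * Nm"
    proof eventually_elim
      case (elim y)
      have "H y \<le> ennreal K * (\<Sum>i. ennreal (\<rho> ^ i) * h i y)" using H(2) by blast
      also have "\<dots> \<le> ennreal K * (\<Sum>i. ennreal (\<rho> ^ i) * Nm)"
        using elim by (intro mult_left_mono suminf_le summableI) auto
      also have "\<dots> = ennreal (K * (1 / (1 - \<rho>))) * Nm"
        using \<rho> K by (subst ennreal_mult) (auto simp: suminf_ennreal_geometric mult.assoc simp del: suminf_ennreal)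
      finally show ?case .
    qed
    then show "Lebesgue_norm p H \<le> ennreal (K * (1 / (1 - \<rho>))) * Nm"
      using H(1) True by (simp add: Lebesgue_norm_def esssup_I)
  qed
next
  case False
  then obtain P where P: "p = ereal P" "1 < P" using p by (cases p) auto
  have recip: "recip p = 1 / P" using P by (simp add: recip_def one_ereal_def)
  have norm: "Lebesgue_norm p g = ennpow (\<integral>\<^sup>+y. ennpow (g y) P \<partial>lebesgue) (1 / P)" for g :: "'a \<Rightarrow> ennreal"
    using False P(1) by (simp add: Lebesgue_norm_def recip[unfolded P(1)])
  define s where "s = sqrt \<rho>"
  have s: "0 < s" "s < 1" "s * s = \<rho>" using \<rho> by (auto simp: s_def)
  define t where "t = s powr P"
  have t: "0 < t" "t < 1" using s P by (auto simp: t_def intro: powr_less_1)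
  define G where "G = 1 / (1 - s) * (1 / (1 - t)) powr (1 / P)"
  show ?thesis
  proof (intro exI[of _ G] conjI allI impI)
    show "0 \<le> G" using s by (simp add: G_def)
    fix H :: "'a \<Rightarrow> ennreal" and h Nm and K :: real
    assume K: "0 \<le> K" and H: "H \<in> borel_measurable lebesgue" "\<forall>y. H y \<le> ennreal K * (\<Sum>i. ennreal (\<rho> ^ i) * h i y)"
      and h: "\<forall>i. h i \<in> borel_measurable lebesgue" "\<forall>i. Lebesgue_norm p (h i) \<le> Nm"
    let ?c = "K * (1 / (1 - s))"
    have c: "0 \<le> ?c" using K s by simp
    have int_h: "(\<integral>\<^sup>+y. ennpow (h i y) P \<partial>lebesgue) \<le> ennpow Nm P" for i
      using h(2)[rule_format, of i] P(2) unfolding norm by (subst (asm) ennpow_le_iff) auto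
    have pt: "ennpow (H y) P \<le> ennreal (?c powr P) * (\<Sum>i. ennreal (t ^ i) * ennpow (h i y) P)" for y
    proof -
      define M where "M = (SUP i. ennreal (s ^ i) * h i y)"
      have "(\<Sum>i. ennreal (\<rho> ^ i) * h i y) \<le> (\<Sum>i. ennreal (s ^ i) * M)"
      proof (intro suminf_le summableI)
        fix i
        have "ennreal (\<rho> ^ i) = ennreal (s ^ i) * ennreal (s ^ i)"
          using s by (simp flip: ennreal_mult power_mult_distrib)
        moreover have "ennreal (s ^ i) * h i y \<le> M" unfolding M_def by (rule SUP_upper) simp
        ultimately show "ennreal (\<rho> ^ i) * h i y \<le> ennreal (s ^ i) * M"
          by (simp add: mult.assoc mult_left_mono)
      qed
      also have "\<dots> = ennreal (1 / (1 - s)) * M"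
        using s by (simp add: suminf_ennreal_geometric del: suminf_ennreal)
      finally have "H y \<le> ennreal K * (ennreal (1 / (1 - s)) * M)"
        using H(2) by (meson mult_left_mono order_trans zero_le)
      also have "\<dots> = ennreal ?c * M"
        using K s by (subst ennreal_mult) (auto simp: mult.assoc)
      finally have "ennpow (H y) P \<le> ennpow (ennreal ?c * M) P"
        using P by (intro ennpow_mono) auto
      also have "\<dots> = ennreal (?c powr P) * (SUP i. ennpow (ennreal (s ^ i) * h i y) P)"
        using P c by (simp add: M_def ennpow_mult ennpow_SUP ennpow_ennreal)
      also have "(SUP i. ennpow (ennreal (s ^ i) * h i y) P) \<le> (\<Sum>i. ennreal (t ^ i) * ennpow (h i y) P)"
      proof (rule SUP_least)
        fix i
        have "(s ^ i) powr P = t ^ i"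
          by (simp only: t_def power_powr[OF s(1)])
        then have "ennpow (ennreal (s ^ i) * h i y) P = ennreal (t ^ i) * ennpow (h i y) P"
          using P s by (simp add: ennpow_mult ennpow_ennreal)
        then show "ennpow (ennreal (s ^ i) * h i y) P \<le> (\<Sum>i. ennreal (t ^ i) * ennpow (h i y) P)"
          using suminf_ennreal_upper[of "\<lambda>i. ennreal (t ^ i) * ennpow (h i y) P" i] by simp
      qed
      finally show ?thesis by (simp add: mult_left_mono)
    qed
    have [measurable]: "h i \<in> borel_measurable lebesgue" for i using h(1) by blast
    have "(\<integral>\<^sup>+y. ennpow (H y) P \<partial>lebesgue) \<le> (\<integral>\<^sup>+y. ennreal (?c powr P) * (\<Sum>i. ennreal (t ^ i) * ennpow (h i y) P) \<partial>lebesgue)"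
      by (intro nn_integral_mono pt)
    also have "\<dots> = ennreal (?c powr P) * (\<Sum>i. ennreal (t ^ i) * (\<integral>\<^sup>+y. ennpow (h i y) P \<partial>lebesgue))"
      by (simp add: nn_integral_cmult nn_integral_suminf)
    also have "\<dots> \<le> ennreal (?c powr P) * (\<Sum>i. ennreal (t ^ i) * ennpow Nm P)"
      by (intro mult_left_mono suminf_le summableI int_h) auto
    also have "\<dots> = ennreal (?c powr P * (1 / (1 - t))) * ennpow Nm P"
      using t by (subst ennreal_mult) (auto simp: suminf_ennreal_geometric mult.assoc simp del: suminf_ennreal)
    finally have "Lebesgue_norm p H \<le> ennpow (ennreal (?c powr P * (1 / (1 - t))) * ennpow Nm P) (1 / P)"
      unfolding norm using P by (intro ennpow_mono) auto
    also have "\<dots> = ennreal (K * G) * Nm"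
    proof -
      have "(?c powr P * (1 / (1 - t))) powr (1 / P) = K * G"
      proof -
        have "(x powr P * y) powr (1 / P) = x * y powr (1 / P)" if "0 \<le> x" for x y
          using P(2) that by (simp add: powr_mult powr_powr)
        from this[OF c] show ?thesis by (simp only: G_def mult.assoc)
      qed
      then show ?thesis using P t by (simp add: ennpow_mult ennpow_ennreal ennpow_ennpow)
    qed
    finally show "Lebesgue_norm p H \<le> ennreal (K * G) * Nm" .
  qed
qed

lemma ball_integral_measurable:
  fixes G :: "'a::euclidean_space \<Rightarrow> ennreal"
  assumes G: "G \<in> borel_measurable lebesgue"
  shows "(\<lambda>y. \<integral>\<^sup>+x. G x * indicator (ball y r) x \<partial>lebesgue) \<in> borel_measurable lebesgue"
proof -
  obtain G' where G': "G' \<in> borel_measurable lborel" "AE x in lborel. G x = G' x"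
    using completion_ex_borel_measurable[OF G] by auto
  have [measurable]: "G' \<in> borel_measurable borel" using G'(1) by simp
  have eq: "(\<integral>\<^sup>+x. G x * indicator (ball y r) x \<partial>lebesgue) = (\<integral>\<^sup>+x. G' x * (if dist y x < r then 1 else 0) \<partial>lborel)" for y
    unfolding nn_integral_completion
    by (rule nn_integral_cong_AE, use G'(2) in eventually_elim) (auto split: split_indicator)
  have "(\<lambda>y. \<integral>\<^sup>+x. G' x * (if dist y x < r then 1 else 0) \<partial>lborel) \<in> borel_measurable borel"
    by measurable
  then show ?thesis unfolding eq by (intro measurable_completion) simp
qed

theorem theorem3p1:
  fixes w :: "'a::euclidean_space \<Rightarrow> real"
    and q \<alpha> \<gamma> :: real and p :: ereal
  assumes "0 < \<gamma>" "\<gamma> \<le> 1"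
    and "1 < q" "q \<le> \<alpha>" "ereal \<alpha> < p" "p \<le> \<infinity>"
    and "w \<in> Muckenhoupt q"
  shows "\<exists>C::real. C > 0 \<and> (\<forall>f \<in> amalgam_space w q p \<alpha>.
           intrinsic_square \<gamma> f \<in> borel_measurable lebesgue \<and>
           amalgam_norm w q p \<alpha> (intrinsic_square \<gamma> f)
             \<le> ennreal C * amalgam_norm w q p \<alpha> (\<lambda>x. ennreal (norm (f x))))"
proof -
  note \<gamma> = assms(1,2)
  have p1: "1 < p"
  proof -
    have "(1::ereal) < ereal \<alpha>" using assms(3,4) by (simp add: one_ereal_def)
    then show ?thesis using assms(5) by (rule less_trans)
  qed
  have recip: "0 \<le> recip p" "recip p < 1 / \<alpha>"
  proof -
    have "0 \<le> recip p \<and> recip p < 1 / \<alpha>"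
    proof (cases "p = \<infinity>")
      case True
      then show ?thesis using assms(3,4) by (simp add: recip_def)
    next
      case False
      then obtain P where P: "p = ereal P" using p1 by (cases p) auto
      then have "\<alpha> < P" using assms(5) by simp
      then show ?thesis using P assms(3,4) by (simp add: recip_def one_ereal_def frac_less2)
    qed
    then show "0 \<le> recip p" "recip p < 1 / \<alpha>" by auto
  qed
  \<comment> \<open>The exponent of \<open>w(B(y,r))\<close> in the amalgam norm.\<close>
  define e where "e = 1 / \<alpha> - 1 / q - recip p"
  have e: "e \<le> 0" "0 < e + 1 / q"
    using recip assms(3,4) by (auto simp: e_def frac_le diff_le_eq intro: order_trans[OF frac_le[of 1 1 q \<alpha>]])
  obtain A where A: "muckenhoupt_weight w q A"
    using muckenhoupt_weight_exists[OF assms(3,7)] by blast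
  interpret muckenhoupt_weight w q A by (rule A)
  define \<rho> where "\<rho> = shrink powr (e + 1 / q)"
  have \<rho>: "0 < \<rho>" "\<rho> < 1" using shrink e by (auto simp: \<rho>_def intro: powr_less_1)
  obtain K where K: "0 \<le> K" "\<And>f y r. 0 < r \<Longrightarrow> f \<in> borel_measurable lebesgue \<Longrightarrow> (\<And>R. set_integrable lebesgue (ball 0 R) f) \<Longrightarrow>
    ennreal (wball y r powr e) * snorm \<gamma> f y r \<le> ennreal K *
      (\<Sum>i. ennreal (\<rho> ^ i) * (ennreal (wball y (2 ^ Suc i * r) powr e) * fnorm f y (2 ^ Suc i * r)))"
    using amalgam_local_bound[OF \<gamma> e] unfolding \<rho>_def[symmetric] by blast
  obtain G where G: "0 \<le> G" "\<And>(H :: 'a \<Rightarrow> ennreal) h Nm K. 0 \<le> K \<Longrightarrow> H \<in> borel_measurable lebesgue \<Longrightarrow> (\<And>i. h i \<in> borel_measurable lebesgue) \<Longrightarrow>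
    (\<And>i. Lebesgue_norm p (h i) \<le> Nm) \<Longrightarrow> (\<And>y. H y \<le> ennreal K * (\<Sum>i. ennreal (\<rho> ^ i) * h i y)) \<Longrightarrow>
    Lebesgue_norm p H \<le> ennreal (K * G) * Nm"
    using Lebesgue_norm_geometric_sum[where 'a = 'a, OF p1 \<rho>] by blast
  have meas: "(\<lambda>y. ennreal (wball y r powr e) * weighted_norm w q (\<lambda>x. g x * indicator (ball y r) x)) \<in> borel_measurable lebesgue"
    if g [measurable]: "g \<in> borel_measurable lebesgue" for g :: "'a \<Rightarrow> ennreal" and r
  proof -
    have [measurable]: "(\<lambda>y. \<integral>\<^sup>+x. wt x * indicator (ball y r) x \<partial>lebesgue) \<in> borel_measurable lebesgue"
      by (rule ball_integral_measurable) measurable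
    have [measurable]: "(\<lambda>y. \<integral>\<^sup>+x. ennpow (g x) q * wt x * indicator (ball y r) x \<partial>lebesgue) \<in> borel_measurable lebesgue"
      by (rule ball_integral_measurable) measurable
    have "wball y r = enn2real (\<integral>\<^sup>+x. wt x * indicator (ball y r) x \<partial>lebesgue)" for y
      by (simp add: weight_of_ball wball_nonneg)
    then show ?thesis using assms(3) by (simp add: weighted_norm_ball)
  qed
  show ?thesis
  proof (intro exI[of _ "K * G + 1"] conjI ballI)
    show "0 < K * G + 1" using K(1) G(1) by (simp add: add_nonneg_pos)
    fix f assume f: "f \<in> amalgam_space w q p \<alpha>"
    define nf where "nf x = ennreal (norm (f x))" for x
    have f_meas [measurable]: "f \<in> borel_measurable lebesgue" using f by (simp add: amalgam_space_def)
    have nf_meas [measurable]: "nf \<in> borel_measurable lebesgue" unfolding nf_def by measurable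
    define Nm where "Nm = amalgam_norm w q p \<alpha> nf"
    have Nm: "Nm < \<infinity>" using f by (simp add: amalgam_space_def Nm_def nf_def[abs_def])
    define h where "h r y = ennreal (wball y r powr e) * fnorm f y r" for r y
    have h_meas: "h r \<in> borel_measurable lebesgue" for r
      unfolding h_def using meas[OF nf_meas, of r] by (simp add: nf_def)
    have h_norm: "Lebesgue_norm p (h r) \<le> Nm" if "0 < r" for r
      unfolding Nm_def amalgam_norm_def h_def nf_def e_def using that by (intro SUP_upper) auto
    \<comment> \<open>A finite amalgam norm gives finite local weighted norms around almost every centre, hence local integrability.\<close>
    have fint: "set_integrable lebesgue (ball 0 R) f" for R
    proof -
      define r where "r = max 1 (R + 1)"
      have r: "0 < r" by (simp add: r_def)
      have "AE y in lebesgue. h r y < \<infinity>"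
      proof (cases "p = \<infinity>")
        case True
        have "AE y in lebesgue. h r y \<le> esssup lebesgue (h r)" by (rule esssup_AE)
        then show ?thesis
          by eventually_elim (use h_norm[OF r] Nm True in \<open>auto simp: Lebesgue_norm_def intro: le_less_trans\<close>)
      next
        case False
        have "ennpow (\<integral>\<^sup>+y. ennpow (h r y) (real_of_ereal p) \<partial>lebesgue) (recip p) < top"
          using le_less_trans[OF h_norm[OF r] Nm] False by (simp add: Lebesgue_norm_def)
        then have "(\<integral>\<^sup>+y. ennpow (h r y) (real_of_ereal p) \<partial>lebesgue) \<noteq> \<infinity>"
          by (simp add: less_top)
        then have "AE y in lebesgue. ennpow (h r y) (real_of_ereal p) \<noteq> \<infinity>"
          using h_meas by (intro nn_integral_PInf_AE) auto
        then show ?thesis by eventually_elim (simp add: less_top)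
      qed
      moreover have "\<not> (AE y in lebesgue. y \<notin> ball (0::'a) 1)"
      proof
        assume "AE y in lebesgue. y \<notin> ball (0::'a) 1"
        then have "emeasure lebesgue (ball (0::'a) 1) = 0"
          by (subst (asm) AE_iff_measurable[of "ball 0 1"]) auto
        then show False using bvol_pos[of 1] by (simp only: emeasure_ball_bvol[OF zero_less_one]) simp
      qed
      ultimately obtain y where y: "h r y < \<infinity>" "y \<in> ball 0 1"
        by (metis (mono_tags, lifting) eventually_mono)
      have v: "0 < wball y r" by (rule wball_pos[OF r])
      have "fnorm f y r < top"
        using y(1) v by (auto simp: h_def ennreal_mult_less_top less_top)
      then have X: "(\<integral>\<^sup>+x. ennpow (nf x) q * wt x * indicator (ball y r) x \<partial>lebesgue) < top"
        using assms(3) by (simp add: weighted_norm_ball nf_def)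
      have "ennpow (\<integral>\<^sup>+x. nf x * indicator (ball y r) x \<partial>lebesgue) q * ennreal (wball y r) \<le>
        ennreal (A * bvol r powr q) * (\<integral>\<^sup>+x. ennpow (nf x) q * wt x * indicator (ball y r) x \<partial>lebesgue)"
        by (rule weighted_average_le[OF nf_meas r])
      also have "\<dots> < top" using X by (simp add: ennreal_mult_less_top)
      finally have fin: "(\<integral>\<^sup>+x. nf x * indicator (ball y r) x \<partial>lebesgue) < top"
        using v by (auto simp: ennreal_mult_less_top)
      have "(\<integral>\<^sup>+x. ennreal (norm (indicat_real (ball 0 R) x *\<^sub>R f x)) \<partial>lebesgue) \<le> (\<integral>\<^sup>+x. nf x * indicator (ball y r) x \<partial>lebesgue)"
      proof (intro nn_integral_mono)
        fix x
        have "x \<in> ball y r" if "x \<in> ball 0 R"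
          using that y(2) norm_triangle_ineq4[of y x] by (simp add: dist_norm r_def)
        then show "ennreal (norm (indicat_real (ball 0 R) x *\<^sub>R f x)) \<le> nf x * indicator (ball y r) x"
          by (auto simp: nf_def split: split_indicator)
      qed
      then show ?thesis
        unfolding set_integrable_def integrable_iff_bounded using fin by auto
    qed
    have S_borel: "intrinsic_square \<gamma> f \<in> borel_measurable borel"
      by (rule intrinsic_square_measurable[OF \<gamma> fint f_meas])
    then show S_meas: "intrinsic_square \<gamma> f \<in> borel_measurable lebesgue"
      by (intro measurable_completion) simp
    have "amalgam_norm w q p \<alpha> (intrinsic_square \<gamma> f) \<le> ennreal (K * G) * Nm"
      unfolding amalgam_norm_def
    proof (rule SUP_least)
      fix r :: real assume "r \<in> {0<..}"
      then have r: "0 < r" by simp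
      show "Lebesgue_norm p (\<lambda>y. ennreal (weight_of w (ball y r) powr (1 / \<alpha> - 1 / q - recip p)) *
          weighted_norm w q (\<lambda>x. intrinsic_square \<gamma> f x * indicator (ball y r) x)) \<le> ennreal (K * G) * Nm"
        unfolding e_def[symmetric]
      proof (rule G(2)[OF K(1) meas[OF S_meas], where h = "\<lambda>i. h (2 ^ Suc i * r)"])
        show "h (2 ^ Suc i * r) \<in> borel_measurable lebesgue" for i by (rule h_meas)
        show "Lebesgue_norm p (h (2 ^ Suc i * r)) \<le> Nm" for i using r by (intro h_norm) auto
        show "ennreal (wball y r powr e) * snorm \<gamma> f y r \<le> ennreal K * (\<Sum>i. ennreal (\<rho> ^ i) * h (2 ^ Suc i * r) y)" for y
          unfolding h_def by (rule K(2)[OF r f_meas fint])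
      qed
    qed
    also have "\<dots> \<le> ennreal (K * G + 1) * Nm"
      by (intro mult_right_mono ennreal_leI) auto
    finally show "amalgam_norm w q p \<alpha> (intrinsic_square \<gamma> f) \<le> ennreal (K * G + 1) * amalgam_norm w q p \<alpha> (\<lambda>x. ennreal (norm (f x)))"
      by (simp add: Nm_def nf_def[abs_def])
  qed
qed

end
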